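(* Let $\mathbf{k}$ be a commutative ring and $mB$ the matrix Brauer category over $\mathbf{k}$. For each $p,q\ge0$ there is a canonical $\mathbf{k}$-module isomorphism $$mB(p,q)\cong\bigoplus_{r\preceq p,q}M_{d_{q,r},d_{p,r}}(\mathbb{S}_r),$$ where $d_{p,r}=|\mathbb{B}^{+,m}(r,p)|=(\mathrm{rank}_{\mathbf{k}}B^+(r,p))/r!$ and $M_{m,n}$ denotes $m\times n$ matrices. If $p=q$, then there is an algebra isomorphism $$mB(p)\cong\bigoplus_{r\preceq p}M_{d_{p,r}}(\mathbb{S}_r),$$ where $mB(p)=mB(p,p)$. In particular, if $\mathbf{k}$ is a field of characteristic $0$, then the algebra $mB(p)$ is split semisimple.
   Context: For $p,q\ge0$, a $(p,q)$-Brauer diagram is a partition of $[p]^+\sqcup[q]^-=\{1^+,\dots,p^+\}\sqcup\{1^-,\dots,q^-\}$ into unordered pairs ($i^+$ top points, $i^-$ bottom points); $\mathbb{B}(p,q)$ is their set. Upward: no pair of two top points; downward: no pair of two bottom points; level: both; monotone: $(i-k)(j-l)>0$ for any two distinct pairs $\{i^+,j^-\},\{k^+,l^-\}$. $\mathbb{B}^+,\mathbb{B}^-,\mathbb{B}^0$: upward, downward, level diagrams; $\mathbb{B}^{\pm,m}$: monotone ones in $\mathbb{B}^\pm$. $B^+(r,p)$ is the free $\mathbf{k}$-module on $\mathbb{B}^+(r,p)$. $\overline f$ is $f$ with $i^\pm\leftrightarrow i^\mp$ exchanged. $p\preceq q$ iff $p\le q$ and $q-p$ even; $r\preceq p,q$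 means $r\preceq p$ and $r\preceq q$. $\mathbb{S}_r=\mathbf{k}[\mathfrak{S}_r]$, identified with the free module on $\mathbb{B}^0(r,r)$ via $\sigma\mapsto\{\{i^+,\sigma(i)^-\}\}_i$. Diagrams are concatenated by placing the right factor above the left one. Every $f\in\mathbb{B}(p,q)$ factors uniquely as $f=f^+f^0f^-$ with $f^+\in\mathbb{B}^{+,m}(t,q)$, $f^0\in\mathbb{B}^0(t,t)$, $f^-\in\mathbb{B}^{-,m}(p,t)$ for a unique $t$ (no closed loops arise in this factorization). Matrix Brauer category $mB$: objects are non-negative integers; $mB(p,q)$ is the free $\mathbf{k}$-module on $\mathbb{B}(p,q)$; composition of $f=f^+f^0f^-$ with $f^-\in\mathbb{B}^{-,m}(q,t)$ and $g=g^+g^0g^-$ with $g^+\in\mathbb{B}^{+,m}(s,q)$ is $f^+(f^0g^0)g^-$ if $t=s$ and $\overline{f^-}=g^+$, and $0$ otherwise; the identity of $p$ is $\sum_{r\preceq p}\sum_{f\in\mathbb{B}^{+,m}(r,p)}f\,\overline f$. The canonical isomorphism sends $f^+f^0f^-$ (with middle object $r$) to $f^0$ times the matrix unit in row $f^+\in\mathbb{B}^{+,m}(r,q)$ and column $\overline{f^-}\in\mathbb{B}^{+,m}(r,p)$. *)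

theory Defs
  imports Complex_Main "HOL-Algebra.Module" "HOL-Algebra.Sym_Groups" "HOL-Library.Disjoint_Sets"
begin

section \<open>Brauer diagrams\<close>

datatype point = Top nat | Bot nat

type_synonym diagram = "point set set"

definition points :: "nat \<Rightarrow> nat \<Rightarrow> point set" where
  "points p q = Top ` {1..p} \<union> Bot ` {1..q}"

definition brauer :: "nat \<Rightarrow> nat \<Rightarrow> diagram set" where
  "brauer p q = {f. partition_on (points p q) f \<and> (\<forall>e\<in>f. card e = 2)}"

definition upward :: "diagram \<Rightarrow> bool" where
  "upward f \<longleftrightarrow> (\<forall>i k. {Top i, Top k} \<notin> f)"

definition downward :: "diagram \<Rightarrow> bool" where
  "downward f \<longleftrightarrow> (\<forall>j l. {Bot j, Bot l} \<notin> f)"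

definition monotone_diagram :: "diagram \<Rightarrow> bool" where
  "monotone_diagram f \<longleftrightarrow>
     (\<forall>i j k l. {Top i, Bot j} \<in> f \<longrightarrow> {Top k, Bot l} \<in> f \<longrightarrow> {Top i, Bot j} \<noteq> {Top k, Bot l} \<longrightarrow>
        (int i - int k) * (int j - int l) > 0)"

definition brauer_up :: "nat \<Rightarrow> nat \<Rightarrow> diagram set" where
  "brauer_up p q = {f \<in> brauer p q. upward f}"

definition brauer_level :: "nat \<Rightarrow> nat \<Rightarrow> diagram set" where
  "brauer_level p q = {f \<in> brauer p q. upward f \<and> downward f}"

definition brauer_up_mono :: "nat \<Rightarrow> nat \<Rightarrow> diagram set" where
  "brauer_up_mono p q = {f \<in> brauer p q. upward f \<and> monotone_diagram f}"

definition brauer_down_mono :: "nat \<Rightarrow> nat \<Rightarrow> diagram set" where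
  "brauer_down_mono p q = {f \<in> brauer p q. downward f \<and> monotone_diagram f}"

fun flip_point :: "point \<Rightarrow> point" where
  "flip_point (Top i) = Bot i"
| "flip_point (Bot i) = Top i"

definition flip :: "diagram \<Rightarrow> diagram" where
  "flip f = (\<lambda>e. flip_point ` e) ` f"

text \<open>The identification of the symmetric group on \<open>{1..r}\<close> with \<open>brauer_level r r\<close>.\<close>

definition perm_diagram :: "nat \<Rightarrow> (nat \<Rightarrow> nat) \<Rightarrow> diagram" where
  "perm_diagram r \<sigma> = (\<lambda>i. {Top i, Bot (\<sigma> i)}) ` {1..r}"

definition parity_le :: "nat \<Rightarrow> nat \<Rightarrow> bool" (infix \<open>\<preceq>\<close> 50) where
  "p \<preceq> q \<longleftrightarrow> p \<le> q \<and> even (q - p)"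

subsection \<open>Concatenation\<close>

text \<open>In the concatenation of \<open>f\<close> (below) and \<open>g\<close> (above), the point \<open>(l, i)\<close> is the \<open>i\<close>-th
  point on level \<open>l\<close>, where level 0 is the top row of \<open>g\<close>, level 1 is the bottom row of \<open>g\<close> glued
  to the top row of \<open>f\<close>, and level 2 is the bottom row of \<open>f\<close>.\<close>

fun upper_pos :: "point \<Rightarrow> nat \<times> nat" where
  "upper_pos (Top i) = (0, i)"
| "upper_pos (Bot i) = (1, i)"

fun lower_pos :: "point \<Rightarrow> nat \<times> nat" where
  "lower_pos (Top i) = (1, i)"
| "lower_pos (Bot i) = (2, i)"

fun outer_pos :: "point \<Rightarrow> nat \<times> nat" where
  "outer_pos (Top i) = (0, i)"
| "outer_pos (Bot i) = (2, i)"

definition glued :: "diagram \<Rightarrow> diagram \<Rightarrow> ((nat \<times> nat) \<times> (nat \<times> nat)) set" where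
  "glued f g = {(upper_pos x, upper_pos y) | x y. {x, y} \<in> g} \<union>
               {(lower_pos x, lower_pos y) | x y. {x, y} \<in> f}"

text \<open>The right factor is placed above the left one.  Closed loops of the glued graph do not meet
  the outer points and are discarded; none occur wherever this operation is used below.\<close>

definition concat_diagram :: "diagram \<Rightarrow> diagram \<Rightarrow> diagram" (infixl \<open>\<bullet>\<close> 70) where
  "f \<bullet> g = {{x, y} | x y. x \<noteq> y \<and> (outer_pos x, outer_pos y) \<in> (glued f g)\<^sup>+}"

definition factorisation ::
    "nat \<Rightarrow> nat \<Rightarrow> diagram \<Rightarrow> nat \<Rightarrow> diagram \<Rightarrow> diagram \<Rightarrow> diagram \<Rightarrow> bool" where
  "factorisation p q f t fp f0 fm \<longleftrightarrow>
     fp \<in> brauer_up_mono t q \<and> f0 \<in> brauer_level t t \<and> fm \<in> brauer_down_mono p t \<and>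
     f = fp \<bullet> f0 \<bullet> fm"

definition factors :: "nat \<Rightarrow> nat \<Rightarrow> diagram \<Rightarrow> nat \<times> diagram \<times> diagram \<times> diagram" where
  "factors p q f = (THE (t, fp, f0, fm). factorisation p q f t fp f0 fm)"

definition mono_count :: "nat \<Rightarrow> nat \<Rightarrow> nat" where
  "mono_count p r = card (brauer_up_mono r p)"

text \<open>\<open>e m r\<close> numbers the monotone upward diagrams in \<open>brauer_up_mono r m\<close>, so that they can
  serve as row and column indices of matrices of size \<open>mono_count m r\<close>.\<close>

definition enumeration :: "(nat \<Rightarrow> nat \<Rightarrow> diagram \<Rightarrow> nat) \<Rightarrow> bool" where
  "enumeration e \<longleftrightarrow> (\<forall>m r. bij_betw (e m r) (brauer_up_mono r m) {..<mono_count m r})"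

lemma finite_brauer: "finite (brauer p q)"
proof (rule finite_subset)
  show "brauer p q \<subseteq> Pow (Pow (points p q))"
    by (auto simp: brauer_def partition_on_def)
  show "finite (Pow (Pow (points p q)))"
    by (simp add: points_def)
qed

lemma enumeration_exists: "\<exists>e. enumeration e"
proof -
  have "\<forall>m r. \<exists>h. bij_betw h (brauer_up_mono r m) {..<mono_count m r}"
    by (auto simp: brauer_up_mono_def mono_count_def lessThan_atLeast0 finite_brauer
        intro!: ex_bij_betw_finite_nat)
  then show ?thesis
    unfolding enumeration_def by metis
qed


section \<open>Modules and associative algebras over a commutative ring\<close>

text \<open>The library locale \<open>algebra\<close> requires commutativity.\<close>

locale associative_algebra = module R M + ring M for R and M (structure) +
  assumes smult_mult_left: "\<lbrakk>a \<in> carrier R; x \<in> carrier M; y \<in> carrier M\<rbrakk> \<Longrightarrow>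
      (a \<odot>\<^bsub>M\<^esub> x) \<otimes>\<^bsub>M\<^esub> y = a \<odot>\<^bsub>M\<^esub> (x \<otimes>\<^bsub>M\<^esub> y)"
    and smult_mult_right: "\<lbrakk>a \<in> carrier R; x \<in> carrier M; y \<in> carrier M\<rbrakk> \<Longrightarrow>
      x \<otimes>\<^bsub>M\<^esub> (a \<odot>\<^bsub>M\<^esub> y) = a \<odot>\<^bsub>M\<^esub> (x \<otimes>\<^bsub>M\<^esub> y)"

definition module_iso ::
    "('k, 'm) ring_scheme \<Rightarrow> ('k, 'a, 'n) module_scheme \<Rightarrow> ('k, 'b, 'o) module_scheme \<Rightarrow>
     ('a \<Rightarrow> 'b) \<Rightarrow> bool" where
  "module_iso R M N \<phi> \<longleftrightarrow>
     module R M \<and> module R N \<and> bij_betw \<phi> (carrier M) (carrier N) \<and>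
     (\<forall>x\<in>carrier M. \<forall>y\<in>carrier M. \<phi> (x \<oplus>\<^bsub>M\<^esub> y) = \<phi> x \<oplus>\<^bsub>N\<^esub> \<phi> y) \<and>
     (\<forall>a\<in>carrier R. \<forall>x\<in>carrier M. \<phi> (a \<odot>\<^bsub>M\<^esub> x) = a \<odot>\<^bsub>N\<^esub> \<phi> x)"

definition algebra_iso ::
    "('k, 'm) ring_scheme \<Rightarrow> ('k, 'a, 'n) module_scheme \<Rightarrow> ('k, 'b, 'o) module_scheme \<Rightarrow>
     ('a \<Rightarrow> 'b) \<Rightarrow> bool" where
  "algebra_iso R A B \<phi> \<longleftrightarrow>
     associative_algebra R A \<and> associative_algebra R B \<and> module_iso R A B \<phi> \<and>
     (\<forall>x\<in>carrier A. \<forall>y\<in>carrier A. \<phi> (x \<otimes>\<^bsub>A\<^esub> y) = \<phi> x \<otimes>\<^bsub>B\<^esub> \<phi> y) \<and>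
     \<phi> \<one>\<^bsub>A\<^esub> = \<one>\<^bsub>B\<^esub>"

text \<open>In the constructions below all index sets that occur are finite, so no finite support
  condition is imposed.  The fields \<open>mult\<close> and \<open>one\<close> are irrelevant for modules.\<close>

definition free_module :: "('k, 'm) ring_scheme \<Rightarrow> 's set \<Rightarrow> ('k, 's \<Rightarrow> 'k) module" where
  "free_module R S =
     \<lparr>carrier = S \<rightarrow>\<^sub>E carrier R, monoid.mult = undefined, one = undefined,
      zero = (\<lambda>s\<in>S. \<zero>\<^bsub>R\<^esub>), add = (\<lambda>x y. \<lambda>s\<in>S. x s \<oplus>\<^bsub>R\<^esub> y s),
      smult = (\<lambda>a x. \<lambda>s\<in>S. a \<otimes>\<^bsub>R\<^esub> x s)\<rparr>"

definition free_basis :: "('k, 'm) ring_scheme \<Rightarrow> 's set \<Rightarrow> 's \<Rightarrow> 's \<Rightarrow> 'k" where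
  "free_basis R S s = (\<lambda>t\<in>S. if t = s then \<one>\<^bsub>R\<^esub> else \<zero>\<^bsub>R\<^esub>)"

text \<open>A relation, since over the zero ring the rank is not unique.\<close>

definition free_of_rank ::
    "('k, 'm) ring_scheme \<Rightarrow> ('k, 'a, 'n) module_scheme \<Rightarrow> nat \<Rightarrow> bool" where
  "free_of_rank R M n \<longleftrightarrow> (\<exists>\<phi>. module_iso R M (free_module R {..<n}) \<phi>)"

definition group_algebra ::
    "('k, 'm) ring_scheme \<Rightarrow> ('g, 'n) monoid_scheme \<Rightarrow> ('k, 'g \<Rightarrow> 'k) module" where
  "group_algebra R G =
     (free_module R (carrier G))
       \<lparr>monoid.mult := (\<lambda>x y. \<lambda>g\<in>carrier G. \<Oplus>\<^bsub>R\<^esub>h\<in>carrier G. x h \<otimes>\<^bsub>R\<^esub> y (inv\<^bsub>G\<^esub> h \<otimes>\<^bsub>G\<^esub> g)),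
        one := free_basis R (carrier G) \<one>\<^bsub>G\<^esub>\<rparr>"

text \<open>Matrices with entries in a not necessarily commutative algebra \<open>A\<close>; rows and columns are
  numbered from 0.\<close>

definition matrix_module ::
    "('k, 'a, 'n) module_scheme \<Rightarrow> nat \<Rightarrow> nat \<Rightarrow> ('k, nat \<times> nat \<Rightarrow> 'a) module" where
  "matrix_module A m n =
     \<lparr>carrier = {..<m} \<times> {..<n} \<rightarrow>\<^sub>E carrier A, monoid.mult = undefined, one = undefined,
      zero = (\<lambda>ij\<in>{..<m} \<times> {..<n}. \<zero>\<^bsub>A\<^esub>),
      add = (\<lambda>x y. \<lambda>ij\<in>{..<m} \<times> {..<n}. x ij \<oplus>\<^bsub>A\<^esub> y ij),
      smult = (\<lambda>a x. \<lambda>ij\<in>{..<m} \<times> {..<n}. a \<odot>\<^bsub>A\<^esub> x ij)\<rparr>"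

definition matrix_algebra ::
    "('k, 'a, 'n) module_scheme \<Rightarrow> nat \<Rightarrow> ('k, nat \<times> nat \<Rightarrow> 'a) module" where
  "matrix_algebra A n =
     (matrix_module A n n)
       \<lparr>monoid.mult := (\<lambda>x y. \<lambda>(i, j)\<in>{..<n} \<times> {..<n}. \<Oplus>\<^bsub>A\<^esub>l\<in>{..<n}. x (i, l) \<otimes>\<^bsub>A\<^esub> y (l, j)),
        one := (\<lambda>(i, j)\<in>{..<n} \<times> {..<n}. if i = j then \<one>\<^bsub>A\<^esub> else \<zero>\<^bsub>A\<^esub>)\<rparr>"

definition matrix_single ::
    "('k, 'a, 'n) module_scheme \<Rightarrow> nat \<Rightarrow> nat \<Rightarrow> nat \<Rightarrow> nat \<Rightarrow> 'a \<Rightarrow> nat \<times> nat \<Rightarrow> 'a" where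
  "matrix_single A m n i j a =
     (\<lambda>ij\<in>{..<m} \<times> {..<n}. if ij = (i, j) then a else \<zero>\<^bsub>A\<^esub>)"

definition direct_sum ::
    "'i set \<Rightarrow> ('i \<Rightarrow> ('k, 'a, 'n) module_scheme) \<Rightarrow> ('k, 'i \<Rightarrow> 'a) module" where
  "direct_sum I M =
     \<lparr>carrier = (\<Pi>\<^sub>E i\<in>I. carrier (M i)),
      monoid.mult = (\<lambda>x y. \<lambda>i\<in>I. x i \<otimes>\<^bsub>M i\<^esub> y i), one = (\<lambda>i\<in>I. \<one>\<^bsub>M i\<^esub>),
      zero = (\<lambda>i\<in>I. \<zero>\<^bsub>M i\<^esub>), add = (\<lambda>x y. \<lambda>i\<in>I. x i \<oplus>\<^bsub>M i\<^esub> y i),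
      smult = (\<lambda>a x. \<lambda>i\<in>I. a \<odot>\<^bsub>M i\<^esub> x i)\<rparr>"

definition summand_embed ::
    "'i set \<Rightarrow> ('i \<Rightarrow> ('k, 'a, 'n) module_scheme) \<Rightarrow> 'i \<Rightarrow> 'a \<Rightarrow> 'i \<Rightarrow> 'a" where
  "summand_embed I M r x = (\<lambda>i\<in>I. if i = r then x else \<zero>\<^bsub>M i\<^esub>)"

definition ground_algebra :: "('k, 'm) ring_scheme \<Rightarrow> ('k, 'k) module" where
  "ground_algebra R =
     \<lparr>carrier = carrier R, monoid.mult = monoid.mult R, one = \<one>\<^bsub>R\<^esub>,
      zero = \<zero>\<^bsub>R\<^esub>, add = add R, smult = monoid.mult R\<rparr>"

text \<open>A finite-dimensional algebra over a field is split semisimple if it is isomorphic to a finite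
  product of full matrix algebras over that field.\<close>

definition split_semisimple ::
    "('k, 'm) ring_scheme \<Rightarrow> ('k, 'a, 'n) module_scheme \<Rightarrow> bool" where
  "split_semisimple R A \<longleftrightarrow>
     (\<exists>(N::nat) n \<phi>. (\<forall>i<N. n i > 0) \<and>
        algebra_iso R A (direct_sum {..<N} (\<lambda>i. matrix_algebra (ground_algebra R) (n i))) \<phi>)"

definition char_zero :: "('k, 'm) ring_scheme \<Rightarrow> bool" where
  "char_zero R \<longleftrightarrow> (\<forall>n::nat. n > 0 \<longrightarrow> [n] \<cdot>\<^bsub>R\<^esub> \<one>\<^bsub>R\<^esub> \<noteq> \<zero>\<^bsub>R\<^esub>)"


section \<open>The matrix Brauer category\<close>

text \<open>The module \<open>B\<^sup>+(r, p)\<close>.\<close>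

definition up_module :: "('k, 'm) ring_scheme \<Rightarrow> nat \<Rightarrow> nat \<Rightarrow> ('k, diagram \<Rightarrow> 'k) module" where
  "up_module R r p = free_module R (brauer_up r p)"

definition mB_hom :: "('k, 'm) ring_scheme \<Rightarrow> nat \<Rightarrow> nat \<Rightarrow> ('k, diagram \<Rightarrow> 'k) module" where
  "mB_hom R p q = free_module R (brauer p q)"

text \<open>The composite of two basis elements \<open>f\<close> from \<open>q\<close> to \<open>r\<close> and \<open>g\<close> from \<open>p\<close> to \<open>q\<close>, with
  \<open>None\<close> for the composite 0.\<close>

definition mB_basis_comp :: "nat \<Rightarrow> nat \<Rightarrow> nat \<Rightarrow> diagram \<Rightarrow> diagram \<Rightarrow> diagram option" where
  "mB_basis_comp p q r f g =
     (case factors q r f of (t, fp, f0, fm) \<Rightarrow> case factors p q g of (s, gp, g0, gm) \<Rightarrow>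
        if t = s \<and> flip fm = gp then Some (fp \<bullet> (f0 \<bullet> g0) \<bullet> gm) else None)"

definition mB_comp ::
    "('k, 'm) ring_scheme \<Rightarrow> nat \<Rightarrow> nat \<Rightarrow> nat \<Rightarrow> (diagram \<Rightarrow> 'k) \<Rightarrow> (diagram \<Rightarrow> 'k) \<Rightarrow> diagram \<Rightarrow> 'k"
  where
  "mB_comp R p q r x y =
     (\<lambda>h\<in>brauer p r.
        \<Oplus>\<^bsub>R\<^esub>fg\<in>{fg \<in> brauer q r \<times> brauer p q.
                mB_basis_comp p q r (fst fg) (snd fg) = Some h}.
          x (fst fg) \<otimes>\<^bsub>R\<^esub> y (snd fg))"

definition mB_id :: "('k, 'm) ring_scheme \<Rightarrow> nat \<Rightarrow> diagram \<Rightarrow> 'k" where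
  "mB_id R p =
     (\<Oplus>\<^bsub>mB_hom R p p\<^esub>r\<in>{r. r \<preceq> p}. \<Oplus>\<^bsub>mB_hom R p p\<^esub>f\<in>brauer_up_mono r p.
        free_basis R (brauer p p) (f \<bullet> flip f))"

definition mB_algebra :: "('k, 'm) ring_scheme \<Rightarrow> nat \<Rightarrow> ('k, diagram \<Rightarrow> 'k) module" where
  "mB_algebra R p = (mB_hom R p p)\<lparr>monoid.mult := mB_comp R p p p, one := mB_id R p\<rparr>"

text \<open>The prescribed values of the canonical isomorphism on the basis of \<open>mB_hom R p q\<close>: the
  diagram \<open>f\<^sup>+ f\<^sup>0 f\<^sup>-\<close> with middle object \<open>r\<close>, where \<open>f\<^sup>0\<close> is the diagram of the permutation
  \<open>\<sigma>\<close>, goes to \<open>\<sigma>\<close> times the matrix unit in row \<open>f\<^sup>+\<close> and column \<open>flip f\<^sup>-\<close> of the \<open>r\<close>-th summand.\<close>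

definition canonical_on_basis ::
    "('k, 'm) ring_scheme \<Rightarrow> (nat \<Rightarrow> nat \<Rightarrow> diagram \<Rightarrow> nat) \<Rightarrow> nat \<Rightarrow> nat \<Rightarrow>
     ((diagram \<Rightarrow> 'k) \<Rightarrow> nat \<Rightarrow> nat \<times> nat \<Rightarrow> (nat \<Rightarrow> nat) \<Rightarrow> 'k) \<Rightarrow> bool" where
  "canonical_on_basis R e p q \<phi> \<longleftrightarrow>
     (\<forall>r fp \<sigma> fm.
        r \<preceq> p \<and> r \<preceq> q \<and> fp \<in> brauer_up_mono r q \<and> \<sigma> \<in> carrier (sym_group r) \<and>
        fm \<in> brauer_down_mono p r \<longrightarrow>
        \<phi> (free_basis R (brauer p q) (fp \<bullet> perm_diagram r \<sigma> \<bullet> fm)) =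
        summand_embed {r. r \<preceq> p \<and> r \<preceq> q}
          (\<lambda>r. matrix_module (group_algebra R (sym_group r)) (mono_count q r) (mono_count p r)) r
          (matrix_single (group_algebra R (sym_group r)) (mono_count q r) (mono_count p r)
             (e q r fp) (e p r (flip fm))
             (free_basis R (carrier (sym_group r)) \<sigma>)))"

end

theory Submission
  imports Defs "HOL-Library.Poly_Mapping" "HOL-Library.Infinite_Set"
begin

text \<open>
  An upward diagram is a set of cups on the bottom row together with an injection of the top row into
  the remaining bottom points, and concatenating it below another diagram merely relabels the bottom
  points of the latter.  So the factorisation amounts to listing the free bottom and top points of a
  diagram in increasing order and recording the permutation by which its through strands connect
  them, and the canonical isomorphism is a reindexing of coordinates.

  In characteristic zero it remains to split the group algebras of the symmetric groups.  This is done
  over the rationals, without partitions, in the style of Okounkov and Vershik: the Jucys--Murphy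
  elements have integer spectrum, and together with the centre of the \<open>n\<close>-th group algebra they
  generate its centraliser in the next one.  Splitting idempotents along the tower therefore yields
  self-adjoint orthogonal idempotents \<open>e\<close> with sum 1 and \<open>e A e = \<rat> e\<close>, hence matrix units, and
  the resulting rational matrix coefficients can be read in every field of characteristic zero.
\<close>


section \<open>Rational group algebras\<close>

text \<open>The rationals meet two opposed needs. Their order makes the form
  \<open>star x * x\<close> definite, so that self-adjoint elements have no nilpotent part. They are
  not algebraically closed, however, so every eigenvalue and every scalar has to be shown rational.
  For eigenvalues this comes from an intertwiner between consecutive Jucys-Murphy elements, which
  keeps a root or moves it by 1 or -1. For corners a detour is needed: an element \<open>y\<close>
  of the corner of \<open>e\<close> at the next level need not commute with level \<open>n\<close>.
  Summing its conjugates under the \<open>n\<close>-th symmetric group gives an element of the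
  centraliser whose product with \<open>e\<close> is again a multiple of \<open>y\<close>; the
  factor is a sum of rational squares, one of them equal to 1, hence nonzero. So a statement on
  centralisers becomes one on corners. Square roots are avoided: matrix units are rescaled on one
  side only and need not be adjoint to each other. What is finally exported is a pair of mutually
  inverse rational matrices together with a rational multiplication rule; such identities survive
  the embedding of the rationals into any field of characteristic zero.\<close>

type_synonym 'g galg = "'g \<Rightarrow>\<^sub>0 rat"

abbreviation gcoeff :: "'g galg \<Rightarrow> 'g \<Rightarrow> rat" where
  "gcoeff \<equiv> Poly_Mapping.lookup"

abbreviation gkeys :: "'g galg \<Rightarrow> 'g set" where
  "gkeys \<equiv> Poly_Mapping.keys"

abbreviation scal :: "rat \<Rightarrow> 'g::group_add galg" where
  "scal c \<equiv> Poly_Mapping.single 0 c"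

abbreviation gel :: "'g \<Rightarrow> 'g::group_add galg" where
  "gel g \<equiv> Poly_Mapping.single g 1"

section \<open>Coefficients, scalars and expansion in group elements\<close>

lemma galg_expand:
  fixes x :: "'g::group_add galg"
  assumes "finite S" "gkeys x \<subseteq> S"
  shows "x = (\<Sum>g\<in>S. scal (gcoeff x g) * gel g)"
proof (rule poly_mapping_eqI)
  fix k
  show "gcoeff x k = gcoeff (\<Sum>g\<in>S. scal (gcoeff x g) * gel g) k"
    using assms by (auto simp: lookup_sum mult_single lookup_single when_def in_keys_iff)
qed

lemma galg_expand_keys: "x = (\<Sum>g\<in>gkeys x. scal (gcoeff x g) * gel g)" for x :: "'g::group_add galg"
  by (rule galg_expand) auto

lemma mult_galg_expand:
  "y * x = (\<Sum>g\<in>gkeys x. y * (scal (gcoeff x g) * gel g))" for x :: "'g::group_add galg"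
  using arg_cong[OF galg_expand_keys, of "(*) y" x] by (simp only: sum_distrib_left)

lemma galg_expand_mult:
  "x * y = (\<Sum>g\<in>gkeys x. (scal (gcoeff x g) * gel g) * y)" for x :: "'g::group_add galg"
  using arg_cong[OF galg_expand_keys, of "\<lambda>x. x * y" x] by (simp only: sum_distrib_right)

lemma scal_commute: "scal c * x = x * (scal c :: 'g::group_add galg)"
proof -
  have "scal c * (scal d * gel g) = (scal d * gel g) * (scal c :: 'g galg)" for d g
    by (simp add: mult_single mult.commute)
  then show ?thesis
    by (simp only: mult_galg_expand[of "scal c" x] galg_expand_mult[of x "scal c"])
qed

lemma scal_left_commute: "y * (scal c * x) = scal c * (y * (x :: 'g::group_add galg))"
  by (metis mult.assoc scal_commute)

lemma scal_sum: "scal (sum f I) = (\<Sum>i\<in>I. scal (f i) :: 'g::group_add galg)"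
  by (induction I rule: infinite_finite_induct) (simp_all add: single_add)

lemma scal_mult: "scal (a * b) = scal a * (scal b :: 'g::group_add galg)"
  by (simp add: mult_single)

lemma scal_assoc: "scal a * (scal b * x) = scal (a * b) * (x :: 'g::group_add galg)"
  by (simp add: scal_mult mult.assoc)

lemma scal_mult_scal: "(scal a * x) * (scal b * y) = scal (a * b) * (x * y :: 'g::group_add galg)"
  by (simp only: scal_mult mult.assoc scal_left_commute[of x])

lemma lookup_scal_mult [simp]: "gcoeff (scal c * x) g = c * gcoeff (x :: 'g::group_add galg) g"
proof -
  have "scal c * x = (\<Sum>g\<in>gkeys x. scal c * (scal (gcoeff x g) * gel g))"
    by (rule mult_galg_expand)
  then show ?thesis
    by (simp add: lookup_sum mult_single lookup_single when_def in_keys_iff)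
qed

lemma scal_cancel:
  assumes "scal a * x = (scal b * x :: 'g::group_add galg)" "x \<noteq> 0"
  shows "a = b"
proof -
  obtain g where "gcoeff x g \<noteq> 0"
    using \<open>x \<noteq> 0\<close> by (metis lookup_zero poly_mapping_eqI)
  then show ?thesis
    using arg_cong[OF assms(1), of "\<lambda>y. gcoeff y g"] by simp
qed

lemma scal_mult_zeroD:
  assumes "scal a * x = (0 :: 'g::group_add galg)" "x \<noteq> 0"
  shows "a = 0"
  using scal_cancel[of a x 0] assms by simp

lemma gel_mult_lookup: "gcoeff (gel u * x) g = gcoeff (x :: 'g::group_add galg) (- u + g)"
proof -
  have eq: "u + h = g \<longleftrightarrow> h = - u + g" for h
    by (metis add.assoc left_minus right_minus add_0)
  have "gel u * x = (\<Sum>h\<in>gkeys x. gel u * (scal (gcoeff x h) * gel h))"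
    by (rule mult_galg_expand)
  then show ?thesis
    by (simp add: lookup_sum mult_single lookup_single when_def eq in_keys_iff)
qed

lemma galg_mult_lookup:
  fixes x y :: "'g::group_add galg"
  assumes "finite S" "gkeys x \<subseteq> S"
  shows "gcoeff (x * y) g = (\<Sum>h\<in>S. gcoeff x h * gcoeff y (- h + g))"
proof -
  have "x * y = (\<Sum>h\<in>S. scal (gcoeff x h) * (gel h * y))"
    using galg_expand[OF assms] by (metis (no_types, lifting) mult.assoc sum.cong sum_distrib_right)
  then show ?thesis
    by (simp add: lookup_sum gel_mult_lookup)
qed

text \<open>The adjoint for the inner product in which the group elements are orthonormal:
  \<open>gcoeff (star x * y) 0\<close> is the inner product of \<open>x\<close> and
  \<open>y\<close>.\<close>

lift_definition star :: "'g::group_add galg \<Rightarrow> 'g galg" is "\<lambda>f g. f (- g)"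
proof -
  fix f :: "'g \<Rightarrow> rat"
  assume "finite {x. f x \<noteq> 0}"
  moreover have "{x. f (- x) \<noteq> 0} = uminus ` {x. f x \<noteq> 0}"
    by (auto intro!: image_eqI[where x = "- _"])
  ultimately show "finite {x. f (- x) \<noteq> 0}"
    by simp
qed

lemma star_add: "star (x + y) = star x + star y"
  by transfer simp

lemma star_diff: "star (x - y) = star x - star y"
  by transfer simp

lemma star_zero [simp]: "star 0 = 0"
  by transfer simp

lemma star_sum: "star (sum f S) = (\<Sum>i\<in>S. star (f i))"
  by (induction S rule: infinite_finite_induct) (auto simp: star_add)

lemma star_single [simp]: "star (Poly_Mapping.single g c) = Poly_Mapping.single (- g) c"
  by transfer (auto simp: fun_eq_iff when_def)

lemma star_one [simp]: "star 1 = (1 :: 'g::group_add galg)"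
  using star_single[of 0 1] by simp

lemma star_star [simp]: "star (star x) = x"
  by transfer simp

lemma star_mult: "star (x * y) = star y * star (x :: 'g::group_add galg)"
proof -
  have x: "x = (\<Sum>g\<in>gkeys x. scal (gcoeff x g) * gel g)"
    and y: "y = (\<Sum>g\<in>gkeys y. scal (gcoeff y g) * gel g)"
    by (rule galg_expand; auto)+
  have "star (x * y) = (\<Sum>g\<in>gkeys x. \<Sum>h\<in>gkeys y.
      star ((scal (gcoeff x g) * gel g) * (scal (gcoeff y h) * gel h)))"
    by (subst galg_expand_mult) (simp only: mult_galg_expand[of _ y] star_sum)
  also have "\<dots> = (\<Sum>g\<in>gkeys x. \<Sum>h\<in>gkeys y.
      star (scal (gcoeff y h) * gel h) * star (scal (gcoeff x g) * gel g))"
    by (simp add: mult_single minus_add mult.commute)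
  also have "\<dots> = (\<Sum>h\<in>gkeys y. star (scal (gcoeff y h) * gel h)) *
      (\<Sum>g\<in>gkeys x. star (scal (gcoeff x g) * gel g))"
    by (simp only: sum_distrib_left sum_distrib_right)
  also have "\<dots> = star y * star x"
    by (simp only: star_sum[symmetric] x[symmetric] y[symmetric])
  finally show ?thesis .
qed

text \<open>The inner product of \<open>x\<close> with itself. Its definiteness is special to an
  ordered coefficient field and takes over the role of semisimplicity in what follows.\<close>

lemma lookup_star_mult_self:
  "gcoeff (star x * x) 0 = (\<Sum>g\<in>gkeys x. (gcoeff x g)\<^sup>2)" for x :: "'g::group_add galg"
proof -
  have "gkeys (star x) = uminus ` gkeys x"
    by transfer (auto intro!: image_eqI[where x = "- _"])
  then have "gcoeff (star x * x) 0 = (\<Sum>g\<in>uminus ` gkeys x. gcoeff (star x) g * gcoeff x (- g))"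
    by (subst galg_mult_lookup[of "uminus ` gkeys x"]) auto
  also have "\<dots> = (\<Sum>g\<in>gkeys x. gcoeff x g * gcoeff x g)"
    by (subst sum.reindex) (auto simp: inj_on_def star.rep_eq)
  finally show ?thesis
    by (simp add: power2_eq_square)
qed

lemma star_mult_self_zeroD:
  assumes "star x * x = (0 :: 'g::group_add galg)"
  shows "x = 0"
proof (rule poly_mapping_eqI)
  fix g
  have "(\<Sum>g\<in>gkeys x. (gcoeff x g)\<^sup>2) = 0"
    using assms lookup_star_mult_self[of x] by simp
  then have "\<forall>g\<in>gkeys x. (gcoeff x g)\<^sup>2 = 0"
    by (subst (asm) sum_nonneg_eq_0_iff) auto
  then show "gcoeff x g = gcoeff 0 g"
    by (auto simp: in_keys_iff)
qed

text \<open>With \<open>x\<close> self-adjoint, \<open>star (x * y) * (x * y)\<close> is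
  \<open>star y * (x * (x * y))\<close>, so definiteness applies. This is what makes self-adjoint
  elements diagonalisable.\<close>

lemma selfadjoint_square_zeroD:
  assumes "star x = x" "x * (x * y) = (0 :: 'g::group_add galg)"
  shows "x * y = 0"
proof (rule star_mult_self_zeroD)
  show "star (x * y) * (x * y) = 0"
    using assms by (simp add: star_mult mult.assoc)
qed


subsection \<open>Spectral decomposition\<close>

text \<open>A polynomial in \<open>X\<close> that splits over the rationals, given by its roots with
  multiplicity. The equation \<open>shift_prod X ds = 0\<close> expresses that \<open>X\<close> has
  rational spectrum inside \<open>ds\<close>, without a vector space to act on.\<close>

definition shift_prod :: "'g::group_add galg \<Rightarrow> rat list \<Rightarrow> 'g galg" where
  "shift_prod X ds = prod_list (map (\<lambda>d. X - scal d) ds)"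

lemma shift_prod_simps [simp]:
  "shift_prod X [] = 1"
  "shift_prod X (d # ds) = (X - scal d) * shift_prod X ds"
  by (simp_all add: shift_prod_def)

lemma shift_prod_append: "shift_prod X (xs @ ys) = shift_prod X xs * shift_prod X ys"
  by (simp add: shift_prod_def)

lemma shift_prod_commute:
  assumes "X * y = y * (X :: 'g::group_add galg)"
  shows "shift_prod X ds * y = y * shift_prod X ds"
proof (induction ds)
  case (Cons d ds)
  have "(X - scal d) * (shift_prod X ds * y) = (X - scal d) * y * shift_prod X ds"
    using Cons by (simp add: mult.assoc)
  also have "(X - scal d) * y = y * (X - scal d)"
    using assms scal_commute[of d y] by (simp add: algebra_simps)
  finally show ?case
    by (simp add: mult.assoc)
qed simp

lemma shift_prod_remove1:
  assumes "c \<in> set ds"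
  shows "shift_prod X ds = (X - scal c) * shift_prod X (remove1 c ds)"
  using assms
proof (induction ds)
  case (Cons d ds)
  have "(X - scal d) * (X - scal c) = (X - scal c) * (X - scal d)"
    using scal_commute[of d X] scal_commute[of c X] scal_commute[of d "scal c"]
    by (simp add: algebra_simps)
  then show ?case
    using Cons by (auto simp: mult.assoc[symmetric])
qed simp

lemma shift_prod_eigen:
  assumes "X * y = scal c * (y :: 'g::group_add galg)"
  shows "shift_prod X ds * y = scal (\<Prod>d\<leftarrow>ds. c - d) * y"
proof (induction ds)
  case (Cons d ds)
  have "shift_prod X (d # ds) * y = (X - scal d) * (scal (\<Prod>d\<leftarrow>ds. c - d) * y)"
    using Cons by (simp add: mult.assoc)
  also have "\<dots> = scal (\<Prod>d\<leftarrow>ds. c - d) * ((X - scal d) * y)"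
    by (simp add: scal_left_commute)
  also have "(X - scal d) * y = scal (c - d) * y"
    using assms by (simp add: algebra_simps single_diff)
  finally show ?case
    by (simp add: scal_assoc mult.commute)
qed simp

lemma shift_prod_star:
  assumes "star X = X"
  shows "star (shift_prod X ds) = (shift_prod X ds :: 'g::group_add galg)"
proof (induction ds)
  case (Cons d ds)
  have "shift_prod X ds * (X - scal d) = (X - scal d) * shift_prod X ds"
    by (rule shift_prod_commute) (simp add: algebra_simps scal_commute)
  then show ?case
    using assms Cons by (simp add: star_mult star_diff)
qed simp

text \<open>The idempotent splits off one eigenvalue at a time; self-adjointness of \<open>X\<close> makes repeated
  factors redundant.\<close>

lemma spectral_decomposition:
  fixes X e :: "'g::group_add galg"
  assumes "star X = X" "star e = e" "e * e = e" "X * e = e * X" "shift_prod X ds * e = 0"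
    and "X \<in> A" "e \<in> A"
    and A_closed: "\<And>x y. x \<in> A \<Longrightarrow> y \<in> A \<Longrightarrow> x * y \<in> A" "\<And>x y. x \<in> A \<Longrightarrow> y \<in> A \<Longrightarrow> x - y \<in> A"
      "\<And>c. scal c \<in> A"
  shows "\<exists>C ec. finite (C :: rat set) \<and> (\<Sum>c\<in>C. ec c) = e \<and>
     (\<forall>c\<in>C. ec c \<in> A \<and> star (ec c) = ec c \<and> X * ec c = scal c * ec c \<and> ec c * e = ec c \<and> e * ec c = ec c \<and>
       ec c * ec c = ec c \<and> (\<forall>d\<in>C. c \<noteq> d \<longrightarrow> ec c * ec d = 0))"
  using assms(2-5,7)
proof (induction ds arbitrary: e)
  case Nil
  then show ?case
    by (intro exI[of _ "{}"]) auto
next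
  case (Cons c ds)
  have prodA: "shift_prod X xs \<in> A" for xs
  proof (induction xs)
    case Nil
    then show ?case using A_closed(3)[of 1] by simp
  next
    case (Cons d xs)
    then show ?case
      using A_closed \<open>X \<in> A\<close> by simp
  qed
  show ?case
  proof (cases "c \<in> set ds")
    case True
    let ?y = "shift_prod X (remove1 c ds) * e"
    have "(X - scal c) * ((X - scal c) * ?y) = 0"
      using Cons.prems(4) shift_prod_remove1[OF True, of X] by (simp add: mult.assoc)
    then have "(X - scal c) * ?y = 0"
      using selfadjoint_square_zeroD[of "X - scal c" ?y] \<open>star X = X\<close> by (simp add: star_diff)
    then have "shift_prod X ds * e = 0"
      using shift_prod_remove1[OF True, of X] by (simp add: mult.assoc)
    then show ?thesis
      using Cons by blast
  next
    case False
    \<comment> \<open>Below, \<open>p\<close> is the Lagrange polynomial evaluated at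
      \<open>X\<close>, with value 1 at \<open>c\<close> and 0 at the roots in \<open>ds\<close>;
      \<open>a\<close> is its normalising constant, nonzero because \<open>c\<close> is not among
      these roots.\<close>
    define a where "a = (\<Prod>d\<leftarrow>ds. c - d)"
    have "a \<noteq> 0"
      using False unfolding a_def by (induction ds) auto
    define p where "p = scal (1 / a) * shift_prod X ds"
    define e' where "e' = p * e"
    have pe: "p * e = e * p"
      using shift_prod_commute[OF \<open>X * e = e * X\<close>, of ds]
      by (simp add: p_def mult.assoc scal_left_commute)
    have Xp: "X * p = p * X"
      using shift_prod_commute[of X X ds] by (simp add: p_def mult.assoc scal_left_commute)
    have "(X - scal c) * e' = scal (1 / a) * (shift_prod X (c # ds) * e)"
      by (simp add: e'_def p_def mult.assoc scal_left_commute)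
    then have Xe': "X * e' = scal c * e'"
      using Cons.prems by (simp add: left_diff_distrib)
    have pe': "p * e' = e'"
      using shift_prod_eigen[OF Xe', of ds] \<open>a \<noteq> 0\<close>
      by (simp add: p_def mult.assoc scal_assoc flip: a_def)
    have ee': "e * e' = e'" "e' * e = e'"
      using Cons.prems pe by (metis e'_def mult.assoc)+
    have "e' * e' = e'"
      by (metis e'_def ee'(1) mult.assoc pe')
    have "star p = p"
      using shift_prod_star[OF \<open>star X = X\<close>, of ds] by (simp add: p_def star_mult scal_commute)
    then have "star e' = e'"
      using Cons.prems pe by (simp add: e'_def star_mult)
    have Xe'c: "X * e' = e' * X"
      by (metis Xp Cons.prems(3) e'_def mult.assoc)
    have "e' \<in> A"
      using A_closed prodA Cons.prems(5) by (simp add: e'_def p_def)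
    have "shift_prod X ds * e = scal a * e'"
      using \<open>a \<noteq> 0\<close> by (simp add: e'_def p_def mult.assoc scal_assoc)
    moreover have "shift_prod X ds * e' = scal a * e'"
      using shift_prod_eigen[OF Xe'] by (simp add: a_def)
    ultimately have "shift_prod X ds * (e - e') = 0"
      by (simp add: right_diff_distrib)
    then obtain C ec where C: "finite C" "(\<Sum>c\<in>C. ec c) = e - e'"
      and ec: "\<And>c. c \<in> C \<Longrightarrow> ec c \<in> A \<and> star (ec c) = ec c \<and> X * ec c = scal c * ec c \<and>
         ec c * (e - e') = ec c \<and> (e - e') * ec c = ec c \<and> ec c * ec c = ec c \<and>
         (\<forall>d\<in>C. c \<noteq> d \<longrightarrow> ec c * ec d = 0)"
      using Cons.IH[of "e - e'"] Cons.prems ee' \<open>e' * e' = e'\<close> \<open>star e' = e'\<close> Xe'c \<open>e' \<in> A\<close> A_closed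
      by (auto simp: star_diff algebra_simps)
    have ece: "ec d * e = ec d" "e * ec d = ec d" "ec d * e' = 0" "e' * ec d = 0" if "d \<in> C" for d
    proof -
      have 1: "(e - e') * e = e - e'" "e * (e - e') = e - e'" "(e - e') * e' = 0" "e' * (e - e') = 0"
        using Cons.prems ee' \<open>e' * e' = e'\<close> by (simp_all add: algebra_simps)
      show "ec d * e = ec d" "e * ec d = ec d" "ec d * e' = 0" "e' * ec d = 0"
        using ec[OF that] 1 by (metis mult.assoc mult_zero_left mult_zero_right)+
    qed
    \<comment> \<open>The index set from the induction hypothesis may still contain
      \<open>c\<close>. Its idempotent then vanishes: on \<open>e - e'\<close> the polynomial with
      roots \<open>ds\<close> is zero, but its value at \<open>c\<close> is \<open>a\<close>. So the
      index \<open>c\<close> is free for \<open>e'\<close>.\<close>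
    have "ec c = 0" if "c \<in> C"
    proof -
      have "shift_prod X ds * ec c = scal a * ec c"
        using shift_prod_eigen[of X "ec c" c ds] ec[OF that] by (simp add: a_def)
      moreover have "shift_prod X ds * ec c = 0"
        using \<open>shift_prod X ds * (e - e') = 0\<close> ec[OF that]
        by (metis mult.assoc mult_zero_left)
      ultimately show ?thesis
        using \<open>a \<noteq> 0\<close> scal_mult_zeroD by metis
    qed
    then have sum0: "(\<Sum>d\<in>C - {c}. ec d) = e - e'"
      using C by (cases "c \<in> C") (simp_all add: sum.remove)
    define ec' where "ec' = (\<lambda>d. if d = c then e' else ec d)"
    have "(\<Sum>d\<in>insert c C. ec' d) = e' + (\<Sum>d\<in>C - {c}. ec' d)"
      using C(1) by (subst insert_Diff_single[symmetric], subst sum.insert) (auto simp: ec'_def)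
    also have "(\<Sum>d\<in>C - {c}. ec' d) = (\<Sum>d\<in>C - {c}. ec d)"
      by (rule sum.cong) (auto simp: ec'_def)
    finally have "(\<Sum>d\<in>insert c C. ec' d) = e"
      using sum0 by simp
    moreover have "ec' d \<in> A \<and> star (ec' d) = ec' d \<and> X * ec' d = scal d * ec' d \<and>
        ec' d * e = ec' d \<and> e * ec' d = ec' d \<and> ec' d * ec' d = ec' d \<and>
         (\<forall>b\<in>insert c C. d \<noteq> b \<longrightarrow> ec' d * ec' b = 0)" if "d \<in> insert c C" for d
      using that ec ece ee' Xe' \<open>e' * e' = e'\<close> \<open>star e' = e'\<close> \<open>e' \<in> A\<close>
      by (auto simp: ec'_def)
    ultimately show ?thesis
      using C(1) by (intro exI[of _ "insert c C"] exI[of _ ec']) auto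
  qed
qed

text \<open>If \<open>a\<close> and \<open>b\<close> satisfy the relations of consecutive Jucys--Murphy elements, then the
  intertwiner \<open>s (a - b) + 1\<close> carries the spectrum of \<open>b\<close> to that of \<open>a\<close>, up to the factor
  \<open>1 - (a - b)\<^sup>2\<close>.\<close>

lemma shift_prod_intertwine:
  fixes a b s :: "'g::group_add galg"
  assumes ss: "s * s = 1" and sa: "s * a = b * s - 1" and ab: "a * b = b * a"
    and a0: "shift_prod a ds = 0"
  shows "\<exists>ds'. shift_prod b ds' = 0"
proof -
  have sb: "s * b = a * s + 1"
  proof -
    have "s * (b * s) = s * (s * a + 1)" using sa by simp
    then have "s * b * s = a + s" using ss by (simp add: algebra_simps flip: mult.assoc)
    then have "s * b * s * s = (a + s) * s" by simp
    then show ?thesis using ss by (simp add: algebra_simps)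
  qed
  \<comment> \<open>The summand 1 compensates the inhomogeneous term of \<open>sa\<close>, so that
    \<open>a * P = P * b\<close> holds exactly.\<close>
  define P where "P = s * (a - b) + 1"
  have aP: "a * P = P * b"
  proof -
    have "a * s = s * b - 1" using sb by simp
    moreover have "a * P = (a * s) * (a - b) + a"
      by (simp add: P_def distrib_left mult.assoc)
    ultimately have "a * P = (s * b - 1) * (a - b) + a"
      by simp
    also have "\<dots> = P * b"
      using ab by (simp add: P_def algebra_simps)
    finally show ?thesis .
  qed
  have "(s * a) * s = b - s" "(s * b) * s = a + s"
    unfolding sa sb using ss by (simp_all add: left_diff_distrib distrib_right mult.assoc)
  then have sas: "s * (a * s) = b - s" and sbs: "s * (b * s) = a + s"
    by (simp_all add: mult.assoc)
  have PP: "P * P = 1 - (a - b) * (a - b)"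
  proof -
    have "P * P = (s * (a * s) - s * (b * s)) * (a - b) + s * (a - b) + s * (a - b) + 1"
      by (simp add: P_def algebra_simps)
    also have "\<dots> = (b - a - s - s) * (a - b) + s * (a - b) + s * (a - b) + 1"
      unfolding sas sbs by (simp add: algebra_simps)
    also have "\<dots> = 1 - (a - b) * (a - b)"
      by (simp add: algebra_simps)
    finally show ?thesis .
  qed
  have qP: "shift_prod a xs * P = P * shift_prod b xs" for xs
  proof (induction xs)
    case (Cons d xs)
    have "(a - scal d) * P = P * (b - scal d)"
      using aP scal_commute[of d P] by (simp add: algebra_simps)
    then show ?case
      using Cons by (simp add: mult.assoc) (simp add: mult.assoc[symmetric])
  qed simp
  have sq: "(1 - x * x) * y = y * (1 - x * x)" if "x * y = y * x" for x y :: "'g galg"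
  proof -
    have "x * (x * y) = y * (x * x)"
      by (metis that mult.assoc)
    then show ?thesis
      by (simp add: left_diff_distrib right_diff_distrib mult.assoc)
  qed
  define y0 where "y0 = shift_prod b ds"
  \<comment> \<open>The polynomial with roots \<open>ds\<close> in \<open>b\<close> maps everything
    into the kernel of \<open>P\<close>, hence into the part where \<open>(a - b) * (a - b)\<close>
    acts as 1. Only this part still needs an annihilating polynomial.\<close>
  have "P * y0 = 0"
    using qP[of ds] a0 by (simp add: y0_def)
  then have y0: "(1 - (a - b) * (a - b)) * y0 = 0"
    using PP by (metis mult.assoc mult_zero_right)
  \<comment> \<open>Where \<open>(a - b) * (a - b)\<close> acts as 1 and \<open>a\<close> acts as
    \<open>c\<close>, the eigenvalues of \<open>b\<close> differ from \<open>c\<close> by 1 or -1.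
    Hence every root of \<open>a\<close> is replaced by its two neighbours.\<close>
  have "shift_prod b (concat (map (\<lambda>c. [c + 1, c - 1]) cs)) * y = 0"
    if "shift_prod a cs * y = 0" "(1 - (a - b) * (a - b)) * y = 0" for cs y
    using that
  proof (induction cs arbitrary: y)
    case (Cons c cs)
    let ?z = "shift_prod b (concat (map (\<lambda>c. [c + 1, c - 1]) cs)) * y"
    have comm: "(a - scal c) * shift_prod a cs = shift_prod a cs * (a - scal c)"
      by (rule shift_prod_commute[symmetric]) (simp add: algebra_simps scal_commute)
    have comm2: "shift_prod b xs * (a - scal c) = (a - scal c) * shift_prod b xs" for xs
      by (rule shift_prod_commute) (simp add: algebra_simps scal_commute ab)
    have comm3: "(1 - (a - b) * (a - b)) * (a - scal c) = (a - scal c) * (1 - (a - b) * (a - b))"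
    proof -
      have "(a - b) * (a - scal c) = (a - scal c) * (a - b)"
        using ab by (simp add: algebra_simps scal_commute)
      then show ?thesis
        by (rule sq)
    qed
    have comm4: "shift_prod b xs * (1 - (a - b) * (a - b)) = (1 - (a - b) * (a - b)) * shift_prod b xs" for xs
    proof (rule shift_prod_commute)
      have "(a - b) * b = b * (a - b)"
        using ab by (simp add: algebra_simps)
      then show "b * (1 - (a - b) * (a - b)) = (1 - (a - b) * (a - b)) * b"
        by (rule sq[symmetric])
    qed
    have "shift_prod b (concat (map (\<lambda>c. [c + 1, c - 1]) cs)) * ((a - scal c) * y) = 0"
    proof (rule Cons.IH)
      show "shift_prod a cs * ((a - scal c) * y) = 0"
        using Cons.prems(1) by (simp add: comm[symmetric] flip: mult.assoc)
      have "(1 - (a - b) * (a - b)) * ((a - scal c) * y) = (a - scal c) * ((1 - (a - b) * (a - b)) * y)"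
        by (simp only: comm3 flip: mult.assoc)
      then show "(1 - (a - b) * (a - b)) * ((a - scal c) * y) = 0"
        using Cons.prems(2) by simp
    qed
    then have "(a - scal c) * ?z = 0"
      by (simp only: comm2 flip: mult.assoc)
    then have az: "a * ?z = scal c * ?z"
      by (simp add: algebra_simps)
    have z2: "(1 - (a - b) * (a - b)) * ?z = 0"
      using arg_cong[OF Cons.prems(2), of "(*) (shift_prod b (concat (map (\<lambda>c. [c + 1, c - 1]) cs)))"]
      by (simp only: comm4 mult_zero_right flip: mult.assoc)
    have abz: "(a - b) * ?z = (scal c - b) * ?z"
      using az by (simp add: left_diff_distrib)
    have "(a - b) * ((a - b) * ?z) = (a - b) * ((scal c - b) * ?z)"
      using abz by simp
    also have "\<dots> = (scal c - b) * ((a - b) * ?z)"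
    proof -
      have "(a - b) * (scal c - b) = (scal c - b) * (a - b)"
        using ab by (simp add: algebra_simps scal_commute)
      then show ?thesis by (simp only: flip: mult.assoc)
    qed
    also have "\<dots> = (scal c - b) * ((scal c - b) * ?z)"
      using abz by simp
    finally have e1: "?z = (scal c - b) * ((scal c - b) * ?z)"
      using z2 by (simp add: left_diff_distrib mult.assoc)
    have "(b - scal (c + 1)) * (b - scal (c - 1)) = (scal c - b) * (scal c - b) - 1"
    proof -
      have "scal (c + 1) = scal c + (1 :: 'g galg)" "scal (c - 1) = scal c - (1 :: 'g galg)"
        by (simp_all add: single_add single_diff)
      then show ?thesis
        unfolding \<open>scal (c + 1) = _\<close> \<open>scal (c - 1) = _\<close> by (simp add: algebra_simps scal_commute[of c b])
    qed
    then have "(b - scal (c + 1)) * ((b - scal (c - 1)) * ?z) = ((scal c - b) * (scal c - b) - 1) * ?z"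
      by (simp only: flip: mult.assoc)
    also have "\<dots> = (scal c - b) * ((scal c - b) * ?z) - ?z"
      by (simp only: left_diff_distrib[of "(scal c - b) * (scal c - b)" 1 ?z] mult_1_left mult.assoc)
    also have "\<dots> = 0"
      by (simp only: e1[symmetric] diff_self)
    finally have "(b - scal (c + 1)) * ((b - scal (c - 1)) * ?z) = 0" .
    then show ?case
      by (simp add: mult.assoc)
  qed simp
  from this[OF _ y0, of ds] have "shift_prod b (concat (map (\<lambda>c. [c + 1, c - 1]) ds) @ ds) = 0"
    using a0 by (simp add: shift_prod_append y0_def)
  then show ?thesis ..
qed


subsection \<open>Permutations of the natural numbers\<close>

text \<open>Composition is written additively, since the convolution product of \<open>\<Rightarrow>\<^sub>0\<close> requires an
  additive monoid.\<close>

typedef fperm = "{p :: nat \<Rightarrow> nat. bij p \<and> finite {i. p i \<noteq> i}}"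
  morphisms fapp Fperm
  by (rule exI[of _ id]) simp

setup_lifting type_definition_fperm

instantiation fperm :: group_add
begin

lift_definition zero_fperm :: fperm is id
  by simp

lift_definition plus_fperm :: "fperm \<Rightarrow> fperm \<Rightarrow> fperm" is "(\<circ>)"
proof -
  fix p q :: "nat \<Rightarrow> nat"
  assume p: "bij p \<and> finite {i. p i \<noteq> i}" and q: "bij q \<and> finite {i. q i \<noteq> i}"
  have "{i. (p \<circ> q) i \<noteq> i} \<subseteq> {i. p i \<noteq> i} \<union> {i. q i \<noteq> i}"
    by auto
  then show "bij (p \<circ> q) \<and> finite {i. (p \<circ> q) i \<noteq> i}"
    using p q by (auto simp: bij_comp intro: finite_subset)
qed

lift_definition uminus_fperm :: "fperm \<Rightarrow> fperm" is "Hilbert_Choice.inv"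
proof -
  fix p :: "nat \<Rightarrow> nat"
  assume p: "bij p \<and> finite {i. p i \<noteq> i}"
  then have "Hilbert_Choice.inv p i = i \<longleftrightarrow> p i = i" for i
    by (metis bij_inv_eq_iff)
  then show "bij (Hilbert_Choice.inv p) \<and> finite {i. Hilbert_Choice.inv p i \<noteq> i}"
    using p by (simp add: bij_imp_bij_inv)
qed

definition minus_fperm :: "fperm \<Rightarrow> fperm \<Rightarrow> fperm" where
  "minus_fperm g h = g + (- h)"

instance
proof
  fix a b c :: fperm
  show "a + b + c = a + (b + c)" by transfer (simp add: comp_assoc)
  show "0 + a = a" by transfer simp
  show "a + 0 = a" by transfer simp
  show "- a + a = 0" by transfer (auto simp: bij_def)
  show "a + - b = a - b" by (simp add: minus_fperm_def)
qed

end

lemma fapp_zero [simp]: "fapp 0 i = i"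
  by transfer simp

lemma fapp_plus [simp]: "fapp (g + h) i = fapp g (fapp h i)"
  by transfer simp

lemma fapp_uminus_left [simp]: "fapp (- g) (fapp g i) = i"
  by (metis fapp_plus fapp_zero left_minus)

lemma fapp_uminus_right [simp]: "fapp g (fapp (- g) i) = i"
  by (metis fapp_plus fapp_zero right_minus)

lemma fperm_eqI: "(\<And>i. fapp g i = fapp h i) \<Longrightarrow> g = h"
  by transfer auto

lemma fapp_inject_arg [simp]: "fapp g i = fapp g j \<longleftrightarrow> i = j"
  by (metis fapp_uminus_left)

definition fsupp :: "fperm \<Rightarrow> nat set" where
  "fsupp g = {i. fapp g i \<noteq> i}"

lemma finite_fsupp [simp]: "finite (fsupp g)"
  unfolding fsupp_def by transfer simp

lemma fsupp_iff: "i \<in> fsupp g \<longleftrightarrow> fapp g i \<noteq> i"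
  by (simp add: fsupp_def)

lemma fsupp_plus: "fsupp (g + h) \<subseteq> fsupp g \<union> fsupp h"
  by (auto simp: fsupp_iff)

lemma fsupp_zero [simp]: "fsupp 0 = {}"
  by (auto simp: fsupp_iff)

lemma fsupp_uminus [simp]: "fsupp (- g) = fsupp g"
  by (auto simp: fsupp_iff) (metis fapp_uminus_left fapp_uminus_right)+

lift_definition ftrans :: "nat \<Rightarrow> nat \<Rightarrow> fperm" is "\<lambda>i j. transpose i j"
proof -
  fix i j :: nat
  have "{k. transpose i j k \<noteq> k} \<subseteq> {i, j}"
    by (auto simp: transpose_def)
  then show "bij (transpose i j) \<and> finite {k. transpose i j k \<noteq> k}"
    by (auto intro: finite_subset)
qed

lemma fapp_ftrans: "fapp (ftrans i j) k = (if k = i then j else if k = j then i else k)"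
  by transfer (simp add: transpose_def)

lemma ftrans_ftrans [simp]: "ftrans i j + ftrans i j = 0"
  by (rule fperm_eqI) (simp add: fapp_ftrans)

lemma uminus_ftrans [simp]: "- ftrans i j = ftrans i j"
  using ftrans_ftrans minus_unique by blast

lemma fsupp_ftrans: "fsupp (ftrans i j) \<subseteq> {i, j}"
  by (auto simp: fsupp_iff fapp_ftrans split: if_splits)

text \<open>The symmetric groups are nested subgroups of a single group, so that passing to the next
  level of the tower is an inclusion of sets and needs no embedding map.\<close>

definition fsym :: "nat \<Rightarrow> fperm set" where
  "fsym n = {g. fsupp g \<subseteq> {1..n}}"

lemma fsym_plus [intro]: "g \<in> fsym n \<Longrightarrow> h \<in> fsym n \<Longrightarrow> g + h \<in> fsym n"
  using fsupp_plus[of g h] by (auto simp: fsym_def)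

lemma fsym_uminus [simp]: "- g \<in> fsym n \<longleftrightarrow> g \<in> fsym n"
  by (simp add: fsym_def)

lemma fsym_zero [simp]: "0 \<in> fsym n"
  by (simp add: fsym_def)

lemma fsym_mono: "n \<le> m \<Longrightarrow> fsym n \<subseteq> fsym m"
  by (auto simp: fsym_def)

lemma fsym_fixed: "g \<in> fsym n \<Longrightarrow> i \<notin> {1..n} \<Longrightarrow> fapp g i = i"
  unfolding fsym_def fsupp_def by blast

lemma fsym_range: "g \<in> fsym n \<Longrightarrow> fapp g i \<in> {1..n} \<longleftrightarrow> i \<in> {1..n}"
  by (metis fapp_inject_arg fsym_fixed)

lemma ftrans_fsym: "i \<in> {1..n} \<Longrightarrow> j \<in> {1..n} \<Longrightarrow> ftrans i j \<in> fsym n"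
  using fsupp_ftrans[of i j] by (auto simp: fsym_def)

lemma fapp_fsym: "fapp ` fsym n = {p. p permutes {1..n}}"
proof (rule Set.set_eqI, rule iffI)
  fix p assume "p \<in> fapp ` fsym n"
  then obtain g where g: "g \<in> fsym n" "p = fapp g" by blast
  have "bij (fapp g)" using fapp[of g] by simp
  then show "p \<in> {p. p permutes {1..n}}"
    using g fsym_fixed[OF g(1)] by (auto simp: permutes_def bij_iff)
next
  fix p assume "p \<in> {p. p permutes {1..n}}"
  then have p: "p permutes {1..n}" by simp
  have "{i. p i \<noteq> i} \<subseteq> {1..n}"
    using p permutes_not_in by fastforce
  moreover have "bij p" using p by (rule permutes_bij)
  ultimately have "fapp (Fperm p) = p"
    by (intro Fperm_inverse) (auto intro: finite_subset)
  then show "p \<in> fapp ` fsym n"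
    using \<open>{i. p i \<noteq> i} \<subseteq> {1..n}\<close> by (intro image_eqI[of _ _ "Fperm p"]) (auto simp: fsym_def fsupp_def)
qed

lemma inj_fapp: "inj fapp"
  by (rule injI) (simp add: fapp_inject)

lemma finite_fsym [simp]: "finite (fsym n)"
proof (rule finite_imageD)
  show "finite (fapp ` fsym n)"
    unfolding fapp_fsym by (simp add: finite_permutations)
  show "inj_on fapp (fsym n)"
    using inj_fapp by (rule inj_on_subset) simp
qed

lemma sum_fsym_right:
  assumes "v \<in> fsym n"
  shows "(\<Sum>u\<in>fsym n. f (u + v)) = sum f (fsym n)"
  by (rule sum.reindex_bij_witness[of _ "\<lambda>u. u + - v" "\<lambda>u. u + v"])
    (use assms in \<open>auto simp: add.assoc simp del: add_uminus_conv_diff\<close>)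

lemma sum_fsym_left:
  assumes "v \<in> fsym n"
  shows "(\<Sum>u\<in>fsym n. f (v + u)) = sum f (fsym n)"
  by (rule sum.reindex_bij_witness[of _ "\<lambda>u. - v + u" "\<lambda>u. v + u"])
    (use assms fsym_uminus in \<open>auto simp: add.assoc[symmetric]\<close>)


subsection \<open>The tower of group algebras\<close>

definition galg_on :: "nat \<Rightarrow> fperm galg set" where
  "galg_on n = {x. gkeys x \<subseteq> fsym n}"

lemma galg_on_closed:
  shows galg_on_add: "x \<in> galg_on n \<Longrightarrow> y \<in> galg_on n \<Longrightarrow> x + y \<in> galg_on n"
    and galg_on_diff: "x \<in> galg_on n \<Longrightarrow> y \<in> galg_on n \<Longrightarrow> x - y \<in> galg_on n"
    and galg_on_mult: "x \<in> galg_on n \<Longrightarrow> y \<in> galg_on n \<Longrightarrow> x * y \<in> galg_on n"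
    and galg_on_scal: "scal c \<in> galg_on n"
    and galg_on_gel: "g \<in> fsym n \<Longrightarrow> gel g \<in> galg_on n"
  using keys_add[of x y] Poly_Mapping.keys_diff[of x y] keys_mult[of x y]
  unfolding galg_on_def by (auto 0 4)

lemma galg_on_zero [simp]: "0 \<in> galg_on n"
  by (simp add: galg_on_def)

lemma galg_on_one [simp]: "1 \<in> galg_on n"
  by (simp add: galg_on_def)

lemma galg_on_sum: "(\<And>i. i \<in> I \<Longrightarrow> f i \<in> galg_on n) \<Longrightarrow> sum f I \<in> galg_on n"
  by (induction I rule: infinite_finite_induct) (auto intro: galg_on_add)

lemma galg_on_mono: "n \<le> m \<Longrightarrow> galg_on n \<subseteq> galg_on m"
  using fsym_mono by (auto simp: galg_on_def)

lemma galg_on_star: "x \<in> galg_on n \<Longrightarrow> star x \<in> galg_on n"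
  unfolding galg_on_def by (auto simp: in_keys_iff star.rep_eq)

lemma galg_on_commute:
  assumes "\<And>g. g \<in> fsym n \<Longrightarrow> gel g * y = y * gel g" "x \<in> galg_on n"
  shows "x * y = y * x"
proof -
  have "x * y = (\<Sum>g\<in>gkeys x. (scal (gcoeff x g) * gel g) * y)"
    by (rule galg_expand_mult)
  also have "\<dots> = (\<Sum>g\<in>gkeys x. y * (scal (gcoeff x g) * gel g))"
  proof (rule sum.cong)
    fix g assume "g \<in> gkeys x"
    then have "gel g * y = y * gel g"
      using assms by (auto simp: galg_on_def)
    then show "(scal (gcoeff x g) * gel g) * y = y * (scal (gcoeff x g) * gel g)"
      by (simp add: mult.assoc scal_left_commute)
  qed simp
  also have "\<dots> = y * x"
    by (rule mult_galg_expand[symmetric])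
  finally show ?thesis .
qed

section \<open>Jucys-Murphy elements and averages over a symmetric group\<close>

definition jucys_murphy :: "nat \<Rightarrow> fperm galg" where
  "jucys_murphy m = (\<Sum>i\<in>{1..<m}. gel (ftrans i m))"

lemma jucys_murphy_Suc: "jucys_murphy (Suc n) = (\<Sum>i\<in>{1..n}. gel (ftrans i (Suc n)))"
  unfolding jucys_murphy_def atLeastLessThanSuc_atLeastAtMost ..

lemma jucys_murphy_in: "jucys_murphy m \<in> galg_on m"
  unfolding jucys_murphy_def by (intro galg_on_sum galg_on_gel ftrans_fsym) auto

lemma star_jucys_murphy: "star (jucys_murphy m) = jucys_murphy m"
  by (simp add: jucys_murphy_def star_sum)

lemma ftrans_conj: "g + ftrans i j = ftrans (fapp g i) (fapp g j) + g"
  by (rule fperm_eqI) (simp add: fapp_ftrans)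

text \<open>Conjugation by a permutation that fixes \<open>Suc n\<close> merely permutes the
  transpositions \<open>(i, Suc n)\<close> in the sum.\<close>

lemma jucys_murphy_commute_gel:
  assumes "g \<in> fsym n"
  shows "gel g * jucys_murphy (Suc n) = jucys_murphy (Suc n) * gel g"
proof -
  have "gel g * jucys_murphy (Suc n) = (\<Sum>i\<in>{1..n}. gel (ftrans (fapp g i) (Suc n) + g))"
    using fsym_fixed[OF assms, of "Suc n"]
    by (simp add: jucys_murphy_Suc sum_distrib_left mult_single ftrans_conj[of g])
  also have "\<dots> = (\<Sum>i\<in>{1..n}. gel (ftrans i (Suc n) + g))"
    using fsym_range[OF assms] fsym_range[of "- g" n] assms
    by (intro sum.reindex_bij_witness[of _ "fapp (- g)" "fapp g"]) simp_all
  finally show ?thesis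
    by (simp add: jucys_murphy_Suc sum_distrib_right mult_single)
qed

lemma jucys_murphy_commute:
  "x \<in> galg_on n \<Longrightarrow> x * jucys_murphy (Suc n) = jucys_murphy (Suc n) * x"
  using galg_on_commute jucys_murphy_commute_gel by blast

text \<open>The relation of the degenerate affine Hecke algebra, in the form required by
  \<open>shift_prod_intertwine\<close>. Conjugation by the transposition of \<open>n\<close> and
  \<open>Suc n\<close> carries the terms of one element to those of the next, except for one new
  term: that transposition itself, whose square is the 1 on the right.\<close>

lemma jucys_murphy_step:
  assumes "n \<ge> 1"
  shows "gel (ftrans n (Suc n)) * jucys_murphy n = jucys_murphy (Suc n) * gel (ftrans n (Suc n)) - 1"
proof -
  let ?s = "ftrans n (Suc n)"
  have "gel ?s * jucys_murphy n = (\<Sum>i\<in>{1..<n}. gel (ftrans i (Suc n) + ?s))"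
    by (auto simp: jucys_murphy_def sum_distrib_left mult_single ftrans_conj[of ?s] fapp_ftrans intro!: sum.cong)
  moreover have "jucys_murphy (Suc n) * gel ?s = (\<Sum>i\<in>{1..<n}. gel (ftrans i (Suc n) + ?s)) + 1"
  proof -
    have "{1..n} = insert n {1..<n}" using assms by auto
    then show ?thesis
      by (simp add: jucys_murphy_Suc sum_distrib_right mult_single distrib_right del: One_nat_def)
  qed
  ultimately show ?thesis
    by simp
qed

text \<open>The elements with index 0 and 1 are empty sums and have the single root 0. From then on
  the adjacent transposition serves as \<open>s\<close> in the intertwining argument; it starts at
  index 1 because the permuted points do.\<close>

lemma jucys_murphy_spectrum: "\<exists>ds. shift_prod (jucys_murphy n) ds = 0"
proof (induction n)
  case 0
  then show ?case by (intro exI[of _ "[0]"]) (simp add: jucys_murphy_def)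
next
  case (Suc n)
  show ?case
  proof (cases "n = 0")
    case True
    then show ?thesis by (intro exI[of _ "[0]"]) (simp add: jucys_murphy_def)
  next
    case False
    from Suc obtain ds where "shift_prod (jucys_murphy n) ds = 0" by blast
    then show ?thesis
    proof (rule shift_prod_intertwine[rotated 3])
      show "gel (ftrans n (Suc n)) * gel (ftrans n (Suc n)) = 1"
        by (simp add: mult_single)
      show "gel (ftrans n (Suc n)) * jucys_murphy n = jucys_murphy (Suc n) * gel (ftrans n (Suc n)) - 1"
        using False by (intro jucys_murphy_step) simp
      show "jucys_murphy n * jucys_murphy (Suc n) = jucys_murphy (Suc n) * jucys_murphy n"
        by (rule jucys_murphy_commute[OF jucys_murphy_in])
    qed
  qed
qed

text \<open>Up to the factor \<open>card (fsym n)\<close>, the projection onto the centraliser of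
  level \<open>n\<close>. Without normalisation the values at group elements have integer
  coefficients.\<close>

definition conj_sum :: "nat \<Rightarrow> fperm galg \<Rightarrow> fperm galg" where
  "conj_sum n x = (\<Sum>u\<in>fsym n. gel u * x * gel (- u))"

lemma conj_sum_sum: "conj_sum n (sum f I) = (\<Sum>i\<in>I. conj_sum n (f i))"
  unfolding conj_sum_def by (subst sum.swap) (simp add: sum_distrib_left sum_distrib_right)

lemma conj_sum_scal: "conj_sum n (scal c * x) = scal c * conj_sum n x"
  unfolding conj_sum_def by (simp add: sum_distrib_left scal_left_commute mult.assoc)

lemma conj_sum_conj:
  assumes "v \<in> fsym n"
  shows "conj_sum n (gel v * x * gel (- v)) = conj_sum n x"
proof -
  have "conj_sum n (gel v * x * gel (- v)) = (\<Sum>u\<in>fsym n. gel (u + v) * x * gel (- (u + v)))"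
  proof -
    have "gel u * (gel v * x * gel (- v)) * gel (- u) = gel (u + v) * x * gel (- (u + v))" for u
    proof -
      have "gel (u + v) = gel u * gel v" "gel (- (u + v)) = gel (- v) * gel (- u)"
        by (simp_all add: mult_single minus_add)
      then show ?thesis by (simp only: mult.assoc)
    qed
    then show ?thesis by (simp add: conj_sum_def)
  qed
  also have "\<dots> = conj_sum n x"
    unfolding conj_sum_def sum_fsym_right[OF assms, of "\<lambda>w. gel w * x * gel (- w)"] ..
  finally show ?thesis .
qed

lemma conj_sum_commute:
  assumes "y \<in> galg_on n"
  shows "y * conj_sum n x = conj_sum n x * y"
proof (rule galg_on_commute[OF _ assms])
  fix v assume v: "v \<in> fsym n"
  have "gel v * conj_sum n x = (\<Sum>u\<in>fsym n. gel (v + u) * x * gel (- (v + u))) * gel v"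
  proof -
    have "gel v * (gel u * x * gel (- u)) = gel (v + u) * x * gel (- (v + u)) * gel v" for u
    proof -
      have "gel (v + u) = gel v * gel u" "gel (- u) = gel (- (v + u)) * gel v"
        by (simp_all add: mult_single minus_add add.assoc)
      then show ?thesis by (simp only: mult.assoc)
    qed
    then show ?thesis by (simp add: conj_sum_def sum_distrib_left sum_distrib_right)
  qed
  also have "\<dots> = conj_sum n x * gel v"
    unfolding conj_sum_def sum_fsym_left[OF v, of "\<lambda>w. gel w * x * gel (- w)"] ..
  finally show "gel v * conj_sum n x = conj_sum n x * gel v" .
qed

lemma conj_sum_mult_left:
  assumes "\<And>g. g \<in> fsym n \<Longrightarrow> gel g * c = c * gel g"
  shows "conj_sum n (c * x) = c * conj_sum n x"
  unfolding conj_sum_def sum_distrib_left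
proof (rule sum.cong)
  fix u assume "u \<in> fsym n"
  then have "gel u * c = c * gel u" using assms by blast
  then show "gel u * (c * x) * gel (- u) = c * (gel u * x * gel (- u))"
    by (simp only: mult.assoc[symmetric])
qed simp

lemma conj_sum_in: "x \<in> galg_on n \<Longrightarrow> conj_sum n x \<in> galg_on n"
  unfolding conj_sum_def by (intro galg_on_sum galg_on_mult galg_on_gel) auto


subsection \<open>The centraliser of one level in the next\<close>

text \<open>A product of star transpositions, which all share the point \<open>m\<close>; the name
  is unrelated to the involution \<open>star\<close>. If the letters are distinct and different from
  \<open>m\<close>, the product is a single cycle through \<open>m\<close>, one longer than the
  word.\<close>

fun star_word :: "nat \<Rightarrow> nat list \<Rightarrow> fperm" where
  "star_word m [] = 0"
| "star_word m (i # is) = ftrans i m + star_word m is"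

lemma star_word_append: "star_word m (is @ js) = star_word m is + star_word m js"
  by (induction "is") (auto simp: add.assoc)

lemma fsupp_star_word: "fsupp (star_word m is) \<subseteq> insert m (set is)"
proof (induction "is")
  case (Cons i "is")
  then show ?case
    using fsupp_plus[of "ftrans i m" "star_word m is"] fsupp_ftrans[of i m] by auto
qed simp

text \<open>The sum runs over words and not over permutations, because different words can have the
  same value and each of them counts.\<close>

lemma power_jucys_murphy:
  "jucys_murphy (Suc n) ^ k = (\<Sum>is\<in>{is. set is \<subseteq> {1..n} \<and> length is = k}. gel (star_word (Suc n) is))"
proof (induction k)
  case 0
  have "{is. set is \<subseteq> {1..n} \<and> length is = 0} = {[]}" by auto
  then show ?case by simp
next
  case (Suc k)
  let ?L = "\<lambda>k. {is. set is \<subseteq> {1..n} \<and> length is = k}"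
  have "(\<Sum>is\<in>?L (Suc k). gel (star_word (Suc n) is)) =
      (\<Sum>(i, is)\<in>{1..n} \<times> ?L k. gel (star_word (Suc n) (i # is)))"
    by (rule sum.reindex_bij_witness[of _ "\<lambda>(i, is). i # is" "\<lambda>is. (hd is, tl is)"])
      (auto simp: length_Suc_conv)
  also have "\<dots> = jucys_murphy (Suc n) * (\<Sum>is\<in>?L k. gel (star_word (Suc n) is))"
    by (simp add: sum.cartesian_product[symmetric] jucys_murphy_Suc sum_product mult_single)
  finally show ?case by (simp add: Suc)
qed

text \<open>The cycle of \<open>m\<close> written as a product of transpositions \<open>(i m)\<close>, followed by the
  remaining cycles.\<close>

lemma star_word_decomposition:
  assumes "fapp g m \<noteq> m"
  shows "\<exists>is h. g = star_word m is + h \<and> distinct is \<and> set is \<inter> fsupp h = {} \<and> m \<notin> set is \<and> m \<notin> fsupp h \<and>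
     set is \<subseteq> fsupp g \<and> fsupp h \<subseteq> fsupp g \<and> length is + 1 + card (fsupp h) \<le> card (fsupp g)"
  using assms
proof (induction "card (fsupp g)" arbitrary: g rule: less_induct)
  case less
  define i where "i = fapp g m"
  \<comment> \<open>\<open>g'\<close> fixes \<open>i\<close>: the transposition sends
    \<open>i\<close> to \<open>m\<close>, and \<open>g\<close> sends \<open>m\<close> to
    \<open>i\<close>. So one point is split off the cycle of \<open>m\<close>, and the support
    shrinks.\<close>
  define g' where "g' = g + ftrans i m"
  have "i \<noteq> m" using less.prems by (simp add: i_def)
  have g: "g = g' + ftrans i m" by (simp add: g'_def add.assoc)
  have "fapp g i \<noteq> i"
    using less.prems by (metis fapp_inject_arg i_def)
  have "fapp g' i = i" using \<open>i \<noteq> m\<close> by (simp add: g'_def fapp_ftrans i_def)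
  have supp: "fsupp g' \<subseteq> fsupp g - {i}"
    using \<open>fapp g' i = i\<close> less.prems by (auto simp: fsupp_iff g'_def fapp_ftrans split: if_splits)
  have "i \<in> fsupp g" "m \<in> fsupp g" using \<open>fapp g i \<noteq> i\<close> less.prems by (auto simp: fsupp_iff)
  then have card: "card (fsupp g') + 1 \<le> card (fsupp g)"
    using supp card_mono[OF _ supp] card_Diff_singleton[of i "fsupp g"] card_gt_0_iff[of "fsupp g"] by auto
  show ?case
  proof (cases "fapp g' m = m")
    case True
    \<comment> \<open>Here the cycle of \<open>m\<close> was the transposition of \<open>i\<close>
      and \<open>m\<close>; both points leave the support, which accounts for the summand 1 in the
      bound.\<close>
    have "g = star_word m [i] + g'"
    proof (rule fperm_eqI)
      fix k show "fapp g k = fapp (star_word m [i] + g') k"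
        using True \<open>fapp g' i = i\<close> \<open>i \<noteq> m\<close> fapp_inject_arg[of g' k i] fapp_inject_arg[of g' k m]
        unfolding g by (auto simp: fapp_ftrans simp del: fapp_inject_arg)
    qed
    moreover have "fsupp g' \<subseteq> fsupp g - {i, m}"
      using supp True by (auto simp: fsupp_iff)
    then have "card (fsupp g') + 2 \<le> card (fsupp g)"
      using card_mono[of "fsupp g - {i, m}" "fsupp g'"] card_Diff_subset[of "{i, m}" "fsupp g"]
        card_mono[of "fsupp g" "{i, m}"] \<open>i \<noteq> m\<close> \<open>i \<in> fsupp g\<close> \<open>m \<in> fsupp g\<close> by auto
    ultimately show ?thesis
      using True \<open>fapp g' i = i\<close> \<open>i \<noteq> m\<close> \<open>i \<in> fsupp g\<close> supp
      by (intro exI[of _ "[i]"] exI[of _ g']) (auto simp: fsupp_iff)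
  next
    case False
    have "card (fsupp g') < card (fsupp g)" using card by simp
    from less.hyps[OF this False] obtain "is" h where IH:
      "g' = star_word m is + h" "distinct is" "set is \<inter> fsupp h = {}" "m \<notin> set is" "m \<notin> fsupp h"
      "set is \<subseteq> fsupp g'" "fsupp h \<subseteq> fsupp g'" "length is + 1 + card (fsupp h) \<le> card (fsupp g')"
      by blast
    have "fapp h i = i" "fapp h m = m" using IH(5,7) supp by (auto simp: fsupp_iff)
    \<comment> \<open>The remaining cycles fix \<open>i\<close> and \<open>m\<close>, so the
      transposition can be moved past them and appended to the word.\<close>
    have "h + ftrans i m = ftrans i m + h"
      using ftrans_conj[of h i m] \<open>fapp h i = i\<close> \<open>fapp h m = m\<close> by simp
    then have "g = star_word m (is @ [i]) + h"
      unfolding g IH(1) by (simp add: star_word_append add.assoc)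
    then show ?thesis
      using IH supp card \<open>i \<in> fsupp g\<close> \<open>i \<noteq> m\<close> \<open>fapp h i = i\<close>
      by (intro exI[of _ "is @ [i]"] exI[of _ h]) (auto simp: fsupp_iff)
  qed
qed

text \<open>A partial injection of a finite set into itself extends to a permutation, since the
  complements of its domain and its range have the same size. The points of \<open>H\<close> join
  the domain as fixed points. This is how two words of equal shape become conjugate.\<close>

lemma fperm_extend:
  assumes "distinct is" "distinct js" "length is = length js" "set is \<subseteq> {1..n}" "set js \<subseteq> {1..n}"
    "H \<inter> set is = {}" "H \<inter> set js = {}" "H \<subseteq> {1..n}"
  shows "\<exists>u\<in>fsym n. map (fapp u) is = js \<and> (\<forall>i\<in>H. fapp u i = i)"
proof -
  have "card ({1..n} - H - set is) = card ({1..n} - H - set js)"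
  proof -
    have "card ({1..n} - H - set ks) = n - (card H + length ks)"
      if "distinct ks" "set ks \<subseteq> {1..n}" "H \<inter> set ks = {}" for ks
    proof -
      have "card (H \<union> set ks) = card H + length ks"
        using that assms(8) by (simp add: card_Un_disjoint distinct_card finite_subset)
      moreover have "{1..n} - H - set ks = {1..n} - (H \<union> set ks)"
        by auto
      ultimately show ?thesis
        using that assms(8) by (simp add: card_Diff_subset finite_subset)
    qed
    then show ?thesis
      using assms by metis
  qed
  then obtain f where f: "bij_betw f ({1..n} - H - set is) ({1..n} - H - set js)"
    by (meson finite_Diff finite_atLeastAtMost finite_same_card_bij)
  define g where "g = (\<lambda>i. js ! (THE k. k < length is \<and> is ! k = i))"
  have g: "g (is ! k) = js ! k" if "k < length is" for k
  proof -
    have "(THE k'. k' < length is \<and> is ! k' = is ! k) = k"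
      using that assms(1) by (intro the_equality) (auto simp: nth_eq_iff_index_eq)
    then show ?thesis by (simp add: g_def)
  qed
  have gb: "bij_betw g (set is) (set js)"
  proof -
    have "map g is = js"
      using g assms(3) by (intro nth_equalityI) auto
    then show ?thesis
      using assms(1,2) by (metis bij_betw_def distinct_map list.set_map)
  qed
  define p where "p = (\<lambda>i. if i \<in> set is then g i else if i \<in> {1..n} - H - set is then f i else i)"
  have "bij_betw p (set is) (set js)"
    using gb by (rule bij_betw_cong[THEN iffD1, rotated]) (auto simp: p_def)
  moreover have "bij_betw p ({1..n} - H - set is) ({1..n} - H - set js)"
    using f by (rule bij_betw_cong[THEN iffD1, rotated]) (auto simp: p_def)
  moreover have "bij_betw p H H"
    using assms by (intro bij_betw_cong[THEN iffD1, OF _ bij_betw_id]) (auto simp: p_def)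
  ultimately have "bij_betw p (set is \<union> ({1..n} - H - set is) \<union> H) (set js \<union> ({1..n} - H - set js) \<union> H)"
    using assms by (intro bij_betw_combine) auto
  moreover have "set is \<union> ({1..n} - H - set is) \<union> H = {1..n}" "set js \<union> ({1..n} - H - set js) \<union> H = {1..n}"
    using assms by auto
  ultimately have "p permutes {1..n}"
    using assms(4) by (intro bij_imp_permutes) (auto simp: p_def)
  then obtain u where u: "u \<in> fsym n" "fapp u = p"
    using fapp_fsym[of n] by (metis (no_types, lifting) imageE mem_Collect_eq)
  have "map (fapp u) is = js"
    using g assms(3) u(2) by (intro nth_equalityI) (auto simp: p_def)
  then show ?thesis
    using u assms(6,8) by (intro bexI[of _ u]) (auto simp: p_def)
qed

lemma star_word_conj: "u + star_word m is = star_word (fapp u m) (map (fapp u) is) + u"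
  by (induction "is") (simp_all add: ftrans_conj[of u] add.assoc[symmetric], simp add: add.assoc)

text \<open>Olshanski's description of the centraliser: modulo permutations moving fewer points, the sum of
  the \<open>S\<^sub>n\<close>-conjugates of \<open>g\<close> is a multiple of \<open>X\<^sup>k\<close> times a central element of level \<open>n\<close>,
  where \<open>k + 1\<close> is the length of the cycle of \<open>n + 1\<close>.\<close>

lemma conj_sum_mult_in:
  assumes e: "e \<in> galg_on n" "e * e = e" "\<And>x. x \<in> galg_on n \<Longrightarrow> \<exists>c. e * x * e = scal c * e"
    and V: "e \<in> V" "\<And>x y. x \<in> V \<Longrightarrow> y \<in> V \<Longrightarrow> x - y \<in> V" "\<And>c x. x \<in> V \<Longrightarrow> scal c * x \<in> V"
      "\<And>x. x \<in> V \<Longrightarrow> jucys_murphy (Suc n) * x \<in> V"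
    and g: "g \<in> fsym (Suc n)"
  shows "conj_sum n (gel g) * e \<in> V"
  using g
proof (induction "card (fsupp g)" arbitrary: g rule: less_induct)
  case less
  let ?m = "Suc n"
  have V0: "0 \<in> V" using V(2)[OF V(1) V(1)] by simp
  have Vadd: "x + y \<in> V" if "x \<in> V" "y \<in> V" for x y
    using V(2)[OF that(1) V(2)[OF V0 that(2)]] by simp
  have Vsum: "(\<And>i. i \<in> I \<Longrightarrow> f i \<in> V) \<Longrightarrow> sum f I \<in> V" for f :: "nat list \<Rightarrow> fperm galg" and I
    by (induction I rule: infinite_finite_induct) (auto intro: Vadd V0)
  \<comment> \<open>An average over \<open>fsym n\<close> commutes with \<open>e\<close>, so
    multiplying it by \<open>e\<close> compresses it to the corner of \<open>e\<close> at level
    \<open>n\<close>, which is a line.\<close>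
  have central: "\<exists>c. conj_sum n (gel h) * e = scal c * e" if "h \<in> fsym n" for h
  proof -
    have "conj_sum n (gel h) \<in> galg_on n" using that by (intro conj_sum_in galg_on_gel)
    from e(3)[OF this] show ?thesis
      using conj_sum_commute[OF e(1), of "gel h"] e(2) by (simp add: mult.assoc)
  qed
  show ?case
  proof (cases "fapp g ?m = ?m")
    case True
    then have "g \<in> fsym n"
      using less.prems by (auto simp: fsym_def fsupp_iff le_Suc_eq dest!: subsetD)
    then show ?thesis using central V(1,3) by metis
  next
    case False
    then obtain "is" h where h: "g = star_word ?m is + h" "distinct is" "set is \<inter> fsupp h = {}"
      "?m \<notin> set is" "?m \<notin> fsupp h" "set is \<subseteq> fsupp g" "fsupp h \<subseteq> fsupp g"
      "length is + 1 + card (fsupp h) \<le> card (fsupp g)"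
      using star_word_decomposition by metis
    have "{1..?m} = insert ?m {1..n}" by auto
    then have sub: "set is \<subseteq> {1..n}" "fsupp h \<subseteq> {1..n}"
      using h less.prems by (auto simp: fsym_def)
    then have "h \<in> fsym n" by (simp add: fsym_def)
    \<comment> \<open>\<open>L\<close> collects the words that occur in the power of the
      Jucys-Murphy element with exponent \<open>length is\<close>. The words in \<open>G\<close> are
      those of the same shape as the word of \<open>g\<close>: distinct letters, all avoiding the
      other cycles.\<close>
    define L where "L = {js. set js \<subseteq> {1..n} \<and> length js = length is}"
    define G where "G = {js \<in> L. distinct js \<and> set js \<inter> fsupp h = {}}"
    have finL: "finite L" unfolding L_def by (rule finite_lists_length_eq) simp
    \<comment> \<open>Some permutation in \<open>fsym n\<close> carries the word \<open>is\<close>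
      to \<open>js\<close> and fixes the support of \<open>h\<close> pointwise. It also fixes
      \<open>Suc n\<close>, hence conjugates \<open>g\<close> to
      \<open>star_word (Suc n) js + h\<close>, and averages do not see conjugation.\<close>
    have good: "conj_sum n (gel (star_word ?m js + h)) = conj_sum n (gel g)" if js: "js \<in> G" for js
    proof -
      obtain u where u: "u \<in> fsym n" "map (fapp u) is = js" "\<forall>i\<in>fsupp h. fapp u i = i"
        using fperm_extend[OF h(2) _ _ sub(1) _ _ _ sub(2), of js] h(3) js
        by (auto simp: G_def L_def Int_commute)
      have "u + h = h + u"
      proof (rule fperm_eqI)
        fix i
        show "fapp (u + h) i = fapp (h + u) i"
        proof (cases "i \<in> fsupp h")
          case True
          then have "fapp h i \<in> fsupp h" by (auto simp: fsupp_iff)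
          then show ?thesis using u True by auto
        next
          case False
          then have "fapp u i \<notin> fsupp h"
            using u(3) by (metis fapp_inject_arg)
          then show ?thesis using False by (simp add: fsupp_iff)
        qed
      qed
      moreover have "fapp u ?m = ?m" using u(1) by (rule fsym_fixed) simp
      ultimately have "u + g = (star_word ?m js + h) + u"
        using star_word_conj[of u ?m "is"] u(2) unfolding h(1) by (metis add.assoc)
      then have "u + g + - u = star_word ?m js + h"
        by simp
      then have "gel u * gel g * gel (- u) = gel (star_word ?m js + h)"
        by (simp only: mult_single mult_1_left)
      then show ?thesis using conj_sum_conj[OF u(1), of "gel g"] by simp
    qed
    \<comment> \<open>A repeated letter, or a letter in the support of \<open>h\<close>, makes the
      product move strictly fewer points than \<open>g\<close>, so the induction hypothesis
      applies.\<close>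
    have bad: "conj_sum n (gel (star_word ?m js + h)) * e \<in> V" if "js \<in> L - G" for js
    proof (rule less.hyps)
      have sw: "fsupp (star_word ?m js + h) \<subseteq> insert ?m (set js \<union> fsupp h)"
        using fsupp_plus fsupp_star_word by blast
      have "card (set js \<union> fsupp h) < length is + card (fsupp h)"
      proof (cases "distinct js")
        case True
        then have "set js \<inter> fsupp h \<noteq> {}" using that by (auto simp: G_def)
        then have "card (set js \<inter> fsupp h) > 0" by (simp add: card_gt_0_iff)
        then show ?thesis
          using card_Un_Int[of "set js" "fsupp h"] card_length[of js] that by (auto simp: L_def)
      next
        case False
        then have "card (set js) < length js"
          using card_length[of js] card_distinct[of js] by linarith
        then show ?thesis
          using card_Un_le[of "set js" "fsupp h"] that by (auto simp: L_def)
      qed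
      then show "card (fsupp (star_word ?m js + h)) < card (fsupp g)"
        using h(8) card_mono[OF _ sw] card_insert_le_m1[of _ "set js \<union> fsupp h" ?m]
          card_insert_if[of "set js \<union> fsupp h" ?m] by (auto split: if_splits)
      show "star_word ?m js + h \<in> fsym ?m"
        using sw sub that by (auto simp: fsym_def L_def) fastforce+
    qed
    obtain c where c: "conj_sum n (gel h) * e = scal c * e"
      using central[OF \<open>h \<in> fsym n\<close>] by blast
    have Xpow: "jucys_murphy ?m ^ k * x \<in> V" if "x \<in> V" for k x
      using that by (induction k) (auto simp: mult.assoc V(4))
    have powcomm: "gel v * jucys_murphy ?m ^ k = jucys_murphy ?m ^ k * gel v" if "v \<in> fsym n" for v k
    proof (induction k)
      case (Suc k)
      have "gel v * (jucys_murphy ?m * jucys_murphy ?m ^ k) = jucys_murphy ?m * (gel v * jucys_murphy ?m ^ k)"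
        using jucys_murphy_commute_gel[OF that] by (simp add: mult.assoc[symmetric])
      then show ?case using Suc by (simp add: mult.assoc)
    qed simp
    \<comment> \<open>This product is evaluated twice. It lies in \<open>V\<close> because
      \<open>conj_sum n (gel h) * e\<close> is a multiple of \<open>e\<close>. Expanded into words,
      it is \<open>card G\<close> times the wanted element plus the contributions of smaller
      support.\<close>
    have "jucys_murphy ?m ^ length is * (conj_sum n (gel h) * e) \<in> V"
      unfolding c by (intro Xpow V(3) V(1))
    also have "jucys_murphy ?m ^ length is * (conj_sum n (gel h) * e) =
        conj_sum n (jucys_murphy ?m ^ length is * gel h) * e"
      by (subst conj_sum_mult_left) (simp_all add: powcomm mult.assoc)
    also have "jucys_murphy ?m ^ length is * gel h = (\<Sum>js\<in>L. gel (star_word ?m js + h))"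
      by (simp add: power_jucys_murphy L_def sum_distrib_right mult_single)
    also have "conj_sum n \<dots> * e = (\<Sum>js\<in>L. conj_sum n (gel (star_word ?m js + h)) * e)"
      by (simp add: conj_sum_sum sum_distrib_right)
    also have "\<dots> = (\<Sum>js\<in>G. conj_sum n (gel (star_word ?m js + h)) * e) +
        (\<Sum>js\<in>L - G. conj_sum n (gel (star_word ?m js + h)) * e)"
      using finL by (subst sum.subset_diff[of G L]) (auto simp: G_def add.commute)
    also have "(\<Sum>js\<in>G. conj_sum n (gel (star_word ?m js + h)) * e) = scal (of_nat (card G)) * (conj_sum n (gel g) * e)"
      using good by simp
    finally have "scal (of_nat (card G)) * (conj_sum n (gel g) * e) +
        (\<Sum>js\<in>L - G. conj_sum n (gel (star_word ?m js + h)) * e) \<in> V" .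
    moreover have "(\<Sum>js\<in>L - G. conj_sum n (gel (star_word ?m js + h)) * e) \<in> V"
      by (intro Vsum bad)
    ultimately have "scal (of_nat (card G)) * (conj_sum n (gel g) * e) +
        (\<Sum>js\<in>L - G. conj_sum n (gel (star_word ?m js + h)) * e) -
        (\<Sum>js\<in>L - G. conj_sum n (gel (star_word ?m js + h)) * e) \<in> V"
      by (rule V(2))
    then have "scal (of_nat (card G)) * (conj_sum n (gel g) * e) \<in> V"
      by simp
    then have "scal (1 / of_nat (card G)) * (scal (of_nat (card G)) * (conj_sum n (gel g) * e)) \<in> V"
      by (rule V(3))
    \<comment> \<open>The word of \<open>g\<close> itself belongs to \<open>G\<close>, so its
      coefficient can be divided out.\<close>
    moreover have "is \<in> G" "finite G"
      using h(2,3) sub(1) finite_subset[OF _ finL, of G] by (auto simp: G_def L_def)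
    then have "card G > 0"
      by (auto simp: card_gt_0_iff)
    ultimately show ?thesis by (simp only: scal_assoc) simp
  qed
qed


subsection \<open>Primitive idempotents\<close>

text \<open>The last condition is stronger than primitivity of \<open>e\<close> alone: the corner of
  \<open>e\<close> is the rational line through \<open>e\<close>, so that the block of
  \<open>e\<close> is a full matrix algebra over the rationals and not over a larger division
  algebra.\<close>

definition primitive_system :: "nat \<Rightarrow> fperm galg set \<Rightarrow> bool" where
  "primitive_system n E \<longleftrightarrow> finite E \<and> \<Sum>E = 1 \<and>
     (\<forall>e\<in>E. e \<in> galg_on n \<and> e \<noteq> 0 \<and> star e = e \<and> e * e = e \<and> (\<forall>f\<in>E. e \<noteq> f \<longrightarrow> e * f = 0) \<and>
       (\<forall>x\<in>galg_on n. \<exists>c. e * x * e = scal c * e))"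

text \<open>Averaging over \<open>S\<^sub>n\<close> recovers an element of the corner ring, up to a sum of squares.\<close>

lemma corner_conj_sum:
  assumes e: "e \<in> galg_on n" "e \<noteq> 0" "star e = e" "e * e = e" "\<And>x. x \<in> galg_on n \<Longrightarrow> \<exists>c. e * x * e = scal c * e"
    and y: "e * y = y" "y * e = y"
  shows "\<exists>\<kappa>. \<kappa> \<noteq> 0 \<and> conj_sum n y * e = scal \<kappa> * y"
proof -
  have "\<forall>g\<in>fsym n. \<exists>c. e * gel g * e = scal c * e"
    using e(5) galg_on_gel by blast
  then obtain c where c: "\<And>g. g \<in> fsym n \<Longrightarrow> e * gel g * e = scal (c g) * e"
    by metis
  \<comment> \<open>Applying \<open>star\<close> to the defining equation of \<open>c g\<close>
    replaces \<open>g\<close> by its inverse and leaves the rational unchanged. Hence squares will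
    appear below, and not products of unrelated coefficients.\<close>
  have c': "e * gel (- g) * e = scal (c g) * e" if "g \<in> fsym n" for g
  proof -
    have "star (e * gel g * e) = star (scal (c g) * e)"
      using c[OF that] by simp
    then show ?thesis
      using e(3) by (simp add: star_mult mult.assoc scal_commute)
  qed
  have c0: "c 0 = 1"
    using c[of 0] e(2,4) scal_cancel[of "c 0" e 1] by simp
  have "conj_sum n y * e = e * conj_sum n y * e"
    using conj_sum_commute[OF e(1), of y] e(4) by (metis mult.assoc)
  also have "\<dots> = (\<Sum>u\<in>fsym n. e * (gel u * y * gel (- u)) * e)"
    by (simp add: conj_sum_def sum_distrib_left sum_distrib_right)
  also have "\<dots> = (\<Sum>u\<in>fsym n. scal (c u * c u) * y)"
  proof (rule sum.cong)
    fix u assume u: "u \<in> fsym n"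
    have "e * (gel u * y * gel (- u)) * e = (e * gel u * e) * y * (e * gel (- u) * e)"
    proof -
      have "(e * gel u * e) * y * (e * gel (- u) * e) = e * gel u * (e * y * e) * gel (- u) * e"
        by (simp only: mult.assoc)
      then show ?thesis
        using y by (simp add: mult.assoc)
    qed
    also have "\<dots> = scal (c u) * (e * y) * (scal (c u) * e)"
      unfolding c[OF u] c'[OF u] by (simp only: mult.assoc)
    also have "\<dots> = scal (c u * c u) * y"
      unfolding scal_mult_scal using y by simp
    finally show "e * (gel u * y * gel (- u)) * e = scal (c u * c u) * y" .
  qed simp
  also have "\<dots> = scal (\<Sum>u\<in>fsym n. c u * c u) * y"
    by (simp only: scal_sum sum_distrib_right)
  finally have "conj_sum n y * e = scal (\<Sum>u\<in>fsym n. c u * c u) * y" .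
  \<comment> \<open>All terms are squares, and the neutral element contributes 1.\<close>
  moreover have "(\<Sum>u\<in>fsym n. c u * c u) > 0"
    using c0 by (intro sum_pos2[of _ 0]) auto
  ultimately show ?thesis by (metis less_irrefl)
qed

text \<open>Each idempotent of level \<open>n\<close> is cut into its eigenprojections for the next
  Jucys-Murphy element. That the corners become lines is the content of \<open>corner\<close>: an
  element of the corner of the old idempotent is a multiple of its own average times
  \<open>e\<close>, and such products are combinations of the eigenprojections.\<close>

lemma primitive_system_step:
  assumes "primitive_system n E"
  shows "\<exists>E'. primitive_system (Suc n) E'"
proof -
  let ?X = "jucys_murphy (Suc n)"
  obtain ds where ds: "shift_prod ?X ds = 0"
    using jucys_murphy_spectrum by blast
  have E: "finite E" "\<Sum>E = 1"
    and eE: "\<And>e. e \<in> E \<Longrightarrow> e \<in> galg_on n" "\<And>e. e \<in> E \<Longrightarrow> e \<noteq> 0" "\<And>e. e \<in> E \<Longrightarrow> star e = e"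
      "\<And>e. e \<in> E \<Longrightarrow> e * e = e" "\<And>e f. e \<in> E \<Longrightarrow> f \<in> E \<Longrightarrow> e \<noteq> f \<Longrightarrow> e * f = 0"
      "\<And>e x. e \<in> E \<Longrightarrow> x \<in> galg_on n \<Longrightarrow> \<exists>c. e * x * e = scal c * e"
    using assms unfolding primitive_system_def by auto
  have "\<exists>C ec. finite (C :: rat set) \<and> (\<Sum>c\<in>C. ec c) = e \<and>
     (\<forall>c\<in>C. ec c \<in> galg_on (Suc n) \<and> star (ec c) = ec c \<and> ?X * ec c = scal c * ec c \<and>
       ec c * e = ec c \<and> e * ec c = ec c \<and> ec c * ec c = ec c \<and> (\<forall>d\<in>C. c \<noteq> d \<longrightarrow> ec c * ec d = 0))"
    if "e \<in> E" for e
  proof (rule spectral_decomposition[where ds = ds])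
    show "?X * e = e * ?X" using jucys_murphy_commute[OF eE(1)[OF that]] by simp
    show "e \<in> galg_on (Suc n)" using eE(1)[OF that] galg_on_mono[of n "Suc n"] by auto
  qed (use that eE ds in \<open>auto intro: star_jucys_murphy jucys_murphy_in galg_on_closed\<close>)
  then obtain C ec where C: "\<And>e. e \<in> E \<Longrightarrow> finite (C e :: rat set)" "\<And>e. e \<in> E \<Longrightarrow> (\<Sum>c\<in>C e. ec e c) = e"
    and ec0: "\<And>e c. e \<in> E \<Longrightarrow> c \<in> C e \<Longrightarrow> ec e c \<in> galg_on (Suc n) \<and> star (ec e c) = ec e c \<and>
       ?X * ec e c = scal c * ec e c \<and> ec e c * e = ec e c \<and> e * ec e c = ec e c \<and> ec e c * ec e c = ec e c \<and>
       (\<forall>d\<in>C e. c \<noteq> d \<longrightarrow> ec e c * ec e d = 0)"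
    by metis
  have ec: "ec e c \<in> galg_on (Suc n)" "star (ec e c) = ec e c" "?X * ec e c = scal c * ec e c"
      "ec e c * e = ec e c" "e * ec e c = ec e c" "ec e c * ec e c = ec e c"
    and ec_orth: "\<And>d. d \<in> C e \<Longrightarrow> c \<noteq> d \<Longrightarrow> ec e c * ec e d = 0"
    if "e \<in> E" "c \<in> C e" for e c
    using ec0[OF that] by auto
  \<comment> \<open>A listed root need not occur as an eigenvalue on \<open>e\<close>, so some
    projections may vanish; only the nonzero ones are kept.\<close>
  define P where "P = {(e, c). e \<in> E \<and> c \<in> C e \<and> ec e c \<noteq> 0}"
  have P_sub: "P \<subseteq> Sigma E C" and "finite (Sigma E C)"
    using E C by (auto simp: P_def)
  then have "finite P" by (rule finite_subset)
  have orth: "ec e c * ec e' c' = 0" if "(e, c) \<in> P" "(e', c') \<in> P" "(e, c) \<noteq> (e', c')" for e c e' c'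
  proof (cases "e = e'")
    case True
    then show ?thesis using that ec_orth by (auto simp: P_def)
  next
    case False
    then have "ec e c * e * (e' * ec e' c') = 0"
      using that eE(5)[of e e'] by (simp add: P_def mult.assoc) (simp add: mult.assoc[symmetric])
    then show ?thesis
      using that ec by (simp add: P_def)
  qed
  have inj: "inj_on (case_prod ec) P"
  proof (rule inj_onI, clarsimp)
    fix e c e' c' assume *: "(e, c) \<in> P" "(e', c') \<in> P" "ec e c = ec e' c'"
    show "e = e' \<and> c = c'"
    proof (rule ccontr)
      assume "\<not> (e = e' \<and> c = c')"
      then have "ec e c * ec e' c' = 0" using * by (intro orth) auto
      then show False using * ec(6)[of e c] by (auto simp: P_def)
    qed
  qed
  define E' where "E' = case_prod ec ` P"
  have "\<Sum>E' = (\<Sum>(e, c)\<in>P. ec e c)"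
    unfolding E'_def by (subst sum.reindex[OF inj]) (simp add: case_prod_unfold comp_def)
  also have "\<dots> = (\<Sum>(e, c)\<in>Sigma E C. ec e c)"
    using P_sub \<open>finite (Sigma E C)\<close> by (intro sum.mono_neutral_left) (auto simp: P_def)
  also have "\<dots> = (\<Sum>e\<in>E. \<Sum>c\<in>C e. ec e c)"
    by (rule sum.Sigma[symmetric]) (use E C in auto)
  also have "\<dots> = 1"
    using C(2) E(2) by simp
  finally have sumE': "\<Sum>E' = 1" .
  have corner: "\<exists>d. ec e c * x * ec e c = scal d * ec e c" if ecP: "(e, c) \<in> P" and x: "x \<in> galg_on (Suc n)" for e c x
  proof -
    have e: "e \<in> E" and c: "c \<in> C e" using ecP by (auto simp: P_def)
    \<comment> \<open>The span of the eigenprojections of \<open>e\<close>. It contains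
      \<open>e\<close>, and the Jucys-Murphy element multiplies each projection by its eigenvalue,
      so the closure conditions of \<open>conj_sum_mult_in\<close> hold.\<close>
    define V where "V = {y. \<exists>a. y = (\<Sum>d\<in>C e. scal (a d) * ec e d)}"
    have V: "conj_sum n (gel g) * e \<in> V" if "g \<in> fsym (Suc n)" for g
    proof (rule conj_sum_mult_in[OF eE(1)[OF e] eE(4)[OF e] eE(6)[OF e] _ _ _ _ that])
      have "e = (\<Sum>d\<in>C e. scal 1 * ec e d)" using C(2)[OF e] by simp
      then show "e \<in> V" unfolding V_def by (intro CollectI exI[of _ "\<lambda>_. 1"])
    next
      fix x y assume "x \<in> V" "y \<in> V"
      then obtain a b where "x = (\<Sum>d\<in>C e. scal (a d) * ec e d)" "y = (\<Sum>d\<in>C e. scal (b d) * ec e d)"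
        unfolding V_def by auto
      then have "x - y = (\<Sum>d\<in>C e. scal (a d - b d) * ec e d)"
        by (simp add: sum_subtractf single_diff left_diff_distrib)
      then show "x - y \<in> V" unfolding V_def by auto
    next
      fix c x assume "x \<in> V"
      then obtain a where "x = (\<Sum>d\<in>C e. scal (a d) * ec e d)"
        unfolding V_def by auto
      then have "scal c * x = (\<Sum>d\<in>C e. scal (c * a d) * ec e d)"
        by (simp add: sum_distrib_left scal_assoc)
      then show "scal c * x \<in> V" unfolding V_def by auto
    next
      fix x assume "x \<in> V"
      then obtain a where "x = (\<Sum>d\<in>C e. scal (a d) * ec e d)"
        unfolding V_def by auto
      then have "?X * x = (\<Sum>d\<in>C e. scal (a d * d) * ec e d)"
        using ec(3)[OF e] by (simp add: sum_distrib_left scal_assoc scal_left_commute[of ?X])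
      then show "?X * x \<in> V" unfolding V_def by auto
    qed
    define y where "y = e * x * e"
    have "y \<in> galg_on (Suc n)"
      using x eE(1)[OF e] galg_on_mono[of n "Suc n"] unfolding y_def by (intro galg_on_mult) auto
    have "e * y = y" "y * e = y" using eE(4)[OF e] by (simp_all add: y_def mult.assoc) (simp add: mult.assoc[symmetric])
    then obtain k where k: "k \<noteq> 0" "conj_sum n y * e = scal k * y"
      using corner_conj_sum[OF eE(1-4)[OF e] eE(6)[OF e]] by blast
    have "conj_sum n y * e = (\<Sum>g\<in>gkeys y. scal (gcoeff y g) * (conj_sum n (gel g) * e))"
      using arg_cong[OF galg_expand_keys, of "\<lambda>y. conj_sum n y * e" y]
      by (simp only: conj_sum_sum conj_sum_scal sum_distrib_right mult.assoc)
    also have "\<forall>g\<in>gkeys y. \<exists>a. conj_sum n (gel g) * e = (\<Sum>d\<in>C e. scal (a d) * ec e d)"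
      using V \<open>y \<in> galg_on (Suc n)\<close> by (auto simp: V_def galg_on_def)
    then obtain a where "\<And>g. g \<in> gkeys y \<Longrightarrow> conj_sum n (gel g) * e = (\<Sum>d\<in>C e. scal (a g d) * ec e d)"
      by metis
    then have "(\<Sum>g\<in>gkeys y. scal (gcoeff y g) * (conj_sum n (gel g) * e)) =
        (\<Sum>g\<in>gkeys y. \<Sum>d\<in>C e. scal (gcoeff y g * a g d) * ec e d)"
      by (simp add: sum_distrib_left scal_assoc)
    finally have "scal k * y = (\<Sum>g\<in>gkeys y. \<Sum>d\<in>C e. scal (gcoeff y g * a g d) * ec e d)"
      using k by simp
    \<comment> \<open>Multiplication by the single projection \<open>ec e c\<close> kills all the
      others, so only one coefficient of each combination survives.\<close>
    then have "scal k * y * ec e c = (\<Sum>g\<in>gkeys y. \<Sum>d\<in>C e. scal (gcoeff y g * a g d) * (ec e d * ec e c))"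
      by (simp add: sum_distrib_right mult.assoc)
    also have "\<dots> = (\<Sum>g\<in>gkeys y. scal (gcoeff y g * a g c) * ec e c)"
    proof (rule sum.cong)
      fix g
      have "(\<Sum>d\<in>C e. scal (gcoeff y g * a g d) * (ec e d * ec e c)) =
          (\<Sum>d\<in>C e. if d = c then scal (gcoeff y g * a g c) * ec e c else 0)"
        using ec(6)[OF e c] ec_orth[OF e _ c] by (intro sum.cong) auto
      then show "(\<Sum>d\<in>C e. scal (gcoeff y g * a g d) * (ec e d * ec e c)) = scal (gcoeff y g * a g c) * ec e c"
        using C(1)[OF e] c by simp
    qed simp
    also have "\<dots> = scal (\<Sum>g\<in>gkeys y. gcoeff y g * a g c) * ec e c"
      by (simp only: scal_sum sum_distrib_right)
    finally have "scal k * (y * ec e c) = scal (\<Sum>g\<in>gkeys y. gcoeff y g * a g c) * ec e c"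
      by (simp add: mult.assoc)
    then have "scal (1 / k) * (scal k * (y * ec e c)) = scal (1 / k) * (scal (\<Sum>g\<in>gkeys y. gcoeff y g * a g c) * ec e c)"
      by simp
    then obtain b where "y * ec e c = scal b * ec e c"
      using k(1) by (simp add: scal_assoc)
    then have "ec e c * (y * ec e c) = scal b * ec e c"
      using ec(6)[OF e c] by (simp add: scal_left_commute[of "ec e c"])
    moreover have "ec e c * (y * ec e c) = ec e c * x * ec e c"
      using ec(4,5)[OF e c] unfolding y_def by (metis mult.assoc)
    ultimately show ?thesis by metis
  qed
  have "primitive_system (Suc n) E'"
    unfolding primitive_system_def
  proof (intro conjI ballI impI)
    show "finite E'" using \<open>finite P\<close> by (simp add: E'_def)
    show "\<Sum>E' = 1" by (rule sumE')
    fix e assume "e \<in> E'"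
    then obtain e0 c where e: "e = ec e0 c" "(e0, c) \<in> P" by (auto simp: E'_def)
    then show "e \<in> galg_on (Suc n)" "star e = e" "e * e = e" "e \<noteq> 0"
      using ec by (auto simp: P_def)
    show "e * f = 0" if "f \<in> E'" "e \<noteq> f" for f
      using that e by (auto simp: E'_def intro!: orth)
    show "\<exists>c. e * x * e = scal c * e" if "x \<in> galg_on (Suc n)" for x
      using corner[OF e(2) that] e(1) by simp
  qed
  then show ?thesis ..
qed

lemma primitive_system_exists: "\<exists>E. primitive_system n E"
proof (induction n)
  case 0
  have "fsym 0 = {0}"
    by (auto simp: fsym_def fsupp_def intro!: fperm_eqI)
  then have "x = scal (gcoeff x 0)" if "x \<in> galg_on 0" for x
    using that galg_expand[of "{0}" x] by (simp add: galg_on_def mult_single)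
  then have "primitive_system 0 {1}"
    unfolding primitive_system_def by (auto intro!: exI[of _ "gcoeff _ 0"])
  then show ?case ..
next
  case (Suc n)
  then show ?case using primitive_system_step by blast
qed


subsection \<open>Matrix units\<close>

text \<open>Two primitive idempotents are linked if they belong to the same simple block.\<close>

definition linked :: "nat \<Rightarrow> fperm galg \<Rightarrow> fperm galg \<Rightarrow> bool" where
  "linked n e f \<longleftrightarrow> (\<exists>x\<in>galg_on n. e * x * f \<noteq> 0)"

text \<open>The idempotents themselves serve as row and column indices and the fibres of
  \<open>b\<close> as blocks, so neither the irreducible representations nor their dimensions have
  to be known. The values of \<open>u\<close> matter only within a block.\<close>

definition matrix_units ::
    "nat \<Rightarrow> fperm galg set \<Rightarrow> (fperm galg \<Rightarrow> fperm galg) \<Rightarrow> (fperm galg \<Rightarrow> fperm galg \<Rightarrow> fperm galg) \<Rightarrow> bool" where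
  "matrix_units n I b u \<longleftrightarrow> finite I \<and>
     (\<forall>e\<in>I. \<forall>f\<in>I. b e = b f \<longrightarrow> u e f \<in> galg_on n \<and> u e f \<noteq> 0 \<and> e * u e f * f = u e f) \<and>
     (\<forall>e\<in>I. u e e = e) \<and>
     (\<forall>e\<in>I. \<forall>f\<in>I. \<forall>g\<in>I. b e = b f \<longrightarrow> b f = b g \<longrightarrow> u e f * u f g = u e g) \<and>
     (\<forall>e\<in>I. \<forall>f\<in>I. e * f = (if e = f then e else 0)) \<and> \<Sum>I = 1 \<and>
     (\<forall>x\<in>galg_on n. \<forall>e\<in>I. \<forall>f\<in>I. if b e = b f then \<exists>c. e * x * f = scal c * u e f else e * x * f = 0)"

text \<open>Linkage is an equivalence relation, and between linked idempotents the space
  \<open>e * A * f\<close> is a line. Choosing one nonzero element from each idempotent to the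
  representative of its class, and going back by adjoints, gives units that all pass through this
  representative and hence multiply consistently.\<close>

lemma matrix_units_exist: "\<exists>I b u. matrix_units n I b u"
proof -
  obtain E where "primitive_system n E"
    using primitive_system_exists by blast
  then have E: "finite E" "\<Sum>E = 1"
    and eE: "\<And>e. e \<in> E \<Longrightarrow> e \<in> galg_on n" "\<And>e. e \<in> E \<Longrightarrow> e \<noteq> 0" "\<And>e. e \<in> E \<Longrightarrow> star e = e"
      "\<And>e. e \<in> E \<Longrightarrow> e * e = e" "\<And>e f. e \<in> E \<Longrightarrow> f \<in> E \<Longrightarrow> e \<noteq> f \<Longrightarrow> e * f = 0"
      "\<And>e x. e \<in> E \<Longrightarrow> x \<in> galg_on n \<Longrightarrow> \<exists>c. e * x * e = scal c * e"
    unfolding primitive_system_def by auto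
  \<comment> \<open>\<open>x * star x\<close> and \<open>star x * x\<close> lie in the corners of
    \<open>e\<close> and \<open>f\<close>, so each is a scalar times an idempotent. The scalars
    agree, as seen on \<open>x * star x * x\<close>, and definiteness makes them nonzero.\<close>
  have unitary: "\<exists>k. k \<noteq> 0 \<and> x * star x = scal k * e \<and> star x * x = scal k * f"
    if e: "e \<in> E" and f: "f \<in> E" and x: "x \<in> galg_on n" "e * x = x" "x * f = x" "x \<noteq> 0" for e f x
  proof -
    have sx: "star x * e = star x" "f * star x = star x"
      using x(2,3) eE(3)[OF e] eE(3)[OF f] by (metis star_mult)+
    obtain k where k: "e * (x * star x) * e = scal k * e"
      using eE(6)[OF e, of "x * star x"] x(1) galg_on_mult galg_on_star by blast
    obtain l where l: "f * (star x * x) * f = scal l * f"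
      using eE(6)[OF f, of "star x * x"] x(1) galg_on_mult galg_on_star by blast
    have k': "x * star x = scal k * e" using k x sx by (metis mult.assoc)
    have l': "star x * x = scal l * f" using l x sx by (metis mult.assoc)
    have "scal k * x = x * star x * x" using k' x(2) by (simp add: mult.assoc)
    also have "\<dots> = scal l * x" using l' x(3) by (simp add: mult.assoc scal_left_commute[of x])
    finally have "k = l" using x(4) by (rule scal_cancel)
    moreover have "l \<noteq> 0"
      using l' x(4) star_mult_self_zeroD[of x] by auto
    ultimately show ?thesis using k' l' by blast
  qed
  \<comment> \<open>Up to a nonzero scalar, \<open>star x\<close> inverts \<open>x\<close> between
    \<open>e\<close> and \<open>f\<close>. So \<open>e * y * f\<close> is a multiple of
    \<open>e * y * f * star x * x\<close>, where everything before the last factor lies in the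
    corner of \<open>e\<close>.\<close>
  have onedim: "\<exists>c. e * y * f = scal c * x"
    if e: "e \<in> E" and f: "f \<in> E" and x: "x \<in> galg_on n" "e * x = x" "x * f = x" "x \<noteq> 0" and y: "y \<in> galg_on n"
    for e f x y
  proof -
    obtain k where k: "k \<noteq> 0" "x * star x = scal k * e" "star x * x = scal k * f"
      using unitary[OF e f x] by blast
    obtain d where d: "e * (y * f * star x) * e = scal d * e"
      using eE(6)[OF e, of "y * f * star x"] x y eE(1)[OF f] by (meson galg_on_mult galg_on_star)
    have "scal k * (e * y * f) = e * y * f * (scal k * f)"
      using eE(4)[OF f] by (simp add: scal_left_commute[of "e * y * f"]) (simp add: mult.assoc)
    also have "\<dots> = e * y * f * star x * x"
      by (simp add: k(3)[symmetric] mult.assoc)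
    also have "\<dots> = e * (y * f * star x) * e * x"
      using x(2) by (simp add: mult.assoc)
    also have "\<dots> = scal d * x"
      unfolding d using x(2) by (simp add: mult.assoc)
    finally have "scal (1 / k) * (scal k * (e * y * f)) = scal (1 / k) * (scal d * x)"
      by simp
    then show ?thesis using k(1) by (auto simp: scal_assoc)
  qed
  have linkedI: "linked n e f" if "x \<in> galg_on n" "e * x * f \<noteq> 0" for e f x
    using that by (auto simp: linked_def)
  have refl: "linked n e e" if "e \<in> E" for e
    using that eE(1,2,4) by (intro linkedI[of e]) (auto simp: mult.assoc)
  have sym: "linked n f e" if ef: "e \<in> E" "f \<in> E" "linked n e f" for e f
  proof -
    obtain x where x: "x \<in> galg_on n" "e * x * f \<noteq> 0" using ef by (auto simp: linked_def)
    have "star (e * x * f) \<noteq> 0" using x(2) by (metis star_star star_zero)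
    then show ?thesis
      using ef x eE(3) by (intro linkedI[of "star x"]) (auto simp: galg_on_star star_mult mult.assoc)
  qed
  have trans: "linked n e g" if ef: "e \<in> E" "f \<in> E" "g \<in> E" "linked n e f" "linked n f g" for e f g
  proof -
    obtain x y where x: "x \<in> galg_on n" "e * x * f \<noteq> 0" and y: "y \<in> galg_on n" "f * y * g \<noteq> 0"
      using ef by (auto simp: linked_def)
    let ?x = "e * x * f" and ?y = "f * y * g"
    have in_n: "?x \<in> galg_on n" "?y \<in> galg_on n"
      using x y ef eE(1) by (auto intro: galg_on_mult)
    have "e * ?x = ?x" "f * ?y = ?y"
      using ef by (simp_all add: eE(4) flip: mult.assoc)
    moreover have "?x * f = ?x"
      using ef by (simp add: eE(4) mult.assoc)
    ultimately have "e * ?x = ?x" "?x * f = ?x" "f * ?y = ?y"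
      by blast+
    then obtain k where "k \<noteq> 0" "star ?x * ?x = scal k * f"
      using unitary[of e f ?x] ef in_n x by blast
    moreover have "star ?x * (?x * ?y) = (star ?x * ?x) * ?y"
      by (simp only: mult.assoc)
    \<comment> \<open>The product of the two linking elements is nonzero because
      \<open>star ?x\<close> recovers a nonzero multiple of \<open>?y\<close> from it.\<close>
    ultimately have "star ?x * (?x * ?y) = scal k * ?y"
      using \<open>f * ?y = ?y\<close> by (simp only: mult.assoc[of "scal k" f])
    then have "?x * ?y \<noteq> 0"
      using y(2) \<open>k \<noteq> 0\<close> scal_mult_zeroD[of k ?y] by auto
    moreover have "?x * ?y = e * (x * f * f * y) * g"
      by (simp only: mult.assoc)
    moreover have "x * f * f * y \<in> galg_on n"
      by (intro galg_on_mult x y eE(1) ef)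
    ultimately show ?thesis using linkedI by metis
  qed
  \<comment> \<open>Linked idempotents pose the same condition to \<open>SOME\<close>, so the
    representative depends only on the class; it is at the same time the base point through which
    the units are built.\<close>
  define b where "b e = (SOME f. f \<in> E \<and> linked n e f)" for e
  have b: "b e \<in> E" "linked n e (b e)" if "e \<in> E" for e
    using someI_ex[of "\<lambda>f. f \<in> E \<and> linked n e f"] refl[OF that] that unfolding b_def by blast+
  have b_eq: "b e = b f \<longleftrightarrow> linked n e f" if "e \<in> E" "f \<in> E" for e f
  proof
    assume "b e = b f"
    then show "linked n e f" using b that trans sym by metis
  next
    assume "linked n e f"
    then have "(g \<in> E \<and> linked n e g) \<longleftrightarrow> (g \<in> E \<and> linked n f g)" for g
      using that trans sym by blast
    then show "b e = b f" unfolding b_def by simp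
  qed
  have "\<exists>x. x \<in> galg_on n \<and> e * x = x \<and> x * b e = x \<and> x \<noteq> 0" if e: "e \<in> E" for e
  proof -
    obtain x where "x \<in> galg_on n" "e * x * b e \<noteq> 0" using b(2)[OF e] by (auto simp: linked_def)
    then show ?thesis
      using e b(1)[OF e] eE(1,4)
      by (intro exI[of _ "e * x * b e"]) (auto simp: mult.assoc intro: galg_on_mult, simp add: mult.assoc[symmetric])
  qed
  then obtain x where x: "\<And>e. e \<in> E \<Longrightarrow> x e \<in> galg_on n" "\<And>e. e \<in> E \<Longrightarrow> e * x e = x e"
      "\<And>e. e \<in> E \<Longrightarrow> x e * b e = x e" "\<And>e. e \<in> E \<Longrightarrow> x e \<noteq> 0"
    by metis
  obtain k where k: "\<And>e. e \<in> E \<Longrightarrow> k e \<noteq> 0" "\<And>e. e \<in> E \<Longrightarrow> x e * star (x e) = scal (k e) * e"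
    "\<And>e. e \<in> E \<Longrightarrow> star (x e) * x e = scal (k e) * b e"
    using unitary[OF _ b(1) x] by metis
  have sx: "star (x e) * e = star (x e)" "b e * star (x e) = star (x e)" if "e \<in> E" for e
    using x(2,3)[OF that] eE(3)[OF that] eE(3)[OF b(1)[OF that]] by (metis star_mult)+
  \<comment> \<open>A symmetric normalisation would require a square root of
    \<open>k e * k f\<close>. Dividing by \<open>k f\<close> alone stays rational and still makes
    \<open>u e e = e\<close> and the products come out right.\<close>
  define u where "u e f = scal (1 / k f) * (x e * star (x f))" for e f
  have u1: "u e f \<in> galg_on n" if "e \<in> E" "f \<in> E" for e f
    using that x(1) unfolding u_def by (intro galg_on_mult galg_on_scal galg_on_star) auto
  have u2: "u e e = e" if "e \<in> E" for e
    using that k by (simp add: u_def scal_assoc)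
  have u3: "u e f * u f g = u e g" if "e \<in> E" "f \<in> E" "g \<in> E" "b e = b f" for e f g
  proof -
    have "u e f * u f g = scal (1 / k f * (1 / k g)) * (x e * (star (x f) * x f) * star (x g))"
      unfolding u_def scal_mult_scal by (simp only: mult.assoc)
    also have "\<dots> = scal (1 / k f * (1 / k g)) * (scal (k f) * (x e * b e * star (x g)))"
      by (simp only: k(3)[OF that(2)] that(4)[symmetric] mult.assoc scal_left_commute[of "x e"])
    also have "\<dots> = scal (1 / k g) * (x e * b e * star (x g))"
      using k(1)[OF that(2)] by (simp add: scal_assoc)
    finally show ?thesis using x(3)[OF that(1)] by (simp add: u_def)
  qed
  have u4: "e * u e f = u e f" "u e f * f = u e f" if "e \<in> E" "f \<in> E" for e f
  proof -
    have "e * u e f = scal (1 / k f) * ((e * x e) * star (x f))"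
      by (simp add: u_def mult.assoc scal_left_commute[of e])
    then show "e * u e f = u e f" using x(2)[OF that(1)] by (simp add: u_def)
    show "u e f * f = u e f" using sx(1)[OF that(2)] by (simp add: u_def mult.assoc)
  qed
  have u5: "u e f \<noteq> 0" if "e \<in> E" "f \<in> E" "b e = b f" for e f
  proof
    assume "u e f = 0"
    then have "u e e = 0" using u3[OF that(1,2,1,3)] by simp
    then show False using u2 eE(2) that by auto
  qed
  show ?thesis
    unfolding matrix_units_def
  proof (rule exI[of _ E], rule exI[of _ b], rule exI[of _ u], intro conjI ballI impI)
    fix y e f assume y: "y \<in> galg_on n" and ef: "e \<in> E" "f \<in> E"
    show "if b e = b f then \<exists>c. e * y * f = scal c * u e f else e * y * f = 0"
    proof (cases "b e = b f")
      case True
      then show ?thesis using onedim[OF ef u1[OF ef] u4[OF ef] u5[OF ef True] y] by simp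
    next
      case False
      then show ?thesis using b_eq[OF ef] y by (auto simp: linked_def)
    qed
  next
    fix e f g assume "e \<in> E" "f \<in> E" "g \<in> E" "b e = b f" "b f = b g"
    then show "u e f * u f g = u e g" by (intro u3)
  qed (use E(1) in \<open>simp_all add: E(2) eE(4,5) u1 u2 u4 u5\<close>)
qed

text \<open>\<open>D\<close> collects the matrix coefficients of the irreducible representations, \<open>U\<close> the coefficients of
  the matrix units; \<open>b\<close> labels the blocks.\<close>

theorem sym_group_matrix_coefficients:
  "\<exists>(I :: fperm galg set) (b :: fperm galg \<Rightarrow> fperm galg) D U. finite I \<and>
     (\<forall>e\<in>I. \<forall>f\<in>I. b e = b f \<longrightarrow> (\<forall>\<sigma>\<in>carrier (sym_group n). \<forall>\<tau>\<in>carrier (sym_group n).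
         D e f (\<sigma> \<circ> \<tau>) = (\<Sum>g\<in>{g \<in> I. b g = b e}. D e g \<sigma> * D g f \<tau>))) \<and>
     (\<forall>e\<in>I. \<forall>f\<in>I. b e = b f \<longrightarrow> D e f id = (if e = f then 1 else 0)) \<and>
     (\<forall>e\<in>I. \<forall>f\<in>I. \<forall>e'\<in>I. \<forall>f'\<in>I. b e = b f \<longrightarrow> b e' = b f' \<longrightarrow>
         (\<Sum>\<sigma>\<in>carrier (sym_group n). U e f \<sigma> * D e' f' \<sigma>) = (if e = e' \<and> f = f' then 1 else 0 :: rat)) \<and>
     (\<forall>\<sigma>\<in>carrier (sym_group n). \<forall>\<tau>\<in>carrier (sym_group n).
         (\<Sum>(e, f)\<in>{(e, f) \<in> I \<times> I. b e = b f}. D e f \<sigma> * U e f \<tau>) = (if \<sigma> = \<tau> then 1 else 0))"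
proof -
  obtain I b u where mu: "matrix_units n I b u"
    using matrix_units_exist by blast
  have I: "finite I" "\<Sum>I = (1 :: fperm galg)"
    and u: "\<And>e f. e \<in> I \<Longrightarrow> f \<in> I \<Longrightarrow> b e = b f \<Longrightarrow> u e f \<in> galg_on n"
      "\<And>e f. e \<in> I \<Longrightarrow> f \<in> I \<Longrightarrow> b e = b f \<Longrightarrow> u e f \<noteq> 0"
      "\<And>e f. e \<in> I \<Longrightarrow> f \<in> I \<Longrightarrow> b e = b f \<Longrightarrow> e * u e f * f = u e f"
      "\<And>e. e \<in> I \<Longrightarrow> u e e = e"
      "\<And>e f g. e \<in> I \<Longrightarrow> f \<in> I \<Longrightarrow> g \<in> I \<Longrightarrow> b e = b f \<Longrightarrow> b f = b g \<Longrightarrow> u e f * u f g = u e g"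
    and orth: "\<And>e f. e \<in> I \<Longrightarrow> f \<in> I \<Longrightarrow> e * f = (if e = f then e else 0)"
    and span: "\<And>x e f. x \<in> galg_on n \<Longrightarrow> e \<in> I \<Longrightarrow> f \<in> I \<Longrightarrow>
        if b e = b f then \<exists>c. e * x * f = scal c * u e f else e * x * f = 0"
    using mu unfolding matrix_units_def by simp_all
  define D where "D e f x = (SOME c. e * x * f = scal c * u e f)" for e f x
  have D: "e * x * f = scal (D e f x) * u e f"
    if "x \<in> galg_on n" "e \<in> I" "f \<in> I" "b e = b f" for x e f
    using span[OF that(1-3)] that(4) someI_ex[of "\<lambda>c. e * x * f = scal c * u e f"] unfolding D_def by auto
  have D_unique: "D e f x = c"
    if "x \<in> galg_on n" "e \<in> I" "f \<in> I" "b e = b f" "e * x * f = scal c * u e f" for x e f c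
    using D[OF that(1-4)] that(5) u(2)[OF that(2-4)] by (metis scal_cancel)
  let ?G = "carrier (sym_group n)"
  \<comment> \<open>\<open>q\<close> reads a permutation from the function-based group
    \<open>sym_group n\<close> as an element of \<open>fperm\<close>, turning composition into
    addition.\<close>
  define q where "q \<sigma> = inv_into (fsym n) fapp \<sigma>" for \<sigma>
  have bij: "bij_betw fapp (fsym n) ?G"
    using inj_fapp fapp_fsym[of n] by (auto simp: bij_betw_def sym_group_def inj_on_def inj_def)
  have q_in: "q \<sigma> \<in> fsym n" and fq: "fapp (q \<sigma>) = \<sigma>" if "\<sigma> \<in> ?G" for \<sigma>
    using that bij unfolding q_def by (metis bij_betw_imp_surj_on inv_into_into, metis bij_betw_inv_into_right)
  have q_comp: "q (\<sigma> \<circ> \<tau>) = q \<sigma> + q \<tau>" if "\<sigma> \<in> ?G" "\<tau> \<in> ?G" for \<sigma> \<tau>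
  proof -
    have "fapp (q \<sigma> + q \<tau>) = \<sigma> \<circ> \<tau>"
      using that by (auto simp: fq)
    then show ?thesis
      unfolding q_def using q_in[OF that(1)] q_in[OF that(2)]
      by (metis bij bij_betw_imp_inj_on fsym_plus inv_into_f_f q_def)
  qed
  have q_id: "q id = 0"
  proof -
    have *: "id = fapp 0" by (rule ext) simp
    show ?thesis
      unfolding q_def * using bij by (intro inv_into_f_f) (simp_all add: bij_betw_imp_inj_on)
  qed
  have q_inj: "q \<sigma> = q \<tau> \<longleftrightarrow> \<sigma> = \<tau>" if "\<sigma> \<in> ?G" "\<tau> \<in> ?G" for \<sigma> \<tau>
    using fq that by metis
  have q_bij: "bij_betw q ?G (fsym n)"
    unfolding q_def by (rule bij_betw_inv_into[OF bij])
  have Dsum: "D e f x = (\<Sum>\<sigma>\<in>?G. gcoeff x (q \<sigma>) * D e f (gel (q \<sigma>)))"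
    if "x \<in> galg_on n" "e \<in> I" "f \<in> I" "b e = b f" for x e f
  proof (rule D_unique[OF that])
    have "x = (\<Sum>g\<in>fsym n. scal (gcoeff x g) * gel g)"
      using that(1) by (intro galg_expand) (auto simp: galg_on_def)
    also have "\<dots> = (\<Sum>\<sigma>\<in>?G. scal (gcoeff x (q \<sigma>)) * gel (q \<sigma>))"
      using sum.reindex_bij_betw[OF q_bij, symmetric] .
    finally have x: "x = \<dots>" .
    have "e * x * f = (\<Sum>\<sigma>\<in>?G. e * (scal (gcoeff x (q \<sigma>)) * gel (q \<sigma>)) * f)"
      by (subst x) (simp only: sum_distrib_left sum_distrib_right)
    also have "\<dots> = (\<Sum>\<sigma>\<in>?G. scal (gcoeff x (q \<sigma>)) * (e * gel (q \<sigma>) * f))"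
      by (simp only: scal_left_commute[of e] mult.assoc)
    also have "\<dots> = (\<Sum>\<sigma>\<in>?G. scal (gcoeff x (q \<sigma>)) * (scal (D e f (gel (q \<sigma>))) * u e f))"
      using that q_in by (intro sum.cong) (auto simp: D galg_on_gel)
    also have "\<dots> = (\<Sum>\<sigma>\<in>?G. scal (gcoeff x (q \<sigma>) * D e f (gel (q \<sigma>)))) * u e f"
      by (simp only: scal_assoc sum_distrib_right)
    also have "(\<Sum>\<sigma>\<in>?G. scal (gcoeff x (q \<sigma>) * D e f (gel (q \<sigma>)))) =
        scal (\<Sum>\<sigma>\<in>?G. gcoeff x (q \<sigma>) * D e f (gel (q \<sigma>)))"
      by (rule scal_sum[symmetric])
    finally show "e * x * f = scal (\<Sum>\<sigma>\<in>?G. gcoeff x (q \<sigma>) * D e f (gel (q \<sigma>))) * u e f" .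
  qed
  have Dmult: "D e f (x * y) = (\<Sum>g\<in>{g \<in> I. b g = b e}. D e g x * D g f y)"
    if "x \<in> galg_on n" "y \<in> galg_on n" "e \<in> I" "f \<in> I" "b e = b f" for x y e f
  proof (rule D_unique[OF galg_on_mult[OF that(1,2)] that(3-5)])
    have "e * (x * y) * f = e * x * (\<Sum>I) * y * f"
      by (simp add: I(2) mult.assoc)
    also have "\<dots> = (\<Sum>g\<in>I. (e * x * g) * (g * y * f))"
      using orth by (simp add: sum_distrib_left sum_distrib_right mult.assoc) (simp add: mult.assoc[symmetric])
    also have "\<dots> = (\<Sum>g\<in>{g \<in> I. b g = b e}. (e * x * g) * (g * y * f))"
    proof -
      have "e * x * g = 0" if "g \<in> I" "b g \<noteq> b e" for g
        using span[OF \<open>x \<in> galg_on n\<close> \<open>e \<in> I\<close> that(1)] that(2) by (simp split: if_splits)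
      then show ?thesis
        using I(1) by (intro sum.mono_neutral_right) auto
    qed
    also have "\<dots> = (\<Sum>g\<in>{g \<in> I. b g = b e}. scal (D e g x * D g f y) * u e f)"
    proof (rule sum.cong)
      fix g assume g: "g \<in> {g \<in> I. b g = b e}"
      have "(e * x * g) * (g * y * f) = (scal (D e g x) * u e g) * (scal (D g f y) * u g f)"
          using g that by (simp add: D)
      also have "\<dots> = scal (D e g x * D g f y) * (u e g * u g f)"
        by (rule scal_mult_scal)
      finally show "(e * x * g) * (g * y * f) = scal (D e g x * D g f y) * u e f"
        using g that u(5)[of e g f] by simp
    qed simp
    also have "\<dots> = scal (\<Sum>g\<in>{g \<in> I. b g = b e}. D e g x * D g f y) * u e f"
      by (simp only: scal_sum sum_distrib_right)
    finally show "e * (x * y) * f = scal (\<Sum>g\<in>{g \<in> I. b g = b e}. D e g x * D g f y) * u e f" .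
  qed
  have Done: "D e f 1 = (if e = f then 1 else 0)" if "e \<in> I" "f \<in> I" "b e = b f" for e f
    using that u(4) orth by (intro D_unique) auto
  have Du: "D e' f' (u e f) = (if e = e' \<and> f = f' then 1 else 0)"
    if "e \<in> I" "f \<in> I" "e' \<in> I" "f' \<in> I" "b e = b f" "b e' = b f'" for e f e' f'
  proof (rule D_unique[OF u(1)[OF that(1,2,5)] that(3,4,6)])
    have "e' * u e f * f' = (e' * e) * u e f * (f * f')"
      by (subst u(3)[OF that(1,2,5), symmetric]) (simp add: mult.assoc)
    then show "e' * u e f * f' = scal (if e = e' \<and> f = f' then 1 else 0) * u e' f'"
      using that orth u(3)[OF that(1,2,5)] by (auto simp: mult.assoc)
  qed
  have expand: "x = (\<Sum>(e, f)\<in>{(e, f) \<in> I \<times> I. b e = b f}. scal (D e f x) * u e f)" if "x \<in> galg_on n" for x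
  proof -
    have "x = (\<Sum>I) * x * (\<Sum>I)"
      by (simp add: I(2))
    also have "\<dots> = (\<Sum>(e, f)\<in>I \<times> I. e * x * f)"
      by (simp add: sum_distrib_left sum_distrib_right sum.cartesian_product[symmetric]) (rule sum.swap)
    also have "\<dots> = (\<Sum>(e, f)\<in>{(e, f) \<in> I \<times> I. b e = b f}. e * x * f)"
    proof -
      have "e * x * f = 0" if "e \<in> I" "f \<in> I" "b e \<noteq> b f" for e f
        using span[OF \<open>x \<in> galg_on n\<close> that(1,2)] that(3) by simp
      then show ?thesis
        using I(1) by (intro sum.mono_neutral_right) auto
    qed
    also have "\<dots> = (\<Sum>(e, f)\<in>{(e, f) \<in> I \<times> I. b e = b f}. scal (D e f x) * u e f)"
      using D[OF that] by (intro sum.cong) auto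
    finally show ?thesis .
  qed
  show ?thesis
  proof (rule exI[of _ I], rule exI[of _ b], rule exI[of _ "\<lambda>e f \<sigma>. D e f (gel (q \<sigma>))"],
      rule exI[of _ "\<lambda>e f \<sigma>. gcoeff (u e f) (q \<sigma>)"], intro conjI ballI impI)
    show "finite I" by (rule I(1))
    fix e f assume ef: "e \<in> I" "f \<in> I" "b e = b f"
    show "D e f (gel (q (\<sigma> \<circ> \<tau>))) = (\<Sum>g | g \<in> I \<and> b g = b e. D e g (gel (q \<sigma>)) * D g f (gel (q \<tau>)))"
      if st: "\<sigma> \<in> ?G" "\<tau> \<in> ?G" for \<sigma> \<tau>
      using Dmult[OF galg_on_gel[OF q_in[OF st(1)]] galg_on_gel[OF q_in[OF st(2)]] ef] q_comp[OF st]
      by (simp add: mult_single)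
    show "D e f (gel (q id)) = (if e = f then 1 else 0)"
      using Done[OF ef] by (simp add: q_id)
  next
    fix e f e' f' assume "e \<in> I" "f \<in> I" "e' \<in> I" "f' \<in> I" "b e = b f" "b e' = b f'"
    then show "(\<Sum>\<sigma>\<in>?G. gcoeff (u e f) (q \<sigma>) * D e' f' (gel (q \<sigma>))) = (if e = e' \<and> f = f' then 1 else 0)"
      using Dsum[of "u e f" e' f'] Du[of e f e' f'] u(1) by simp
  next
    fix \<sigma> \<tau> assume st: "\<sigma> \<in> ?G" "\<tau> \<in> ?G"
    \<comment> \<open>The coefficient at \<tau> of the expansion of the group element \<sigma> in
      matrix units. The preceding goal evaluates \<open>D\<close> on the units; together the two say
      that \<open>D\<close> and \<open>U\<close> are inverse to each other.\<close>
    have "gcoeff (gel (q \<sigma>)) (q \<tau>) =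
        (\<Sum>(e, f)\<in>{(e, f) \<in> I \<times> I. b e = b f}. D e f (gel (q \<sigma>)) * gcoeff (u e f) (q \<tau>))"
      by (subst expand[OF galg_on_gel[OF q_in[OF st(1)]]]) (simp add: lookup_sum case_prod_unfold)
    then show "(\<Sum>(e, f) | (e, f) \<in> I \<times> I \<and> b e = b f. D e f (gel (q \<sigma>)) * gcoeff (u e f) (q \<tau>)) =
        (if \<sigma> = \<tau> then 1 else 0)"
      using q_inj[OF st] by (simp add: lookup_single when_def)
  qed
qed


section \<open>Diagrams as matchings\<close>

text \<open>Stated for an arbitrary type so that the cups of a diagram, which live on numbers, and
  the diagram itself, which lives on points, fall under the same lemmas.\<close>

definition matching :: "'a set \<Rightarrow> 'a set set \<Rightarrow> bool" where
  "matching S C \<longleftrightarrow> partition_on S C \<and> (\<forall>e\<in>C. card e = 2)"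

lemma brauer_iff_matching: "f \<in> brauer p q \<longleftrightarrow> matching (points p q) f"
  by (simp add: brauer_def matching_def)

lemma matching_iff:
  "matching S C \<longleftrightarrow> \<Union>C = S \<and> (\<forall>e\<in>C. \<exists>x y. x \<noteq> y \<and> e = {x, y}) \<and> (\<forall>e\<in>C. \<forall>e'\<in>C. \<forall>x. x \<in> e \<longrightarrow> x \<in> e' \<longrightarrow> e = e')"
proof -
  let ?two = "\<forall>e\<in>C. \<exists>x y. x \<noteq> y \<and> e = {x, y}"
  have two: "(\<forall>e\<in>C. card e = 2) \<longleftrightarrow> ?two"
    by (rule ball_cong) (auto simp: card_2_iff)
  have disj: "disjoint C \<longleftrightarrow> (\<forall>e\<in>C. \<forall>e'\<in>C. \<forall>x. x \<in> e \<longrightarrow> x \<in> e' \<longrightarrow> e = e')"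
    by (auto simp: pairwise_def disjnt_iff)
  have "?two \<Longrightarrow> {} \<notin> C"
    by fastforce
  then show ?thesis
    unfolding matching_def partition_on_def two disj by argo
qed

lemma matching_edge:
  assumes "matching S C" "e \<in> C"
  obtains x y where "x \<noteq> y" "e = {x, y}" "x \<in> S" "y \<in> S"
proof -
  obtain x y where "x \<noteq> y" "e = {x, y}"
    using assms by (auto simp: matching_iff)
  moreover have "e \<subseteq> S" using assms by (auto simp: matching_iff)
  ultimately show ?thesis using that by auto
qed

lemma matching_unique: "matching S C \<Longrightarrow> e \<in> C \<Longrightarrow> e' \<in> C \<Longrightarrow> x \<in> e \<Longrightarrow> x \<in> e' \<Longrightarrow> e = e'"
  unfolding matching_iff by metis

lemma matching_partner: "matching S C \<Longrightarrow> {x, y} \<in> C \<Longrightarrow> {x, z} \<in> C \<Longrightarrow> y = z"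
  using matching_unique[of S C "{x, y}" "{x, z}" x] by (auto simp: doubleton_eq_iff)

lemma matching_union: "matching S C \<Longrightarrow> \<Union>C = S"
  by (simp add: matching_iff)

lemma matching_mem: "matching S C \<Longrightarrow> e \<in> C \<Longrightarrow> x \<in> e \<Longrightarrow> x \<in> S"
  by (auto simp: matching_iff)

lemma matching_image:
  assumes "matching S C" "inj_on k S"
  shows "matching (k ` S) ((`) k ` C)"
  unfolding matching_iff
proof (intro conjI ballI allI impI)
  show "\<Union> ((`) k ` C) = k ` S"
    using matching_union[OF assms(1)] by auto
next
  fix e assume "e \<in> (`) k ` C"
  then obtain e0 where e0: "e0 \<in> C" "e = k ` e0" by auto
  obtain x y where "x \<noteq> y" "e0 = {x, y}" "x \<in> S" "y \<in> S"
    using matching_edge[OF assms(1) e0(1)] by blast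
  then show "\<exists>x y. x \<noteq> y \<and> e = {x, y}"
    using e0(2) assms(2) by (intro exI[of _ "k x"] exI[of _ "k y"]) (auto simp: inj_on_def)
next
  fix e e' x assume "e \<in> (`) k ` C" "e' \<in> (`) k ` C" "x \<in> e" "x \<in> e'"
  then obtain d d' y y' where d: "d \<in> C" "d' \<in> C" "e = k ` d" "e' = k ` d'" "y \<in> d" "y' \<in> d'" "x = k y" "x = k y'"
    by auto
  then have "y \<in> S" "y' \<in> S" using matching_union[OF assms(1)] by auto
  then have "y = y'" using d(7,8) assms(2) inj_onD by metis
  then show "e = e'" using matching_unique[OF assms(1)] d by metis
qed

lemma matching_Un:
  assumes "matching S C" "matching T D" "S \<inter> T = {}"
  shows "matching (S \<union> T) (C \<union> D)"
  unfolding matching_iff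
proof (intro conjI ballI allI impI)
  show "\<Union>(C \<union> D) = S \<union> T"
    using assms(1,2)[THEN matching_union] by auto
next
  fix e assume "e \<in> C \<union> D"
  then show "\<exists>x y. x \<noteq> y \<and> e = {x, y}"
    using matching_edge[OF assms(1)] matching_edge[OF assms(2)] by (metis UnE)
next
  fix e e' x assume e: "e \<in> C \<union> D" "e' \<in> C \<union> D" and x: "x \<in> e" "x \<in> e'"
  have "x \<notin> \<Union>C \<or> x \<notin> \<Union>D"
    using assms(3) assms(1,2)[THEN matching_union] by auto
  then have "e \<in> C \<and> e' \<in> C \<or> e \<in> D \<and> e' \<in> D"
    using e x by auto
  then show "e = e'"
    using matching_unique[OF assms(1)] matching_unique[OF assms(2)] x by metis
qed

lemma matching_subset:
  assumes "matching S C" "D \<subseteq> C"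
  shows "matching (\<Union>D) D"
  unfolding matching_iff
proof (intro conjI ballI allI impI)
  fix e assume "e \<in> D"
  then show "\<exists>x y. x \<noteq> y \<and> e = {x, y}"
    using matching_edge[OF assms(1)] assms(2) by (metis subsetD)
next
  fix e e' x assume "e \<in> D" "e' \<in> D" "x \<in> e" "x \<in> e'"
  then show "e = e'"
    using matching_unique[OF assms(1)] assms(2) by (metis subsetD)
qed simp

lemma matching_card:
  assumes "matching S C" "finite S"
  shows "card S = 2 * card C"
proof -
  have "card (\<Union>C) = (\<Sum>e\<in>C. card e)"
    using assms by (intro card_Union_disjoint) (auto simp: matching_def partition_on_def disjoint_def pairwise_def disjnt_def
        intro: finite_subset)
  also have "\<dots> = (\<Sum>e\<in>C. 2)"
    using assms(1) by (intro sum.cong) (auto simp: matching_def)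
  finally show ?thesis using matching_union[OF assms(1)] by simp
qed

lemma matching_empty: "matching {} C \<longleftrightarrow> C = {}"
  by (auto simp: matching_iff)

text \<open>Here \<open>perm_diagram\<close> is applied to an arbitrary injection, so that it also
  describes the through strands of an upward diagram.\<close>

lemma matching_perm_diagram:
  assumes "inj_on h {1..t}"
  shows "matching (Top ` {1..t} \<union> Bot ` h ` {1..t}) (perm_diagram t h)"
  unfolding matching_iff
proof (intro conjI ballI allI impI)
  fix e e' x assume "e \<in> perm_diagram t h" "e' \<in> perm_diagram t h" and x: "x \<in> e" "x \<in> e'"
  then obtain i k where ik: "i \<in> {1..t}" "k \<in> {1..t}" "e = {Top i, Bot (h i)}" "e' = {Top k, Bot (h k)}"
    unfolding perm_diagram_def by blast
  then have "i = k \<or> h i = h k" using x by auto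
  then show "e = e'" using ik inj_onD[OF assms] by metis
qed (auto simp: perm_diagram_def)

text \<open>An upward diagram consists of the through strands given by \<open>h\<close> and of the cups \<open>C\<close> on the
  remaining bottom points.\<close>

definition up_data :: "nat \<Rightarrow> nat \<Rightarrow> (nat \<Rightarrow> nat) \<Rightarrow> nat set set \<Rightarrow> bool" where
  "up_data t q h C \<longleftrightarrow> inj_on h {1..t} \<and> h ` {1..t} \<subseteq> {1..q} \<and> matching ({1..q} - h ` {1..t}) C"

definition up_diagram :: "nat \<Rightarrow> (nat \<Rightarrow> nat) \<Rightarrow> nat set set \<Rightarrow> diagram" where
  "up_diagram t h C = perm_diagram t h \<union> (`) Bot ` C"

lemma inj_Bot [simp]: "inj_on Bot S" and inj_Top [simp]: "inj_on Top S"
  by (auto simp: inj_on_def)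

lemma perm_diagram_cong:
  "(\<And>i. i \<in> {1..t} \<Longrightarrow> h i = h' i) \<Longrightarrow> perm_diagram t h = perm_diagram t h'"
  unfolding perm_diagram_def by (rule image_cong) auto

lemma up_diagram_cong:
  "(\<And>i. i \<in> {1..t} \<Longrightarrow> h i = h' i) \<Longrightarrow> up_diagram t h C = up_diagram t h' C"
  unfolding up_diagram_def using perm_diagram_cong[of t h h'] by simp

lemma up_diagram_brauer:
  assumes "up_data t q h C"
  shows "up_diagram t h C \<in> brauer_up t q"
proof -
  have "matching ((Top ` {1..t} \<union> Bot ` h ` {1..t}) \<union> Bot ` ({1..q} - h ` {1..t})) (up_diagram t h C)"
    unfolding up_diagram_def using assms
    by (intro matching_Un matching_perm_diagram matching_image) (auto simp: up_data_def)
  moreover have "(Top ` {1..t} \<union> Bot ` h ` {1..t}) \<union> Bot ` ({1..q} - h ` {1..t}) = points t q"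
    using assms by (auto simp: up_data_def points_def)
  ultimately show ?thesis
    by (auto simp: brauer_up_def brauer_iff_matching upward_def up_diagram_def perm_diagram_def doubleton_eq_iff)
qed

lemma Top_Bot_in_up_diagram:
  "{Top i, Bot j} \<in> up_diagram t h C \<longleftrightarrow> i \<in> {1..t} \<and> j = h i"
  by (auto simp: up_diagram_def perm_diagram_def doubleton_eq_iff)

lemma Bot_image_in_up_diagram: "(`) Bot e \<in> up_diagram t h C \<longleftrightarrow> e \<in> C"
proof -
  have "Bot ` e = Bot ` e' \<longleftrightarrow> e = e'" for e e' :: "nat set"
    by (simp add: inj_image_eq_iff)
  moreover have "Bot ` e \<notin> perm_diagram t h"
    by (auto simp: perm_diagram_def)
  ultimately show ?thesis
    by (auto simp: up_diagram_def)
qed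

lemma up_diagram_eqD:
  assumes "up_diagram t h C = up_diagram t h' C'"
  shows "C = C'" "i \<in> {1..t} \<Longrightarrow> h i = h' i"
proof -
  show "C = C'" by (rule Set.set_eqI) (metis Bot_image_in_up_diagram assms)
  show "h i = h' i" if "i \<in> {1..t}" using that by (metis Top_Bot_in_up_diagram assms)
qed

text \<open>In an upward diagram the partner of a top point is a bottom point, and this defines
  \<open>h\<close>. Every edge without a top point is the image of a set of numbers under
  \<open>Bot\<close>, and these sets form \<open>C\<close>.\<close>

lemma up_diagram_exists:
  assumes "f \<in> brauer_up t q"
  obtains h C where "up_data t q h C" "f = up_diagram t h C"
proof -
  have f: "matching (points t q) f" and up: "upward f"
    using assms by (auto simp: brauer_up_def brauer_iff_matching)
  have "\<exists>j. {Top i, Bot j} \<in> f" if "i \<in> {1..t}" for i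
  proof -
    have "Top i \<in> \<Union>f" using that matching_union[OF f] by (auto simp: points_def)
    then obtain e where "e \<in> f" "Top i \<in> e" by auto
    then obtain y where y: "e = {Top i, y}"
      using matching_edge[OF f] by (metis insert_commute insertE singletonD)
    with up \<open>e \<in> f\<close> show ?thesis
      by (cases y) (auto simp: upward_def)
  qed
  then obtain h where h: "\<And>i. i \<in> {1..t} \<Longrightarrow> {Top i, Bot (h i)} \<in> f"
    by metis
  define C where "C = {e. Bot ` e \<in> f}"
  have through: "e = {Top i, Bot (h i)} \<and> i \<in> {1..t}" if "e \<in> f" "Top i \<in> e" for e i
  proof -
    have "Top i \<in> points t q" using that matching_union[OF f] by auto
    then have "i \<in> {1..t}" by (auto simp: points_def)
    then show ?thesis using that h[of i] matching_unique[OF f, of e "{Top i, Bot (h i)}" "Top i"] by auto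
  qed
  have range: "h i \<in> {1..q}" if "i \<in> {1..t}" for i
    using h[OF that] matching_union[OF f] by (auto simp: points_def)
  have inj: "inj_on h {1..t}"
  proof (rule inj_onI)
    fix i k assume "i \<in> {1..t}" "k \<in> {1..t}" "h i = h k"
    then have "{Bot (h i), Top i} \<in> f" "{Bot (h i), Top k} \<in> f"
      using h by (metis insert_commute)+
    then show "i = k" using matching_partner[OF f] by blast
  qed
  have bots: "\<exists>e'. e = Bot ` e'" if "\<forall>i. Top i \<notin> e" for e
  proof -
    have "e = Bot ` (Bot -` e)"
      using that by (auto simp: image_iff) (metis point.exhaust)
    then show ?thesis ..
  qed
  have split: "f = perm_diagram t h \<union> (`) Bot ` C"
  proof (intro equalityI subsetI)
    fix e assume e: "e \<in> f"
    show "e \<in> perm_diagram t h \<union> (`) Bot ` C"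
    proof (cases "\<exists>i. Top i \<in> e")
      case True
      then show ?thesis using through[OF e] unfolding perm_diagram_def by blast
    next
      case False
      then show ?thesis using e bots[of e] by (auto simp: C_def)
    qed
  next
    fix e assume "e \<in> perm_diagram t h \<union> (`) Bot ` C"
    then show "e \<in> f" using h by (auto simp: perm_diagram_def C_def)
  qed
  have "\<Union>((`) Bot ` C) = Bot ` ({1..q} - h ` {1..t})"
  proof (intro equalityI subsetI)
    fix x assume "x \<in> \<Union>((`) Bot ` C)"
    then obtain e j where e: "Bot ` e \<in> f" "j \<in> e" "x = Bot j" by (auto simp: C_def)
    then have "Bot j \<in> points t q" using matching_union[OF f] by blast
    moreover have "j \<notin> h ` {1..t}"
    proof
      assume "j \<in> h ` {1..t}"
      then obtain i where "i \<in> {1..t}" "j = h i" by auto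
      then have "Bot ` e = {Top i, Bot j}"
        using matching_unique[OF f e(1) h[of i], of "Bot j"] e by auto
      then show False by auto
    qed
    ultimately show "x \<in> Bot ` ({1..q} - h ` {1..t})" using e by (auto simp: points_def)
  next
    fix x assume "x \<in> Bot ` ({1..q} - h ` {1..t})"
    then obtain j where j: "x = Bot j" "j \<in> {1..q}" "j \<notin> h ` {1..t}" by auto
    then have "x \<in> \<Union>f" unfolding matching_union[OF f] by (auto simp: points_def)
    then obtain e where "e \<in> f" "x \<in> e" by blast
    then show "x \<in> \<Union>((`) Bot ` C)"
      using j through[of e] by (subst (asm) split) (auto simp: perm_diagram_def)
  qed
  then have "matching (Bot ` ({1..q} - h ` {1..t})) ((`) Bot ` C)"
    using matching_subset[OF f, of "(`) Bot ` C"] by (auto simp: C_def)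
  from matching_image[OF this, of "inv_into UNIV Bot"]
  have "matching ({1..q} - h ` {1..t}) C"
    by (simp add: image_image inj_on_def inv_into_f_f image_inv_into_cancel)
  moreover have "h ` {1..t} \<subseteq> {1..q}"
    using range by blast
  ultimately show ?thesis
    using that[of h C] inj split unfolding up_data_def up_diagram_def by blast
qed

lemma monotone_up_diagram_iff:
  "monotone_diagram (up_diagram t h C) \<longleftrightarrow> strict_mono_on {1..t} h"
proof
  assume m: "monotone_diagram (up_diagram t h C)"
  show "strict_mono_on {1..t} h"
  proof (rule strict_mono_onI)
    fix i k assume ik: "i \<in> {1..t}" "k \<in> {1..t}" "i < k"
    then have "(int i - int k) * (int (h i) - int (h k)) > 0"
      using m unfolding monotone_diagram_def Top_Bot_in_up_diagram by (auto simp: doubleton_eq_iff)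
    then show "h i < h k" using ik by (simp add: zero_less_mult_iff)
  qed
next
  assume h: "strict_mono_on {1..t} h"
  have "(int i - int k) * (int (h i) - int (h k)) > 0" if "i \<in> {1..t}" "k \<in> {1..t}" "i \<noteq> k" for i k
    using that strict_mono_onD[OF h, of i k] strict_mono_onD[OF h, of k i]
    by (cases i k rule: linorder_cases) (auto simp: zero_less_mult_iff)
  then show "monotone_diagram (up_diagram t h C)"
    unfolding monotone_diagram_def Top_Bot_in_up_diagram by auto
qed

lemma up_mono_iff:
  "f \<in> brauer_up_mono t q \<longleftrightarrow> (\<exists>h C. up_data t q h C \<and> strict_mono_on {1..t} h \<and> f = up_diagram t h C)"
proof
  assume "f \<in> brauer_up_mono t q"
  then have f: "f \<in> brauer_up t q" "monotone_diagram f"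
    by (auto simp: brauer_up_mono_def brauer_up_def)
  then show "\<exists>h C. up_data t q h C \<and> strict_mono_on {1..t} h \<and> f = up_diagram t h C"
    by (metis monotone_up_diagram_iff up_diagram_exists)
next
  assume "\<exists>h C. up_data t q h C \<and> strict_mono_on {1..t} h \<and> f = up_diagram t h C"
  then show "f \<in> brauer_up_mono t q"
    using up_diagram_brauer monotone_up_diagram_iff by (auto simp: brauer_up_mono_def brauer_up_def)
qed

text \<open>The bottom points off the strands are paired by the cups, so \<open>q - t\<close> is
  twice the number of cups.\<close>

lemma up_data_parity:
  assumes "up_data t q h C"
  shows "t \<preceq> q"
proof -
  have "card (h ` {1..t}) = t" "h ` {1..t} \<subseteq> {1..q}"
    using assms by (auto simp: up_data_def card_image)
  moreover have "card ({1..q} - h ` {1..t}) = 2 * card C"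
    using assms by (intro matching_card) (auto simp: up_data_def)
  ultimately show ?thesis
    using card_mono[of "{1..q}" "h ` {1..t}"]
    by (auto simp: parity_le_def card_Diff_subset finite_subset)
qed


subsection \<open>Flipping\<close>

lemma flip_point_flip_point [simp]: "flip_point (flip_point x) = x"
  by (cases x) auto

lemma flip_flip [simp]: "flip (flip f) = f"
  by (simp add: flip_def image_image)

lemma inj_flip_point: "inj_on flip_point S"
  by (metis flip_point_flip_point inj_onI)

lemma flip_points: "flip_point ` points p q = points q p"
  by (auto simp: points_def image_Un image_image)

lemma flip_brauer: "f \<in> brauer p q \<Longrightarrow> flip f \<in> brauer q p"
  using matching_image[OF _ inj_flip_point] flip_points by (metis brauer_iff_matching flip_def)

lemma in_flip_iff: "{x, y} \<in> flip f \<longleftrightarrow> {flip_point x, flip_point y} \<in> f"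
proof -
  have "{x, y} \<in> flip f" if "{flip_point x, flip_point y} \<in> f" for x y f
    using that unfolding flip_def by (intro image_eqI[of _ _ "{flip_point x, flip_point y}"]) auto
  then show ?thesis by (metis flip_flip flip_point_flip_point)
qed

lemma downward_flip [simp]: "downward (flip f) \<longleftrightarrow> upward f"
  by (simp add: downward_def upward_def in_flip_iff)

lemma monotone_flip [simp]: "monotone_diagram (flip f) \<longleftrightarrow> monotone_diagram f"
proof -
  have "monotone_diagram (flip f)" if m: "monotone_diagram f" for f
    unfolding monotone_diagram_def in_flip_iff
  proof (intro allI impI)
    fix i j k l
    assume "{flip_point (Top i), flip_point (Bot j)} \<in> f" "{flip_point (Top k), flip_point (Bot l)} \<in> f"
      "{Top i, Bot j} \<noteq> {Top k, Bot l}"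
    then have "(int j - int l) * (int i - int k) > 0"
      using m[unfolded monotone_diagram_def, rule_format, of j i l k]
      by (auto simp: insert_commute doubleton_eq_iff)
    then show "(int i - int k) * (int j - int l) > 0"
      by (simp add: mult.commute)
  qed
  then show ?thesis by (metis flip_flip)
qed

lemma flip_up_mono: "flip f \<in> brauer_down_mono p t \<longleftrightarrow> f \<in> brauer_up_mono t p"
  using flip_brauer[of f t p] flip_brauer[of "flip f" p t]
  by (auto simp: brauer_down_mono_def brauer_up_mono_def)

lemma flip_up_diagram:
  "flip (up_diagram t l D) = (\<lambda>i. {Top (l i), Bot i}) ` {1..t} \<union> (`) Top ` D"
  by (auto simp: flip_def up_diagram_def perm_diagram_def image_Un image_image insert_commute)


subsection \<open>Concatenation with an upward diagram\<close>

fun map_bot :: "(nat \<Rightarrow> nat) \<Rightarrow> point \<Rightarrow> point" where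
  "map_bot h (Top i) = Top i"
| "map_bot h (Bot j) = Bot (h j)"

lemma map_bot_inj:
  assumes "inj_on h {1..t}"
  shows "inj_on (map_bot h) (points p t)"
proof (rule inj_onI)
  fix x y assume "x \<in> points p t" "y \<in> points p t" "map_bot h x = map_bot h y"
  then show "x = y"
    by (cases x; cases y) (auto simp: points_def inj_on_eq_iff[OF assms])
qed

lemma matching_concat:
  assumes "up_data t q h C" "g \<in> brauer p t"
  shows "matching (points p q) ((`) (map_bot h) ` g \<union> (`) Bot ` C)"
proof -
  have "matching (map_bot h ` points p t \<union> Bot ` ({1..q} - h ` {1..t})) ((`) (map_bot h) ` g \<union> (`) Bot ` C)"
    using assms by (intro matching_Un matching_image map_bot_inj) (auto simp: up_data_def brauer_iff_matching points_def)
  moreover have "map_bot h ` points p t \<union> Bot ` ({1..q} - h ` {1..t}) = points p q"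
    using assms by (auto simp: points_def up_data_def image_Un image_image)
  ultimately show ?thesis by simp
qed

text \<open>Collapsing the middle level onto the bottom level along the through strands turns every edge of
  the glued graph into a point or an edge of the right-hand side, which is a matching; so paths do not
  lead any further.\<close>

lemma concat_up_diagram:
  assumes u: "up_data t q h C" and g: "g \<in> brauer p t"
  shows "up_diagram t h C \<bullet> g = (`) (map_bot h) ` g \<union> (`) Bot ` C"
proof -
  define N where "N = (`) (map_bot h) ` g \<union> (`) Bot ` C"
  have N: "matching (points p q) N"
    unfolding N_def by (rule matching_concat[OF u g])
  have gm: "matching (points p t) g" using g by (simp add: brauer_iff_matching)
  have Cm: "matching ({1..q} - h ` {1..t}) C" using u by (simp add: up_data_def)
  define \<rho> where "\<rho> = (\<lambda>(l, i). if l = (0::nat) then Top i else if l = 1 then Bot (h i) else Bot i)"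
  have \<rho>_outer: "\<rho> (outer_pos x) = x" for x by (cases x) (auto simp: \<rho>_def)
  have \<rho>_upper: "\<rho> (upper_pos x) = map_bot h x" for x by (cases x) (auto simp: \<rho>_def)
  let ?G = "glued (up_diagram t h C) g"
  have edge: "\<rho> u = \<rho> v \<or> {\<rho> u, \<rho> v} \<in> N" if "(u, v) \<in> ?G" for u v
    using that unfolding glued_def
  proof (elim UnE CollectE exE conjE)
    fix x y assume "(u, v) = (upper_pos x, upper_pos y)" "{x, y} \<in> g"
    then have eq: "{\<rho> u, \<rho> v} = map_bot h ` {x, y}" by (simp add: \<rho>_upper)
    have "map_bot h ` {x, y} \<in> N" using \<open>{x, y} \<in> g\<close> unfolding N_def by blast
    then show ?thesis unfolding eq by simp
  next
    fix x y assume uv: "(u, v) = (lower_pos x, lower_pos y)" and xy: "{x, y} \<in> up_diagram t h C"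
    show ?thesis
    proof (cases "{x, y} \<in> perm_diagram t h")
      case True
      then obtain i where "{x, y} = {Top i, Bot (h i)}" by (auto simp: perm_diagram_def)
      then show ?thesis using uv by (auto simp: doubleton_eq_iff \<rho>_def)
    next
      case False
      then obtain e where e: "e \<in> C" "{x, y} = Bot ` e" using xy by (auto simp: up_diagram_def)
      then have "x \<in> range Bot" "y \<in> range Bot" by auto
      then have "\<rho> (lower_pos x) = x" "\<rho> (lower_pos y) = y" by (auto simp: \<rho>_def)
      then show ?thesis using uv e by (auto simp: N_def)
    qed
  qed
  have path: "\<rho> u = \<rho> v \<or> {\<rho> u, \<rho> v} \<in> N" if "(u, v) \<in> ?G\<^sup>+" for u v
    using that
  proof (induction rule: trancl_induct)
    case (base y)
    then show ?case by (rule edge)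
  next
    case (step y z)
    have "\<rho> u = \<rho> z" if "{\<rho> u, \<rho> y} \<in> N" "{\<rho> y, \<rho> z} \<in> N"
      using matching_partner[OF N, of "\<rho> y" "\<rho> u" "\<rho> z"] that by (simp add: insert_commute)
    then show ?case using step.IH edge[OF step.hyps(2)] by auto
  qed
  have sym: "(v, u) \<in> ?G" if "(u, v) \<in> ?G" for u v
    using that unfolding glued_def
  proof (elim UnE CollectE exE conjE)
    fix x y assume "(u, v) = (upper_pos x, upper_pos y)" "{x, y} \<in> g"
    then have "v = upper_pos y" "u = upper_pos x" "{y, x} \<in> g" by (simp_all add: insert_commute)
    then show "(v, u) \<in> {(upper_pos x, upper_pos y) |x y. {x, y} \<in> g} \<union>
        {(lower_pos x, lower_pos y) |x y. {x, y} \<in> up_diagram t h C}" by blast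
  next
    fix x y assume "(u, v) = (lower_pos x, lower_pos y)" "{x, y} \<in> up_diagram t h C"
    then have "v = lower_pos y" "u = lower_pos x" "{y, x} \<in> up_diagram t h C" by (simp_all add: insert_commute)
    then show "(v, u) \<in> {(upper_pos x, upper_pos y) |x y. {x, y} \<in> g} \<union>
        {(lower_pos x, lower_pos y) |x y. {x, y} \<in> up_diagram t h C}" by blast
  qed
  \<comment> \<open>For the converse inclusion: a bottom point of \<open>g\<close> sits on the
    middle level and is joined by one strand to its image on the bottom level; a top point is
    already an outer point.\<close>
  have upper: "(outer_pos (map_bot h x), upper_pos x) \<in> ?G\<^sup>*" if "x \<in> points p t" for x
  proof (cases x)
    case (Bot j)
    then have "{Bot (h j), Top j} \<in> up_diagram t h C"
      using that Top_Bot_in_up_diagram[of j "h j" t h C] by (auto simp: points_def insert_commute)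
    then have "(lower_pos (Bot (h j)), lower_pos (Top j)) \<in> ?G"
      unfolding glued_def by blast
    then show ?thesis using Bot by auto
  qed auto
  have sym_star: "(v, u) \<in> ?G\<^sup>*" if "(u, v) \<in> ?G\<^sup>*" for u v
    using that by (induction rule: rtrancl_induct) (auto dest: sym intro: converse_rtrancl_into_rtrancl)
  have conv: "(outer_pos x, outer_pos y) \<in> ?G\<^sup>+" if "{x, y} \<in> N" for x y
    using that unfolding N_def
  proof (elim UnE imageE)
    fix e assume e: "{x, y} = map_bot h ` e" "e \<in> g"
    obtain a b where ab: "e = {a, b}" "a \<in> points p t" "b \<in> points p t"
      using matching_edge[OF gm e(2)] by metis
    then have "\<exists>a b. {a, b} \<in> g \<and> a \<in> points p t \<and> b \<in> points p t \<and> x = map_bot h a \<and> y = map_bot h b"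
    proof -
      have "{a, b} \<in> g" "{b, a} \<in> g" using e(2) ab(1) by (simp_all add: insert_commute)
      moreover have "x = map_bot h a \<and> y = map_bot h b \<or> x = map_bot h b \<and> y = map_bot h a"
        using e(1) ab(1) by (simp add: doubleton_eq_iff)
      ultimately show ?thesis using ab(2,3) by blast
    qed
    then obtain a b where ab: "{a, b} \<in> g" "a \<in> points p t" "b \<in> points p t" "x = map_bot h a" "y = map_bot h b"
      by blast
    then have "(upper_pos a, upper_pos b) \<in> ?G" unfolding glued_def by blast
    then show ?thesis
      using upper[OF ab(2)] sym_star[OF upper[OF ab(3)]] ab(4,5)
      by (meson rtrancl_into_trancl1 trancl_rtrancl_trancl rtrancl_trancl_trancl r_into_trancl)
  next
    fix e assume e: "{x, y} = Bot ` e" "e \<in> C"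
    then have "x \<in> range Bot" "y \<in> range Bot" by auto
    then have "outer_pos x = lower_pos x" "outer_pos y = lower_pos y" by auto
    moreover have "{x, y} \<in> up_diagram t h C" using e by (auto simp: up_diagram_def)
    then have "(lower_pos x, lower_pos y) \<in> ?G" unfolding glued_def by blast
    ultimately show ?thesis by auto
  qed
  have "up_diagram t h C \<bullet> g = N"
    unfolding concat_diagram_def
  proof (intro equalityI subsetI)
    fix e assume "e \<in> {{x, y} |x y. x \<noteq> y \<and> (outer_pos x, outer_pos y) \<in> ?G\<^sup>+}"
    then obtain x y where "e = {x, y}" "x \<noteq> y" "(outer_pos x, outer_pos y) \<in> ?G\<^sup>+" by blast
    then show "e \<in> N" using path[of "outer_pos x" "outer_pos y"] by (auto simp: \<rho>_outer)
  next
    fix e assume e: "e \<in> N"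
    then obtain x y where "x \<noteq> y" "e = {x, y}" using matching_edge[OF N] by metis
    then show "e \<in> {{x, y} |x y. x \<noteq> y \<and> (outer_pos x, outer_pos y) \<in> ?G\<^sup>+}"
      using conv e by blast
  qed
  then show ?thesis by (simp add: N_def)
qed

lemma perm_up_data: "\<sigma> \<in> carrier (sym_group r) \<Longrightarrow> up_data r r \<sigma> {}"
  using permutes_image[of \<sigma> "{1..r}"] permutes_inj_on[of \<sigma> "{1..r}"]
  by (auto simp: up_data_def sym_group_carrier matching_empty)

lemma up_diagram_empty: "up_diagram r \<sigma> {} = perm_diagram r \<sigma>"
  by (simp add: up_diagram_def)

lemma up_data_comp:
  assumes "up_data r q h C" "\<sigma> \<in> carrier (sym_group r)"
  shows "up_data r q (h \<circ> \<sigma>) C"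
proof -
  have \<sigma>: "\<sigma> permutes {1..r}" using assms(2) by (simp add: sym_group_carrier)
  have "(h \<circ> \<sigma>) ` {1..r} = h ` {1..r}"
    using permutes_image[OF \<sigma>] by (metis image_comp)
  moreover have "inj_on (h \<circ> \<sigma>) {1..r}"
    using assms(1) permutes_image[OF \<sigma>] permutes_inj_on[OF \<sigma>] by (intro comp_inj_on) (auto simp: up_data_def)
  ultimately show ?thesis
    using assms(1) unfolding up_data_def by simp
qed

lemma up_diagram_concat_perm:
  assumes "up_data r q h C" "\<sigma> \<in> carrier (sym_group r)"
  shows "up_diagram r h C \<bullet> perm_diagram r \<sigma> = up_diagram r (h \<circ> \<sigma>) C"
proof -
  have "perm_diagram r \<sigma> \<in> brauer r r"
    using up_diagram_brauer[OF perm_up_data[OF assms(2)]] by (simp add: up_diagram_empty brauer_up_def)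
  from concat_up_diagram[OF assms(1) this] show ?thesis
    by (simp add: up_diagram_def perm_diagram_def image_image)
qed

lemma perm_diagram_concat:
  "\<sigma> \<in> carrier (sym_group r) \<Longrightarrow> \<tau> \<in> carrier (sym_group r) \<Longrightarrow>
    perm_diagram r \<sigma> \<bullet> perm_diagram r \<tau> = perm_diagram r (\<sigma> \<circ> \<tau>)"
  using up_diagram_concat_perm[OF perm_up_data, of \<sigma> r \<tau>] by (simp add: up_diagram_empty)

lemma up_diagram_concat_flip:
  assumes "up_data r q h C" "up_data r p l D"
  shows "up_diagram r h C \<bullet> flip (up_diagram r l D) =
    (\<lambda>i. {Top (l i), Bot (h i)}) ` {1..r} \<union> (`) Top ` D \<union> (`) Bot ` C"
proof -
  have "flip (up_diagram r l D) \<in> brauer p r"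
    using up_diagram_brauer[OF assms(2)] by (auto simp: brauer_up_def intro: flip_brauer)
  from concat_up_diagram[OF assms(1) this] show ?thesis
    by (simp add: flip_up_diagram image_Un image_image)
qed

lemma brauer_level_eq: "brauer_level t t = perm_diagram t ` carrier (sym_group t)"
proof (intro equalityI subsetI)
  fix f assume f: "f \<in> brauer_level t t"
  then have "f \<in> brauer_up t t" by (simp add: brauer_level_def brauer_up_def)
  then obtain h C where h: "up_data t t h C" "f = up_diagram t h C"
    by (rule up_diagram_exists)
  have "C = {}"
  proof (rule ccontr)
    assume "C \<noteq> {}"
    then obtain e where e: "e \<in> C" by blast
    have "matching ({1..t} - h ` {1..t}) C" using h by (simp add: up_data_def)
    then obtain x y where "e = {x, y}" using e matching_edge by metis
    then have "Bot ` {x, y} \<in> f" unfolding h(2) up_diagram_def using e by blast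
    then have "{Bot x, Bot y} \<in> f" by simp
    then show False using f by (auto simp: brauer_level_def downward_def)
  qed
  then have "{1..t} - h ` {1..t} = {}"
    using h(1) matching_union by (fastforce simp: up_data_def)
  then have "bij_betw h {1..t} {1..t}"
    using h(1) by (auto simp: bij_betw_def up_data_def)
  \<comment> \<open>Elements of \<open>sym_group t\<close> are functions on all natural numbers that
    fix everything outside \<open>{1..t}\<close>, whereas \<open>h\<close> is only known on
    \<open>{1..t}\<close>.\<close>
  define \<sigma> where "\<sigma> i = (if i \<in> {1..t} then h i else i)" for i
  have "bij_betw \<sigma> {1..t} {1..t}"
    using \<open>bij_betw h {1..t} {1..t}\<close> by (rule bij_betw_cong[THEN iffD1, rotated]) (simp add: \<sigma>_def)
  then have "\<sigma> permutes {1..t}"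
    by (rule bij_imp_permutes) (auto simp: \<sigma>_def)
  moreover have "f = perm_diagram t \<sigma>"
    using h(2) \<open>C = {}\<close> perm_diagram_cong[of t h \<sigma>] by (simp add: up_diagram_empty \<sigma>_def)
  ultimately show "f \<in> perm_diagram t ` carrier (sym_group t)"
    by (auto simp: sym_group_carrier)
next
  fix f assume "f \<in> perm_diagram t ` carrier (sym_group t)"
  then obtain \<sigma> where "\<sigma> \<in> carrier (sym_group t)" "f = perm_diagram t \<sigma>" by blast
  then show "f \<in> brauer_level t t"
    using up_diagram_brauer[OF perm_up_data]
    by (auto simp: brauer_level_def brauer_up_def up_diagram_empty downward_def perm_diagram_def doubleton_eq_iff)
qed

subsection \<open>The factorisation\<close>

lemma strict_mono_unique:
  fixes h h' :: "nat \<Rightarrow> nat"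
  assumes "strict_mono_on {1..t} h" "strict_mono_on {1..t} h'" "h ` {1..t} = h' ` {1..t}" "i \<in> {1..t}"
  shows "h i = h' i"
  using assms(4)
proof (induction i rule: less_induct)
  case (less i)
  \<comment> \<open>Stated for an arbitrary ordered pair of enumerations, so that it yields both
    inequalities of the final antisymmetry argument.\<close>
  have le: "h i \<le> h' i"
    if h: "strict_mono_on {1..t} h" "strict_mono_on {1..t} h'" "h ` {1..t} = h' ` {1..t}"
      and IH: "\<And>k. k < i \<Longrightarrow> k \<in> {1..t} \<Longrightarrow> h k = h' k" for h h' :: "nat \<Rightarrow> nat"
  proof -
    obtain k where k: "k \<in> {1..t}" "h' i = h k" using h(3) less.prems by blast
    show ?thesis
    proof (cases "k < i")
      case True
      then have "h' i = h' k" using IH k by simp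
      then show ?thesis using strict_mono_onD[OF h(2) k(1) less.prems True] by simp
    next
      case False
      then show ?thesis
        using k strict_mono_onD[OF h(1) less.prems k(1)] by (cases "k = i") auto
    qed
  qed
  show ?case
  proof (rule antisym)
    show "h i \<le> h' i" using le[of h h'] assms less.IH by simp
    show "h' i \<le> h i" using le[of h' h] assms less.IH by simp
  qed
qed

lemma strict_mono_enumeration:
  assumes "finite (M :: nat set)"
  obtains h where "bij_betw h {1..card M} M" "strict_mono_on {1..card M} h"
proof -
  obtain h where h: "bij_betw h {..<card M} M" "strict_mono_on {..<card M} h"
    using ex_bij_betw_strict_mono_card[OF assms] by blast
  have "bij_betw (\<lambda>i. i - 1) {1..card M} {..<card M}"
    by (rule bij_betw_byWitness[of _ Suc]) auto
  then have "bij_betw (h \<circ> (\<lambda>i. i - 1)) {1..card M} M"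
    using h(1) by (rule bij_betw_trans)
  moreover have "strict_mono_on {1..card M} (h \<circ> (\<lambda>i. i - 1))"
  proof (rule strict_mono_onI)
    fix i k assume "i \<in> {1..card M}" "k \<in> {1..card M}" "i < k"
    then show "(h \<circ> (\<lambda>i. i - 1)) i < (h \<circ> (\<lambda>i. i - 1)) k"
      using strict_mono_onD[OF h(2), of "i - 1" "k - 1"] by auto
  qed
  ultimately show ?thesis by (rule that)
qed

text \<open>An injection factors uniquely as an increasing map after a permutation: the increasing
  map is determined by the range, and the permutation records the relative order of the values. This
  is the source of the factor \<open>fact r\<close> between \<open>brauer_up\<close> and
  \<open>brauer_up_mono\<close>.\<close>

lemma up_perm_bij:
  "bij_betw (\<lambda>(a, \<sigma>). a \<bullet> perm_diagram r \<sigma>) (brauer_up_mono r q \<times> carrier (sym_group r)) (brauer_up r q)"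
proof (rule bij_betwI')
  fix x y assume "x \<in> brauer_up_mono r q \<times> carrier (sym_group r)" "y \<in> brauer_up_mono r q \<times> carrier (sym_group r)"
  then obtain h C \<sigma> h' C' \<tau> where
    x: "x = (up_diagram r h C, \<sigma>)" "up_data r q h C" "strict_mono_on {1..r} h" "\<sigma> \<in> carrier (sym_group r)" and
    y: "y = (up_diagram r h' C', \<tau>)" "up_data r q h' C'" "strict_mono_on {1..r} h'" "\<tau> \<in> carrier (sym_group r)"
    by (auto simp: up_mono_iff)
  show "((case x of (a, \<sigma>) \<Rightarrow> a \<bullet> perm_diagram r \<sigma>) = (case y of (a, \<sigma>) \<Rightarrow> a \<bullet> perm_diagram r \<sigma>)) = (x = y)"
  proof
    assume "(case x of (a, \<sigma>) \<Rightarrow> a \<bullet> perm_diagram r \<sigma>) = (case y of (a, \<sigma>) \<Rightarrow> a \<bullet> perm_diagram r \<sigma>)"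
    then have eq: "up_diagram r (h \<circ> \<sigma>) C = up_diagram r (h' \<circ> \<tau>) C'"
      using x y by (simp add: up_diagram_concat_perm)
    note C = up_diagram_eqD(1)[OF eq]
    have hs: "h (\<sigma> i) = h' (\<tau> i)" if "i \<in> {1..r}" for i
      using up_diagram_eqD(2)[OF eq that] by simp
    have perms: "\<sigma> permutes {1..r}" "\<tau> permutes {1..r}" using x y by (auto simp: sym_group_carrier)
    have "h ` {1..r} = (\<lambda>i. h (\<sigma> i)) ` {1..r}"
      using permutes_image[OF perms(1)] by (metis image_image)
    also have "\<dots> = (\<lambda>i. h' (\<tau> i)) ` {1..r}"
      using hs by (rule image_cong[OF refl])
    also have "\<dots> = h' ` {1..r}"
      using permutes_image[OF perms(2)] by (metis image_image)
    finally have hh: "h i = h' i" if "i \<in> {1..r}" for i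
      using strict_mono_unique[OF x(3) y(3)] that by blast
    have "\<sigma> i = \<tau> i" for i
    proof (cases "i \<in> {1..r}")
      case True
      then have "\<sigma> i \<in> {1..r}" "\<tau> i \<in> {1..r}" using perms permutes_in_image by metis+
      then show ?thesis
        using hs[OF True] hh x(2) by (metis inj_onD up_data_def)
    next
      case False
      then show ?thesis using perms by (simp add: permutes_not_in del: atLeastAtMost_iff)
    qed
    then have "\<sigma> = \<tau>" ..
    then show "x = y" using x(1) y(1) C up_diagram_cong[of r h h' C'] hh by simp
  qed simp
next
  fix x assume "x \<in> brauer_up_mono r q \<times> carrier (sym_group r)"
  then show "(case x of (a, \<sigma>) \<Rightarrow> a \<bullet> perm_diagram r \<sigma>) \<in> brauer_up r q"
    by (auto simp: up_mono_iff up_diagram_concat_perm up_data_comp up_diagram_brauer)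
next
  fix f assume "f \<in> brauer_up r q"
  then obtain h C where h: "up_data r q h C" "f = up_diagram r h C"
    by (rule up_diagram_exists)
  have "card (h ` {1..r}) = r" using h(1) by (simp add: up_data_def card_image)
  then obtain m where m: "bij_betw m {1..r} (h ` {1..r})" "strict_mono_on {1..r} m"
    using strict_mono_enumeration[of "h ` {1..r}"] by auto
  \<comment> \<open>\<open>m\<close> lists the range of \<open>h\<close> in increasing order, and
    \<sigma> gives the rank of \<open>h i\<close> in this list.\<close>
  define \<sigma> where "\<sigma> i = (if i \<in> {1..r} then inv_into {1..r} m (h i) else i)" for i
  have "bij_betw h {1..r} (h ` {1..r})" using h(1) by (auto simp: up_data_def bij_betw_def)
  from bij_betw_trans[OF this bij_betw_inv_into[OF m(1)]]
  have "bij_betw (inv_into {1..r} m \<circ> h) {1..r} {1..r}" .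
  then have "bij_betw \<sigma> {1..r} {1..r}"
    by (rule bij_betw_cong[THEN iffD1, rotated]) (simp add: \<sigma>_def)
  then have \<sigma>: "\<sigma> \<in> carrier (sym_group r)"
    unfolding sym_group_carrier by (rule bij_imp_permutes) (auto simp: \<sigma>_def)
  have m\<sigma>: "(m \<circ> \<sigma>) i = h i" if "i \<in> {1..r}" for i
    using that m(1) bij_betw_inv_into_right[OF m(1), of "h i"] by (simp add: \<sigma>_def)
  have "up_data r q m C"
    using h(1) m(1) by (auto simp: up_data_def bij_betw_def)
  moreover have "f = up_diagram r (m \<circ> \<sigma>) C"
    using h(2) up_diagram_cong[of r "m \<circ> \<sigma>" h C] m\<sigma> by simp
  ultimately have "f = up_diagram r m C \<bullet> perm_diagram r \<sigma>" "up_diagram r m C \<in> brauer_up_mono r q"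
    using \<sigma> m(2) by (auto simp: up_diagram_concat_perm up_mono_iff)
  then show "\<exists>x\<in>brauer_up_mono r q \<times> carrier (sym_group r). f = (case x of (a, \<sigma>) \<Rightarrow> a \<bullet> perm_diagram r \<sigma>)"
    using \<sigma> by (intro bexI[of _ "(up_diagram r m C, \<sigma>)"]) auto
qed

text \<open>The composite only shows which top endpoint is joined to which bottom endpoint, not how
  the strands are numbered. Since \<open>b\<close> is monotone, the numbering is forced: it must
  follow the top endpoints from left to right. Then \<open>u\<close> can be read off.\<close>

lemma concat_flip_unique:
  assumes u: "u \<in> brauer_up r q" "u' \<in> brauer_up r' q" and b: "b \<in> brauer_up_mono r p" "b' \<in> brauer_up_mono r' p"
    and eq: "u \<bullet> flip b = u' \<bullet> flip b'"
  shows "r = r'" "u = u'" "b = b'"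
proof -
  obtain h C where h: "up_data r q h C" "u = up_diagram r h C" using u(1) by (rule up_diagram_exists)
  obtain h' C' where h': "up_data r' q h' C'" "u' = up_diagram r' h' C'" using u(2) by (rule up_diagram_exists)
  obtain l D where l: "up_data r p l D" "b = up_diagram r l D" "strict_mono_on {1..r} l"
    using b(1) by (auto simp: up_mono_iff)
  obtain l' D' where l': "up_data r' p l' D'" "b' = up_diagram r' l' D'" "strict_mono_on {1..r'} l'"
    using b(2) by (auto simp: up_mono_iff)
  \<comment> \<open>Normal form of either composite, with all data as arguments, so that the
    membership criteria below serve both sides of the equation.\<close>
  define F where "F = (\<lambda>(r :: nat) h C l D. (\<lambda>i. {Top (l i), Bot (h i)}) ` {1..r} \<union> (`) Top ` D \<union> (`) Bot ` C :: diagram)"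
  have eq': "F r h C l D = F r' h' C' l' D'"
    using eq unfolding h(2) h'(2) l(2) l'(2) F_def
      up_diagram_concat_flip[OF h(1) l(1)] up_diagram_concat_flip[OF h'(1) l'(1)] .
  have inj: "Bot ` e = Bot ` e' \<longleftrightarrow> e = e'" "Top ` e = Top ` e' \<longleftrightarrow> e = e'" for e e' :: "nat set"
    by (simp_all add: inj_image_eq_iff)
  \<comment> \<open>The empty set must be excluded, since its images under \<open>Bot\<close> and
    \<open>Top\<close> coincide; that it is neither a cup nor a cap is checked separately.\<close>
  have Bots: "Bot ` e \<in> F r h C l D \<longleftrightarrow> e \<in> C" if "up_data r q h C" "up_data r p l D" "e \<noteq> {}" for r h C l D e
    using that(3) by (auto simp: F_def inj image_iff)
  have Tops: "Top ` e \<in> F r h C l D \<longleftrightarrow> e \<in> D" if "up_data r q h C" "up_data r p l D" "e \<noteq> {}" for r h C l D e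
    using that(3) by (auto simp: F_def inj image_iff)
  have strands: "{Top i, Bot j} \<in> F r h C l D \<longleftrightarrow> (\<exists>a\<in>{1..r}. i = l a \<and> j = h a)" for r h C l D i j
    by (auto simp: F_def doubleton_eq_iff)
  have "e \<in> C \<longleftrightarrow> e \<in> C'" "e \<in> D \<longleftrightarrow> e \<in> D'" if "e \<noteq> {}" for e
    using Bots[OF h(1) l(1) that] Bots[OF h'(1) l'(1) that] Tops[OF h(1) l(1) that] Tops[OF h'(1) l'(1) that] eq'
    by simp_all
  moreover have "{} \<notin> C" "{} \<notin> D" "{} \<notin> C'" "{} \<notin> D'"
    using h(1) h'(1) l(1) l'(1) by (auto simp: up_data_def matching_def)
  ultimately have "e \<in> C \<longleftrightarrow> e \<in> C'" "e \<in> D \<longleftrightarrow> e \<in> D'" for e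
    by (cases "e = {}"; simp)+
  then have CD: "C = C'" "D = D'" by (simp_all add: set_eq_iff)
  have lr: "l ` {1..r} = l' ` {1..r'}"
  proof -
    have *: "i \<in> l ` {1..r} \<longleftrightarrow> (\<exists>j. {Top i, Bot j} \<in> F r h C l D)" for i r h C l D
      unfolding strands by auto
    show ?thesis
      using *[where l = l and r = r and h = h and C = C and D = D]
        *[where l = l' and r = r' and h = h' and C = C' and D = D'] unfolding eq' by blast
  qed
  then have "card (l ` {1..r}) = card (l' ` {1..r'})" by simp
  then show rr: "r = r'" using l(1) l'(1) by (simp add: up_data_def card_image)
  have ll: "l i = l' i" if "i \<in> {1..r}" for i
    using strict_mono_unique[OF l(3) _ _ that, of l'] l'(3) lr rr by simp
  then show "b = b'" using l(2) l'(2) CD rr up_diagram_cong[of r l l' D] by simp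
  have "h i = h' i" if i: "i \<in> {1..r}" for i
  proof -
    have "{Top (l i), Bot (h i)} \<in> F r' h' C' l' D'"
      using eq' strands[of "l i" "h i" r h C l D] i by auto
    then obtain a where "a \<in> {1..r}" "l i = l' a" "h i = h' a"
      unfolding strands using rr by auto
    moreover from this have "a = i"
      using ll[OF i] i l'(1) rr by (metis inj_onD up_data_def)
    ultimately show ?thesis by simp
  qed
  then show "u = u'" using h(2) h'(2) CD rr up_diagram_cong[of r h h' C] by simp
qed

text \<open>The through strands are numbered by their top endpoints in increasing order. This makes
  the flipped factor monotone, and the order of the bottom endpoints is left to the upward factor
  \<open>u\<close>.\<close>

lemma concat_flip_exists:
  assumes f: "f \<in> brauer p q"
  shows "\<exists>r u b. u \<in> brauer_up r q \<and> b \<in> brauer_up_mono r p \<and> f = u \<bullet> flip b"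
proof -
  have fm: "matching (points p q) f" using f by (simp add: brauer_iff_matching)
  define P where "P = {i. \<exists>j. {Top i, Bot j} \<in> f}"
  define r where "r = card P"
  have in_points: "Top i \<in> points p q" "Bot j \<in> points p q" if "{Top i, Bot j} \<in> f" for i j
    using matching_mem[OF fm that] by auto
  have P: "P \<subseteq> {1..p}"
  proof
    fix i assume "i \<in> P"
    then obtain j where "{Top i, Bot j} \<in> f" by (auto simp: P_def)
    from in_points(1)[OF this] show "i \<in> {1..p}" by (auto simp: points_def)
  qed
  then have "finite P" by (rule finite_subset) simp
  then obtain l where l: "bij_betw l {1..r} P" "strict_mono_on {1..r} l"
    unfolding r_def by (rule strict_mono_enumeration)
  then have "\<forall>i\<in>{1..r}. \<exists>j. {Top (l i), Bot j} \<in> f"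
    by (auto simp: P_def bij_betw_def)
  then obtain h where h: "\<And>i. i \<in> {1..r} \<Longrightarrow> {Top (l i), Bot (h i)} \<in> f"
    by metis
  define C where "C = {e. Bot ` e \<in> f}"
  define D where "D = {e. Top ` e \<in> f}"
  have lP: "l ` {1..r} = P" "inj_on l {1..r}" using l(1) by (auto simp: bij_betw_def)
  have strand: "\<exists>a\<in>{1..r}. i = l a \<and> j = h a" if "{Top i, Bot j} \<in> f" for i j
  proof -
    have "i \<in> P" using that by (auto simp: P_def)
    then obtain a where "a \<in> {1..r}" "i = l a" using lP by auto
    moreover from this have "j = h a" using matching_partner[OF fm that, of "Bot (h a)"] h by simp
    ultimately show ?thesis by blast
  qed
  have inj_h: "inj_on h {1..r}"
  proof (rule inj_onI)
    fix a c assume ac: "a \<in> {1..r}" "c \<in> {1..r}" "h a = h c"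
    have "{Bot (h a), Top (l a)} \<in> f" "{Bot (h a), Top (l c)} \<in> f"
      using h[OF ac(1)] h[OF ac(2)] ac(3) by (subst insert_commute, simp)+
    then have "Top (l a) = Top (l c)" by (rule matching_partner[OF fm])
    then have "l a = l c" by simp
    then show "a = c" using inj_onD[OF lP(2)] ac by blast
  qed
  have f_eq: "f = (\<lambda>i. {Top (l i), Bot (h i)}) ` {1..r} \<union> (`) Top ` D \<union> (`) Bot ` C"
  proof (intro equalityI subsetI)
    fix e assume e: "e \<in> f"
    then obtain x y where xy: "e = {x, y}" using matching_edge[OF fm] by metis
    consider i j where "e = {Top i, Bot j}" | i j where "e = Top ` {i, j}" | i j where "e = Bot ` {i, j}"
      using xy by (cases x; cases y) (auto simp: insert_commute)
    then show "e \<in> (\<lambda>i. {Top (l i), Bot (h i)}) ` {1..r} \<union> (`) Top ` D \<union> (`) Bot ` C"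
    proof cases
      case (1 i j)
      then show ?thesis using strand e by fastforce
    next
      case (2 i j)
      then have "{i, j} \<in> D" using e by (simp add: D_def)
      then show ?thesis using 2 by blast
    next
      case (3 i j)
      then have "{i, j} \<in> C" using e by (simp add: C_def)
      then show ?thesis using 3 by blast
    qed
  next
    fix e assume "e \<in> (\<lambda>i. {Top (l i), Bot (h i)}) ` {1..r} \<union> (`) Top ` D \<union> (`) Bot ` C"
    then show "e \<in> f" using h by (auto simp: C_def D_def)
  qed
  \<comment> \<open>One argument for both rows: removing the endpoints of strands from a row leaves
    a set that is matched by the edges contained in this row. It is applied with \<open>Bot\<close>
    for the cups and with \<open>Top\<close> for the caps.\<close>
  have part: "matching (S - k ` {1..r}) M"
    if c: "inj c" "c ` S = points p q \<inter> range c" and M: "M = {e. c ` e \<in> f}"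
      and through: "\<And>i. i \<in> {1..r} \<Longrightarrow> \<exists>e\<in>f. c (k i) \<in> e \<and> \<not> e \<subseteq> range c"
      and other: "\<And>i. c i \<in> points p q \<Longrightarrow> i \<notin> k ` {1..r} \<Longrightarrow> \<exists>e. i \<in> e \<and> c ` e \<in> f"
    for c :: "nat \<Rightarrow> point" and S k M
  proof -
    have "matching (\<Union>((`) c ` M)) ((`) c ` M)"
      using M by (intro matching_subset[OF fm]) auto
    moreover have "\<Union>((`) c ` M) = c ` (S - k ` {1..r})"
    proof (intro equalityI subsetI)
      fix x assume "x \<in> \<Union>((`) c ` M)"
      then obtain e i where e: "c ` e \<in> f" "i \<in> e" "x = c i" by (auto simp: M)
      then have "c i \<in> points p q" using matching_mem[OF fm e(1)] by blast
      then have "c i \<in> c ` S" using c(2) by blast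
      then have "i \<in> S" using c(1) by (simp add: inj_image_mem_iff)
      moreover have "i \<notin> k ` {1..r}"
      proof
        assume "i \<in> k ` {1..r}"
        then obtain a where "a \<in> {1..r}" "i = k a" by (elim imageE)
        with through[OF this(1)] obtain e' where "e' \<in> f" "c i \<in> e'" "\<not> e' \<subseteq> range c" by auto
        moreover have "c ` e = e'"
          by (rule matching_unique[OF fm e(1) \<open>e' \<in> f\<close> imageI[OF e(2)] \<open>c i \<in> e'\<close>])
        ultimately show False using image_mono[of e UNIV c] by simp
      qed
      ultimately show "x \<in> c ` (S - k ` {1..r})" using e by auto
    next
      fix x assume "x \<in> c ` (S - k ` {1..r})"
      then obtain i where i: "i \<in> S" "i \<notin> k ` {1..r}" "x = c i" by auto
      moreover have "c i \<in> points p q" using c i by auto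
      ultimately obtain e where "i \<in> e" "c ` e \<in> f" using other by blast
      then show "x \<in> \<Union>((`) c ` M)" using i by (auto simp: M)
    qed
    ultimately have "matching (c ` (S - k ` {1..r})) ((`) c ` M)" by simp
    from matching_image[OF this, of "inv_into UNIV c"] show ?thesis
      using c by (simp add: image_image inj_on_def inv_into_f_f)
  qed
  have "matching ({1..q} - h ` {1..r}) C"
  proof (rule part[where c = Bot])
    show "\<exists>e. i \<in> e \<and> Bot ` e \<in> f" if i: "Bot i \<in> points p q" "i \<notin> h ` {1..r}" for i
    proof -
      have "Bot i \<in> \<Union>f" unfolding matching_union[OF fm] by (rule i(1))
      then obtain e where "e \<in> f" "Bot i \<in> e" by blast
      then show ?thesis using i(2) by (subst (asm) f_eq) (auto simp: C_def)
    qed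
    show "\<exists>e\<in>f. Bot (h i) \<in> e \<and> \<not> e \<subseteq> range Bot" if "i \<in> {1..r}" for i
      by (rule bexI[OF _ h[OF that]]) auto
  qed (auto simp: points_def C_def)
  moreover have "matching ({1..p} - l ` {1..r}) D"
  proof (rule part[where c = Top])
    show "\<exists>e. i \<in> e \<and> Top ` e \<in> f" if i: "Top i \<in> points p q" "i \<notin> l ` {1..r}" for i
    proof -
      have "Top i \<in> \<Union>f" unfolding matching_union[OF fm] by (rule i(1))
      then obtain e where "e \<in> f" "Top i \<in> e" by blast
      then show ?thesis using i(2) by (subst (asm) f_eq) (auto simp: D_def)
    qed
    show "\<exists>e\<in>f. Top (l i) \<in> e \<and> \<not> e \<subseteq> range Top" if "i \<in> {1..r}" for i
      by (rule bexI[OF _ h[OF that]]) auto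
  qed (auto simp: points_def D_def)
  moreover have "h ` {1..r} \<subseteq> {1..q}"
  proof (rule image_subsetI)
    fix i assume "i \<in> {1..r}"
    from in_points(2)[OF h[OF this]] show "h i \<in> {1..q}" by (auto simp: points_def)
  qed
  ultimately have data: "up_data r q h C" "up_data r p l D"
    using inj_h lP P by (auto simp: up_data_def)
  then have "f = up_diagram r h C \<bullet> flip (up_diagram r l D)"
    using f_eq by (simp add: up_diagram_concat_flip)
  then show ?thesis
    using data l(2) up_diagram_brauer up_mono_iff by blast
qed

text \<open>The downward factor enters through its flip, so that rows and columns are indexed by
  diagrams of the same kind, as the matrices require.\<close>

definition strand_diagram :: "nat \<Rightarrow> diagram \<Rightarrow> (nat \<Rightarrow> nat) \<Rightarrow> diagram \<Rightarrow> diagram" where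
  "strand_diagram r a \<sigma> b = a \<bullet> perm_diagram r \<sigma> \<bullet> flip b"

lemma up_mono_parity: "a \<in> brauer_up_mono r q \<Longrightarrow> r \<preceq> q"
  using up_data_parity by (auto simp: up_mono_iff)

lemma up_concat_perm_in:
  "a \<in> brauer_up_mono r q \<Longrightarrow> \<sigma> \<in> carrier (sym_group r) \<Longrightarrow> a \<bullet> perm_diagram r \<sigma> \<in> brauer_up r q"
  by (auto simp: up_mono_iff up_diagram_concat_perm intro!: up_diagram_brauer up_data_comp)

lemma strand_diagram_in:
  assumes "a \<in> brauer_up_mono r q" "\<sigma> \<in> carrier (sym_group r)" "b \<in> brauer_up_mono r p"
  shows "strand_diagram r a \<sigma> b \<in> brauer p q"
proof -
  obtain h C where h: "up_data r q h C" "a = up_diagram r h C" using assms(1) by (auto simp: up_mono_iff)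
  have "flip b \<in> brauer p r" using assms(3) by (auto simp: brauer_up_mono_def intro: flip_brauer)
  then have "matching (points p q) (up_diagram r (h \<circ> \<sigma>) C \<bullet> flip b)"
    using matching_concat concat_up_diagram up_data_comp[OF h(1) assms(2)] by metis
  then show ?thesis
    using h assms by (simp add: strand_diagram_def brauer_iff_matching up_diagram_concat_perm)
qed

lemma strand_diagram_unique:
  assumes "a \<in> brauer_up_mono r q" "\<sigma> \<in> carrier (sym_group r)" "b \<in> brauer_up_mono r p"
    and "a' \<in> brauer_up_mono r' q" "\<sigma>' \<in> carrier (sym_group r')" "b' \<in> brauer_up_mono r' p"
    and eq: "strand_diagram r a \<sigma> b = strand_diagram r' a' \<sigma>' b'"
  shows "r = r' \<and> a = a' \<and> \<sigma> = \<sigma>' \<and> b = b'"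
proof -
  note * = concat_flip_unique[OF up_concat_perm_in[OF assms(1,2)] up_concat_perm_in[OF assms(4,5)] assms(3,6)
      eq[unfolded strand_diagram_def]]
  have "(a, \<sigma>) = (a', \<sigma>')"
  proof (rule inj_onD[OF bij_betw_imp_inj_on[OF up_perm_bij[of r q]]])
    show "(case (a, \<sigma>) of (a, \<sigma>) \<Rightarrow> a \<bullet> perm_diagram r \<sigma>) = (case (a', \<sigma>') of (a, \<sigma>) \<Rightarrow> a \<bullet> perm_diagram r \<sigma>)"
      using *(1,2) by simp
  qed (use assms *(1) in auto)
  then show ?thesis using * by simp
qed

lemma strand_diagram_exists:
  assumes "f \<in> brauer p q"
  obtains r a \<sigma> b where "a \<in> brauer_up_mono r q" "\<sigma> \<in> carrier (sym_group r)" "b \<in> brauer_up_mono r p"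
    "f = strand_diagram r a \<sigma> b"
proof -
  obtain r u b where ub: "u \<in> brauer_up r q" "b \<in> brauer_up_mono r p" "f = u \<bullet> flip b"
    using concat_flip_exists[OF assms] by blast
  have "u \<in> (\<lambda>(a, \<sigma>). a \<bullet> perm_diagram r \<sigma>) ` (brauer_up_mono r q \<times> carrier (sym_group r))"
    using bij_betw_imp_surj_on[OF up_perm_bij[of r q]] ub(1) by simp
  then obtain x where "x \<in> brauer_up_mono r q \<times> carrier (sym_group r)" "u = (case x of (a, \<sigma>) \<Rightarrow> a \<bullet> perm_diagram r \<sigma>)"
    by (elim imageE)
  then show ?thesis
    using that ub by (cases x) (auto simp: strand_diagram_def)
qed

text \<open>Existence and uniqueness of the factorisation turn the definite description in
  \<open>factors\<close> into a computation rule.\<close>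

lemma factors_strand_diagram:
  assumes "a \<in> brauer_up_mono r q" "\<sigma> \<in> carrier (sym_group r)" "b \<in> brauer_up_mono r p"
  shows "factors p q (strand_diagram r a \<sigma> b) = (r, a, perm_diagram r \<sigma>, flip b)"
  unfolding factors_def
proof (rule the_equality)
  show "case (r, a, perm_diagram r \<sigma>, flip b) of (t, fp, f0, fm) \<Rightarrow> factorisation p q (strand_diagram r a \<sigma> b) t fp f0 fm"
    using assms by (simp add: factorisation_def brauer_level_eq flip_up_mono strand_diagram_def)
next
  fix y assume y: "case y of (t, fp, f0, fm) \<Rightarrow> factorisation p q (strand_diagram r a \<sigma> b) t fp f0 fm"
  obtain t fp f0 fm where y_eq: "y = (t, fp, f0, fm)" by (cases y)
  then obtain \<tau> where t: "fp \<in> brauer_up_mono t q" "\<tau> \<in> carrier (sym_group t)" "f0 = perm_diagram t \<tau>"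
    "flip fm \<in> brauer_up_mono t p" "strand_diagram r a \<sigma> b = strand_diagram t fp \<tau> (flip fm)"
    using y flip_up_mono[of "flip fm" p t]
    by (auto simp: factorisation_def brauer_level_eq strand_diagram_def)
  show "y = (r, a, perm_diagram r \<sigma>, flip b)"
    using strand_diagram_unique[OF assms t(1,2,4,5)] t(3) y_eq by auto
qed

text \<open>The multiplication rule of matrix units with coefficients in the symmetric groups: the
  inner indices have to agree, and then the permutations multiply.\<close>

lemma mB_basis_comp_strand_diagram:
  assumes "a \<in> brauer_up_mono t r" "\<sigma> \<in> carrier (sym_group t)" "b \<in> brauer_up_mono t q"
    and "c \<in> brauer_up_mono s q" "\<tau> \<in> carrier (sym_group s)" "d \<in> brauer_up_mono s p"
  shows "mB_basis_comp p q r (strand_diagram t a \<sigma> b) (strand_diagram s c \<tau> d) =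
     (if t = s \<and> b = c then Some (strand_diagram t a (\<sigma> \<circ> \<tau>) d) else None)"
  unfolding mB_basis_comp_def factors_strand_diagram[OF assms(1-3)] factors_strand_diagram[OF assms(4-6)]
  using assms by (auto simp: perm_diagram_concat strand_diagram_def)

lemma up_concat_id:
  assumes "a \<in> brauer_up_mono r q"
  shows "a \<bullet> perm_diagram r id = a"
  using assms up_diagram_concat_perm[of r q _ _ id]
  by (auto simp: up_mono_iff sym_group_carrier)


section \<open>Modules and algebras of functions\<close>

lemma (in abelian_monoid) finsum_swap:
  assumes "finite A" "finite B" "\<And>a b. a \<in> A \<Longrightarrow> b \<in> B \<Longrightarrow> f a b \<in> carrier G"
  shows "(\<Oplus>a\<in>A. \<Oplus>b\<in>B. f a b) = (\<Oplus>b\<in>B. \<Oplus>a\<in>A. f a b)"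
  using assms(1,3)
proof (induction A rule: finite_induct)
  case (insert a A)
  have "(\<Oplus>a\<in>insert a A. \<Oplus>b\<in>B. f a b) = (\<Oplus>b\<in>B. f a b) \<oplus> (\<Oplus>b\<in>B. \<Oplus>a\<in>A. f a b)"
    using insert by (simp add: Pi_def)
  also have "\<dots> = (\<Oplus>b\<in>B. f a b \<oplus> (\<Oplus>a\<in>A. f a b))"
    using insert.prems by (intro finsum_addf[symmetric]) (auto intro!: finsum_closed)
  also have "\<dots> = (\<Oplus>b\<in>B. \<Oplus>a\<in>insert a A. f a b)"
    using insert by (intro finsum_cong') (auto intro!: finsum_closed)
  finally show ?case .
qed (simp add: finsum_zero)

lemma (in abelian_monoid) finsum_product:
  assumes "finite A" "finite B" "\<And>a b. a \<in> A \<Longrightarrow> b \<in> B \<Longrightarrow> f (a, b) \<in> carrier G"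
  shows "(\<Oplus>x\<in>A \<times> B. f x) = (\<Oplus>a\<in>A. \<Oplus>b\<in>B. f (a, b))"
  using assms(1,3)
proof (induction A rule: finite_induct)
  case (insert a A)
  have "insert a A \<times> B = Pair a ` B \<union> A \<times> B" by auto
  then have "(\<Oplus>x\<in>insert a A \<times> B. f x) = (\<Oplus>x\<in>Pair a ` B. f x) \<oplus> (\<Oplus>x\<in>A \<times> B. f x)"
    using insert assms(2) by (simp only:) (rule finsum_Un_disjoint; auto)
  also have "(\<Oplus>x\<in>Pair a ` B. f x) = (\<Oplus>b\<in>B. f (a, b))"
    using insert by (subst finsum_reindex) (auto simp: inj_on_def)
  finally show ?case
    using insert by (simp add: Pi_def)
qed simp

lemma (in abelian_monoid) finsum_delta:
  assumes "finite A" "a \<in> A" "\<And>b. b \<in> A \<Longrightarrow> b \<noteq> a \<Longrightarrow> f b = \<zero>" "f a \<in> carrier G"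
  shows "(\<Oplus>b\<in>A. f b) = f a"
proof -
  have "(\<Oplus>b\<in>A. f b) = (\<Oplus>b\<in>A. if a = b then f a else \<zero>)"
    using assms by (intro finsum_cong') auto
  then show ?thesis
    using finsum_singleton[of a A "\<lambda>_. f a"] assms by simp
qed

lemma (in abelian_monoid) finsum_reindex_bij:
  assumes "bij_betw h A B" "f \<in> B \<rightarrow> carrier G"
  shows "(\<Oplus>b\<in>B. f b) = (\<Oplus>a\<in>A. f (h a))"
  using finsum_reindex[of f h A] assms by (auto simp: bij_betw_def)

text \<open>The module axioms do not mention the ring fields \<open>mult\<close> and
  \<open>one\<close> of \<open>M\<close>. So free modules, matrices and group algebras can all
  inherit their module structure from a direct sum of copies of one module.\<close>

lemma module_cong:
  fixes M N :: "('k, 'a, 'n) module_scheme"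
  assumes "module R M" "carrier N = carrier M" "add N = add M" "zero N = zero M" "smult N = smult M"
  shows "module R N"
  using assms by (simp add: module_def module_axioms_def abelian_group_def abelian_monoid_def abelian_group_axioms_def)

lemma module_directD:
  assumes "module R M"
  shows "cring R" "abelian_group M" "abelian_monoid M"
  using assms by (simp_all add: module_def abelian_group_def)

lemma associative_algebraD:
  assumes "associative_algebra R M"
  shows "module R M" "ring M" "monoid M"
  using assms by (simp_all add: associative_algebra_def ring_def)

section \<open>Direct sums and free modules\<close>

lemma direct_sum_sel [simp]:
  "carrier (direct_sum I M) = (\<Pi>\<^sub>E i\<in>I. carrier (M i))"
  "x \<otimes>\<^bsub>direct_sum I M\<^esub> y = (\<lambda>i\<in>I. x i \<otimes>\<^bsub>M i\<^esub> y i)"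
  "\<one>\<^bsub>direct_sum I M\<^esub> = (\<lambda>i\<in>I. \<one>\<^bsub>M i\<^esub>)"
  "\<zero>\<^bsub>direct_sum I M\<^esub> = (\<lambda>i\<in>I. \<zero>\<^bsub>M i\<^esub>)"
  "x \<oplus>\<^bsub>direct_sum I M\<^esub> y = (\<lambda>i\<in>I. x i \<oplus>\<^bsub>M i\<^esub> y i)"
  "a \<odot>\<^bsub>direct_sum I M\<^esub> x = (\<lambda>i\<in>I. a \<odot>\<^bsub>M i\<^esub> x i)"
  by (simp_all add: direct_sum_def)

lemma module_direct_sum:
  assumes "cring R" "\<And>i. i \<in> I \<Longrightarrow> module R (M i)"
  shows "module R (direct_sum I M)"
proof -
  interpret R: cring R by fact
  note ag = module_directD(2)[OF assms(2)] and am = module_directD(3)[OF assms(2)]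
  have mem: "x i \<in> carrier (M i)" if "x \<in> (\<Pi>\<^sub>E i\<in>I. carrier (M i))" "i \<in> I" for x i
    using that by (rule PiE_mem)
  note facts = mem abelian_monoid.a_closed[OF am] abelian_monoid.zero_closed[OF am] module.smult_closed[OF assms(2)]
    abelian_monoid.a_assoc[OF am] abelian_monoid.l_zero[OF am] abelian_group.l_neg[OF ag]
    abelian_group.a_inv_closed[OF ag] module.smult_l_distr[OF assms(2)] module.smult_r_distr[OF assms(2)]
    module.smult_assoc1[OF assms(2)] module.smult_one[OF assms(2)]
  show ?thesis
  proof (rule moduleI[OF assms(1)])
    show "abelian_group (direct_sum I M)"
    proof (rule abelian_groupI)
      fix x y assume "x \<in> carrier (direct_sum I M)" "y \<in> carrier (direct_sum I M)"
      then show "x \<oplus>\<^bsub>direct_sum I M\<^esub> y = y \<oplus>\<^bsub>direct_sum I M\<^esub> x"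
        by (auto intro!: restrict_ext abelian_monoid.a_comm[OF am] mem)
    next
      fix x assume x: "x \<in> carrier (direct_sum I M)"
      show "\<exists>y\<in>carrier (direct_sum I M). y \<oplus>\<^bsub>direct_sum I M\<^esub> x = \<zero>\<^bsub>direct_sum I M\<^esub>"
        using x facts by (intro bexI[of _ "\<lambda>i\<in>I. \<ominus>\<^bsub>M i\<^esub> x i"]) (auto intro!: restrict_ext simp: facts)
    qed (auto simp: facts intro!: restrict_ext PiE_ext[of "restrict _ I" I])
  qed (auto simp: facts intro!: restrict_ext PiE_ext[of "restrict _ I" I])
qed

lemma associative_algebraI:
  assumes "module R M" "monoid M"
    and "\<And>x y z. \<lbrakk>x \<in> carrier M; y \<in> carrier M; z \<in> carrier M\<rbrakk> \<Longrightarrow> (x \<oplus>\<^bsub>M\<^esub> y) \<otimes>\<^bsub>M\<^esub> z = x \<otimes>\<^bsub>M\<^esub> z \<oplus>\<^bsub>M\<^esub> y \<otimes>\<^bsub>M\<^esub> z"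
    and "\<And>x y z. \<lbrakk>x \<in> carrier M; y \<in> carrier M; z \<in> carrier M\<rbrakk> \<Longrightarrow> z \<otimes>\<^bsub>M\<^esub> (x \<oplus>\<^bsub>M\<^esub> y) = z \<otimes>\<^bsub>M\<^esub> x \<oplus>\<^bsub>M\<^esub> z \<otimes>\<^bsub>M\<^esub> y"
    and "\<And>a x y. \<lbrakk>a \<in> carrier R; x \<in> carrier M; y \<in> carrier M\<rbrakk> \<Longrightarrow> (a \<odot>\<^bsub>M\<^esub> x) \<otimes>\<^bsub>M\<^esub> y = a \<odot>\<^bsub>M\<^esub> (x \<otimes>\<^bsub>M\<^esub> y)"
    and "\<And>a x y. \<lbrakk>a \<in> carrier R; x \<in> carrier M; y \<in> carrier M\<rbrakk> \<Longrightarrow> x \<otimes>\<^bsub>M\<^esub> (a \<odot>\<^bsub>M\<^esub> y) = a \<odot>\<^bsub>M\<^esub> (x \<otimes>\<^bsub>M\<^esub> y)"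
  shows "associative_algebra R M"
  using assms module_directD[OF assms(1)]
  by (simp add: associative_algebra_def associative_algebra_axioms_def ringI)

lemma associative_algebra_direct_sum:
  assumes "cring R" "\<And>i. i \<in> I \<Longrightarrow> associative_algebra R (M i)"
  shows "associative_algebra R (direct_sum I M)"
proof -
  note mo = associative_algebraD(3)[OF assms(2)] and ri = associative_algebraD(2)[OF assms(2)]
  have mem: "x i \<in> carrier (M i)" if "x \<in> (\<Pi>\<^sub>E i\<in>I. carrier (M i))" "i \<in> I" for x i
    using that by (rule PiE_mem)
  have distr: "(x \<oplus>\<^bsub>M i\<^esub> y) \<otimes>\<^bsub>M i\<^esub> z = x \<otimes>\<^bsub>M i\<^esub> z \<oplus>\<^bsub>M i\<^esub> y \<otimes>\<^bsub>M i\<^esub> z"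
      "z \<otimes>\<^bsub>M i\<^esub> (x \<oplus>\<^bsub>M i\<^esub> y) = z \<otimes>\<^bsub>M i\<^esub> x \<oplus>\<^bsub>M i\<^esub> z \<otimes>\<^bsub>M i\<^esub> y"
    if "i \<in> I" "x \<in> carrier (M i)" "y \<in> carrier (M i)" "z \<in> carrier (M i)" for i x y z
  proof -
    interpret ring "M i" by (rule ri[OF that(1)])
    show "(x \<oplus>\<^bsub>M i\<^esub> y) \<otimes>\<^bsub>M i\<^esub> z = x \<otimes>\<^bsub>M i\<^esub> z \<oplus>\<^bsub>M i\<^esub> y \<otimes>\<^bsub>M i\<^esub> z"
      "z \<otimes>\<^bsub>M i\<^esub> (x \<oplus>\<^bsub>M i\<^esub> y) = z \<otimes>\<^bsub>M i\<^esub> x \<oplus>\<^bsub>M i\<^esub> z \<otimes>\<^bsub>M i\<^esub> y"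
      using that by (simp_all add: l_distr r_distr)
  qed
  note facts = mem distr monoid.m_closed[OF mo] monoid.one_closed[OF mo] monoid.m_assoc[OF mo] monoid.l_one[OF mo] monoid.r_one[OF mo]
    associative_algebra.smult_mult_left[OF assms(2)] associative_algebra.smult_mult_right[OF assms(2)]
  have "module R (direct_sum I M)"
    using assms associative_algebraD(1) by (intro module_direct_sum) auto
  moreover have "monoid (direct_sum I M)"
    by (rule monoidI) (auto simp: facts intro!: restrict_ext PiE_ext[of "restrict _ I" I])
  ultimately show ?thesis
    by (rule associative_algebraI) (auto intro!: restrict_ext simp: facts)
qed

lemma ground_algebra_sel [simp]:
  "carrier (ground_algebra R) = carrier R"
  "x \<otimes>\<^bsub>ground_algebra R\<^esub> y = x \<otimes>\<^bsub>R\<^esub> y"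
  "\<one>\<^bsub>ground_algebra R\<^esub> = \<one>\<^bsub>R\<^esub>"
  "\<zero>\<^bsub>ground_algebra R\<^esub> = \<zero>\<^bsub>R\<^esub>"
  "x \<oplus>\<^bsub>ground_algebra R\<^esub> y = x \<oplus>\<^bsub>R\<^esub> y"
  "a \<odot>\<^bsub>ground_algebra R\<^esub> x = a \<otimes>\<^bsub>R\<^esub> x"
  by (simp_all add: ground_algebra_def)

lemma associative_algebra_ground:
  assumes "cring R"
  shows "associative_algebra R (ground_algebra R)"
proof -
  interpret R: cring R by fact
  show ?thesis
  proof (rule associative_algebraI)
    show "module R (ground_algebra R)"
    proof (rule moduleI[OF assms])
      show "abelian_group (ground_algebra R)"
        by (rule abelian_groupI) (auto simp: R.a_ac intro: bexI[of _ "\<ominus>\<^bsub>R\<^esub> _"] R.l_neg)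
    qed (auto simp: R.l_distr R.r_distr R.m_assoc)
    show "monoid (ground_algebra R)"
      by (rule monoidI) (auto simp: R.m_assoc)
  qed (auto simp: R.l_distr R.r_distr R.m_assoc R.m_lcomm)
qed

lemma free_module_sel [simp]:
  "carrier (free_module R S) = S \<rightarrow>\<^sub>E carrier R"
  "\<zero>\<^bsub>free_module R S\<^esub> = (\<lambda>s\<in>S. \<zero>\<^bsub>R\<^esub>)"
  "x \<oplus>\<^bsub>free_module R S\<^esub> y = (\<lambda>s\<in>S. x s \<oplus>\<^bsub>R\<^esub> y s)"
  "a \<odot>\<^bsub>free_module R S\<^esub> x = (\<lambda>s\<in>S. a \<otimes>\<^bsub>R\<^esub> x s)"
  by (simp_all add: free_module_def)

lemma module_free_module:
  assumes "cring R"
  shows "module R (free_module R S)"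
proof (rule module_cong[of _ "direct_sum S (\<lambda>_. ground_algebra R)"])
  show "module R (direct_sum S (\<lambda>_. ground_algebra R))"
    using associative_algebraD(1)[OF associative_algebra_ground[OF assms]] assms by (intro module_direct_sum)
qed (auto intro!: ext)

section \<open>Matrices over an associative algebra\<close>

lemma matrix_module_sel [simp]:
  "carrier (matrix_module A m n) = {..<m} \<times> {..<n} \<rightarrow>\<^sub>E carrier A"
  "\<zero>\<^bsub>matrix_module A m n\<^esub> = (\<lambda>ij\<in>{..<m} \<times> {..<n}. \<zero>\<^bsub>A\<^esub>)"
  "x \<oplus>\<^bsub>matrix_module A m n\<^esub> y = (\<lambda>ij\<in>{..<m} \<times> {..<n}. x ij \<oplus>\<^bsub>A\<^esub> y ij)"
  "a \<odot>\<^bsub>matrix_module A m n\<^esub> x = (\<lambda>ij\<in>{..<m} \<times> {..<n}. a \<odot>\<^bsub>A\<^esub> x ij)"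
  by (simp_all add: matrix_module_def)

lemma module_matrix_module:
  assumes "module R A"
  shows "module R (matrix_module A m n)"
proof (rule module_cong[of _ "direct_sum ({..<m} \<times> {..<n}) (\<lambda>_. A)"])
  show "module R (direct_sum ({..<m} \<times> {..<n}) (\<lambda>_. A))"
    using module_directD(1)[OF assms] assms by (intro module_direct_sum)
qed (auto intro!: ext)

lemma matrix_algebra_sel [simp]:
  "carrier (matrix_algebra A n) = {..<n} \<times> {..<n} \<rightarrow>\<^sub>E carrier A"
  "\<zero>\<^bsub>matrix_algebra A n\<^esub> = (\<lambda>ij\<in>{..<n} \<times> {..<n}. \<zero>\<^bsub>A\<^esub>)"
  "x \<oplus>\<^bsub>matrix_algebra A n\<^esub> y = (\<lambda>ij\<in>{..<n} \<times> {..<n}. x ij \<oplus>\<^bsub>A\<^esub> y ij)"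
  "a \<odot>\<^bsub>matrix_algebra A n\<^esub> x = (\<lambda>ij\<in>{..<n} \<times> {..<n}. a \<odot>\<^bsub>A\<^esub> x ij)"
  "x \<otimes>\<^bsub>matrix_algebra A n\<^esub> y = (\<lambda>(i, j)\<in>{..<n} \<times> {..<n}. \<Oplus>\<^bsub>A\<^esub>l\<in>{..<n}. x (i, l) \<otimes>\<^bsub>A\<^esub> y (l, j))"
  "\<one>\<^bsub>matrix_algebra A n\<^esub> = (\<lambda>(i, j)\<in>{..<n} \<times> {..<n}. if i = j then \<one>\<^bsub>A\<^esub> else \<zero>\<^bsub>A\<^esub>)"
  by (simp_all add: matrix_algebra_def)

lemma matrix_ext:
  assumes "x \<in> S \<times> T \<rightarrow>\<^sub>E C" "y \<in> S \<times> T \<rightarrow>\<^sub>E C" "\<And>i j. i \<in> S \<Longrightarrow> j \<in> T \<Longrightarrow> x (i, j) = y (i, j)"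
  shows "x = y"
  using assms by (intro PiE_ext[of x "S \<times> T" _ y]) auto

lemma (in associative_algebra) finsum_smult:
  assumes "finite S" "a \<in> carrier R" "\<And>s. s \<in> S \<Longrightarrow> f s \<in> carrier M"
  shows "a \<odot>\<^bsub>M\<^esub> (\<Oplus>\<^bsub>M\<^esub>s\<in>S. f s) = (\<Oplus>\<^bsub>M\<^esub>s\<in>S. a \<odot>\<^bsub>M\<^esub> f s)"
  using assms(1,3)
proof (induction S rule: finite_induct)
  case (insert s S)
  then show ?case using assms(2) by (simp add: Pi_def smult_r_distr)
qed (use assms(2) in simp)

lemma associative_algebra_matrix:
  assumes "associative_algebra R A"
  shows "associative_algebra R (matrix_algebra A n)"
proof -
  interpret A: associative_algebra R A by fact
  let ?M = "matrix_algebra A n" and ?N = "{..<n} \<times> {..<n}"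
  have mem: "x (i, j) \<in> carrier A" if "x \<in> carrier ?M" "i < n" "j < n" for x i j
    using that by (auto simp: PiE_mem)
  have sum_closed: "(\<Oplus>\<^bsub>A\<^esub>l\<in>{..<n}. x (i, l) \<otimes>\<^bsub>A\<^esub> y (l, j)) \<in> carrier A"
    if "x \<in> carrier ?M" "y \<in> carrier ?M" "i < n" "j < n" for x y i j
    by (rule A.M.finsum_closed) (auto intro!: A.m_closed mem[OF that(1)] mem[OF that(2)] simp: that(3,4))
  have mult_closed: "x \<otimes>\<^bsub>?M\<^esub> y \<in> carrier ?M" if "x \<in> carrier ?M" "y \<in> carrier ?M" for x y
    using sum_closed[OF that] by auto
  have one_closed: "\<one>\<^bsub>?M\<^esub> \<in> carrier ?M" by auto
  have mult: "(x \<otimes>\<^bsub>?M\<^esub> y) (i, j) = (\<Oplus>\<^bsub>A\<^esub>l\<in>{..<n}. x (i, l) \<otimes>\<^bsub>A\<^esub> y (l, j))" if "i < n" "j < n" for x y i j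
    using that by simp
  have mod: "module R ?M"
    using module_matrix_module[OF A.module_axioms, of n n] by (rule module_cong) (auto intro!: ext)
  note add_closed = abelian_monoid.a_closed[OF module_directD(3)[OF mod]]
    and smult_closed = module.smult_closed[OF mod]
  show ?thesis
  proof (rule associative_algebraI[OF mod])
    show "monoid ?M"
    proof (rule monoidI)
      fix x y z assume xyz: "x \<in> carrier ?M" "y \<in> carrier ?M" "z \<in> carrier ?M"
      note mems = mem[OF xyz(1)] mem[OF xyz(2)] mem[OF xyz(3)]
      show "x \<otimes>\<^bsub>?M\<^esub> y \<otimes>\<^bsub>?M\<^esub> z = x \<otimes>\<^bsub>?M\<^esub> (y \<otimes>\<^bsub>?M\<^esub> z)"
      proof (rule matrix_ext[of _ "{..<n}" "{..<n}" "carrier A"])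
        fix i j assume ij: "i \<in> {..<n}" "j \<in> {..<n}"
        have "(x \<otimes>\<^bsub>?M\<^esub> y \<otimes>\<^bsub>?M\<^esub> z) (i, j) =
            (\<Oplus>\<^bsub>A\<^esub>l\<in>{..<n}. (\<Oplus>\<^bsub>A\<^esub>m\<in>{..<n}. x (i, m) \<otimes>\<^bsub>A\<^esub> y (m, l)) \<otimes>\<^bsub>A\<^esub> z (l, j))"
          using ij by (subst mult) (auto intro!: A.M.finsum_cong' A.m_closed A.M.finsum_closed mems)
        also have "\<dots> = (\<Oplus>\<^bsub>A\<^esub>l\<in>{..<n}. \<Oplus>\<^bsub>A\<^esub>m\<in>{..<n}. x (i, m) \<otimes>\<^bsub>A\<^esub> y (m, l) \<otimes>\<^bsub>A\<^esub> z (l, j))"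
          using ij by (intro A.M.finsum_cong') (auto intro!: A.finsum_ldistr A.m_closed A.M.finsum_closed mems)
        also have "\<dots> = (\<Oplus>\<^bsub>A\<^esub>m\<in>{..<n}. \<Oplus>\<^bsub>A\<^esub>l\<in>{..<n}. x (i, m) \<otimes>\<^bsub>A\<^esub> y (m, l) \<otimes>\<^bsub>A\<^esub> z (l, j))"
          using ij by (intro A.M.finsum_swap) (auto intro!: A.m_closed mems)
        also have "\<dots> = (\<Oplus>\<^bsub>A\<^esub>m\<in>{..<n}. \<Oplus>\<^bsub>A\<^esub>l\<in>{..<n}. x (i, m) \<otimes>\<^bsub>A\<^esub> (y (m, l) \<otimes>\<^bsub>A\<^esub> z (l, j)))"
          using ij by (intro A.M.finsum_cong') (auto intro!: A.M.finsum_cong' A.m_assoc A.m_closed A.M.finsum_closed mems)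
        also have "\<dots> = (\<Oplus>\<^bsub>A\<^esub>m\<in>{..<n}. x (i, m) \<otimes>\<^bsub>A\<^esub> (\<Oplus>\<^bsub>A\<^esub>l\<in>{..<n}. y (m, l) \<otimes>\<^bsub>A\<^esub> z (l, j)))"
          using ij by (intro A.M.finsum_cong') (auto intro!: A.finsum_rdistr[symmetric] A.m_closed A.M.finsum_closed mems)
        also have "\<dots> = (x \<otimes>\<^bsub>?M\<^esub> (y \<otimes>\<^bsub>?M\<^esub> z)) (i, j)"
          using ij by (subst mult) (auto intro!: A.M.finsum_cong' A.m_closed A.M.finsum_closed mems)
        finally show "(x \<otimes>\<^bsub>?M\<^esub> y \<otimes>\<^bsub>?M\<^esub> z) (i, j) = (x \<otimes>\<^bsub>?M\<^esub> (y \<otimes>\<^bsub>?M\<^esub> z)) (i, j)" .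
      qed (use mult_closed xyz in \<open>simp_all only: matrix_algebra_sel(1)\<close>)
    next
      fix x assume x: "x \<in> carrier ?M"
      show "\<one>\<^bsub>?M\<^esub> \<otimes>\<^bsub>?M\<^esub> x = x"
      proof (rule matrix_ext[of _ "{..<n}" "{..<n}" "carrier A"])
        fix i j assume ij: "i \<in> {..<n}" "j \<in> {..<n}"
        have "(\<Oplus>\<^bsub>A\<^esub>l\<in>{..<n}. \<one>\<^bsub>?M\<^esub> (i, l) \<otimes>\<^bsub>A\<^esub> x (l, j)) = \<one>\<^bsub>?M\<^esub> (i, i) \<otimes>\<^bsub>A\<^esub> x (i, j)"
          using ij by (intro A.M.finsum_delta) (auto simp: mem[OF x])
        then show "(\<one>\<^bsub>?M\<^esub> \<otimes>\<^bsub>?M\<^esub> x) (i, j) = x (i, j)"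
          using ij mem[OF x, of i j] by simp
      qed (use mult_closed[OF one_closed x] x in \<open>simp_all only: matrix_algebra_sel(1)\<close>)
      show "x \<otimes>\<^bsub>?M\<^esub> \<one>\<^bsub>?M\<^esub> = x"
      proof (rule matrix_ext[of _ "{..<n}" "{..<n}" "carrier A"])
        fix i j assume ij: "i \<in> {..<n}" "j \<in> {..<n}"
        have "(\<Oplus>\<^bsub>A\<^esub>l\<in>{..<n}. x (i, l) \<otimes>\<^bsub>A\<^esub> \<one>\<^bsub>?M\<^esub> (l, j)) = x (i, j) \<otimes>\<^bsub>A\<^esub> \<one>\<^bsub>?M\<^esub> (j, j)"
          using ij by (intro A.M.finsum_delta) (auto simp: mem[OF x])
        then show "(x \<otimes>\<^bsub>?M\<^esub> \<one>\<^bsub>?M\<^esub>) (i, j) = x (i, j)"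
          using ij mem[OF x, of i j] by simp
      qed (use mult_closed[OF x one_closed] x in \<open>simp_all only: matrix_algebra_sel(1)\<close>)
    qed (rule mult_closed one_closed; assumption)+
  next
    fix x y z assume xyz: "x \<in> carrier ?M" "y \<in> carrier ?M" "z \<in> carrier ?M"
    note mems = mem[OF xyz(1)] mem[OF xyz(2)] mem[OF xyz(3)]
    show "(x \<oplus>\<^bsub>?M\<^esub> y) \<otimes>\<^bsub>?M\<^esub> z = x \<otimes>\<^bsub>?M\<^esub> z \<oplus>\<^bsub>?M\<^esub> y \<otimes>\<^bsub>?M\<^esub> z"
    proof (rule matrix_ext[of _ "{..<n}" "{..<n}" "carrier A"])
      fix i j assume ij: "i \<in> {..<n}" "j \<in> {..<n}"
      have "((x \<oplus>\<^bsub>?M\<^esub> y) \<otimes>\<^bsub>?M\<^esub> z) (i, j) =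
          (\<Oplus>\<^bsub>A\<^esub>l\<in>{..<n}. x (i, l) \<otimes>\<^bsub>A\<^esub> z (l, j) \<oplus>\<^bsub>A\<^esub> y (i, l) \<otimes>\<^bsub>A\<^esub> z (l, j))"
        using ij by (subst mult) (auto intro!: A.M.finsum_cong' A.l_distr A.m_closed mems)
      also have "\<dots> = (\<Oplus>\<^bsub>A\<^esub>l\<in>{..<n}. x (i, l) \<otimes>\<^bsub>A\<^esub> z (l, j)) \<oplus>\<^bsub>A\<^esub> (\<Oplus>\<^bsub>A\<^esub>l\<in>{..<n}. y (i, l) \<otimes>\<^bsub>A\<^esub> z (l, j))"
        using ij by (intro A.M.finsum_addf) (auto intro!: A.m_closed mems)
      finally show "((x \<oplus>\<^bsub>?M\<^esub> y) \<otimes>\<^bsub>?M\<^esub> z) (i, j) = (x \<otimes>\<^bsub>?M\<^esub> z \<oplus>\<^bsub>?M\<^esub> y \<otimes>\<^bsub>?M\<^esub> z) (i, j)"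
        using ij by simp
    qed (unfold matrix_algebra_sel(1)[symmetric], (intro mult_closed add_closed xyz)+)
    show "z \<otimes>\<^bsub>?M\<^esub> (x \<oplus>\<^bsub>?M\<^esub> y) = z \<otimes>\<^bsub>?M\<^esub> x \<oplus>\<^bsub>?M\<^esub> z \<otimes>\<^bsub>?M\<^esub> y"
    proof (rule matrix_ext[of _ "{..<n}" "{..<n}" "carrier A"])
      fix i j assume ij: "i \<in> {..<n}" "j \<in> {..<n}"
      have "(z \<otimes>\<^bsub>?M\<^esub> (x \<oplus>\<^bsub>?M\<^esub> y)) (i, j) =
          (\<Oplus>\<^bsub>A\<^esub>l\<in>{..<n}. z (i, l) \<otimes>\<^bsub>A\<^esub> x (l, j) \<oplus>\<^bsub>A\<^esub> z (i, l) \<otimes>\<^bsub>A\<^esub> y (l, j))"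
        using ij by (subst mult) (auto intro!: A.M.finsum_cong' A.r_distr A.m_closed mems)
      also have "\<dots> = (\<Oplus>\<^bsub>A\<^esub>l\<in>{..<n}. z (i, l) \<otimes>\<^bsub>A\<^esub> x (l, j)) \<oplus>\<^bsub>A\<^esub> (\<Oplus>\<^bsub>A\<^esub>l\<in>{..<n}. z (i, l) \<otimes>\<^bsub>A\<^esub> y (l, j))"
        using ij by (intro A.M.finsum_addf) (auto intro!: A.m_closed mems)
      finally show "(z \<otimes>\<^bsub>?M\<^esub> (x \<oplus>\<^bsub>?M\<^esub> y)) (i, j) = (z \<otimes>\<^bsub>?M\<^esub> x \<oplus>\<^bsub>?M\<^esub> z \<otimes>\<^bsub>?M\<^esub> y) (i, j)"
        using ij by simp
    qed (unfold matrix_algebra_sel(1)[symmetric], (intro mult_closed add_closed xyz)+)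
  next
    fix a x y assume a: "a \<in> carrier R" and xy: "x \<in> carrier ?M" "y \<in> carrier ?M"
    note mems = mem[OF xy(1)] mem[OF xy(2)]
    show "(a \<odot>\<^bsub>?M\<^esub> x) \<otimes>\<^bsub>?M\<^esub> y = a \<odot>\<^bsub>?M\<^esub> (x \<otimes>\<^bsub>?M\<^esub> y)"
    proof (rule matrix_ext[of _ "{..<n}" "{..<n}" "carrier A"])
      fix i j assume ij: "i \<in> {..<n}" "j \<in> {..<n}"
      have "((a \<odot>\<^bsub>?M\<^esub> x) \<otimes>\<^bsub>?M\<^esub> y) (i, j) = (\<Oplus>\<^bsub>A\<^esub>l\<in>{..<n}. a \<odot>\<^bsub>A\<^esub> (x (i, l) \<otimes>\<^bsub>A\<^esub> y (l, j)))"
        using ij a by (subst mult) (auto intro!: A.M.finsum_cong' A.smult_mult_left A.smult_closed A.m_closed mems)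
      also have "\<dots> = a \<odot>\<^bsub>A\<^esub> (\<Oplus>\<^bsub>A\<^esub>l\<in>{..<n}. x (i, l) \<otimes>\<^bsub>A\<^esub> y (l, j))"
        using ij a by (intro A.finsum_smult[symmetric]) (auto intro!: A.m_closed mems)
      finally show "((a \<odot>\<^bsub>?M\<^esub> x) \<otimes>\<^bsub>?M\<^esub> y) (i, j) = (a \<odot>\<^bsub>?M\<^esub> (x \<otimes>\<^bsub>?M\<^esub> y)) (i, j)"
        using ij by simp
    qed (unfold matrix_algebra_sel(1)[symmetric], (intro mult_closed smult_closed xy a)+)
    show "x \<otimes>\<^bsub>?M\<^esub> (a \<odot>\<^bsub>?M\<^esub> y) = a \<odot>\<^bsub>?M\<^esub> (x \<otimes>\<^bsub>?M\<^esub> y)"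
    proof (rule matrix_ext[of _ "{..<n}" "{..<n}" "carrier A"])
      fix i j assume ij: "i \<in> {..<n}" "j \<in> {..<n}"
      have "(x \<otimes>\<^bsub>?M\<^esub> (a \<odot>\<^bsub>?M\<^esub> y)) (i, j) = (\<Oplus>\<^bsub>A\<^esub>l\<in>{..<n}. a \<odot>\<^bsub>A\<^esub> (x (i, l) \<otimes>\<^bsub>A\<^esub> y (l, j)))"
        using ij a by (subst mult) (auto intro!: A.M.finsum_cong' A.smult_mult_right A.smult_closed A.m_closed mems)
      also have "\<dots> = a \<odot>\<^bsub>A\<^esub> (\<Oplus>\<^bsub>A\<^esub>l\<in>{..<n}. x (i, l) \<otimes>\<^bsub>A\<^esub> y (l, j))"
        using ij a by (intro A.finsum_smult[symmetric]) (auto intro!: A.m_closed mems)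
      finally show "(x \<otimes>\<^bsub>?M\<^esub> (a \<odot>\<^bsub>?M\<^esub> y)) (i, j) = (a \<odot>\<^bsub>?M\<^esub> (x \<otimes>\<^bsub>?M\<^esub> y)) (i, j)"
        using ij by simp
    qed (unfold matrix_algebra_sel(1)[symmetric], (intro mult_closed smult_closed xy a)+)
  qed
qed

section \<open>Group algebras\<close>

lemma group_algebra_sel [simp]:
  "carrier (group_algebra R G) = carrier G \<rightarrow>\<^sub>E carrier R"
  "\<zero>\<^bsub>group_algebra R G\<^esub> = (\<lambda>s\<in>carrier G. \<zero>\<^bsub>R\<^esub>)"
  "x \<oplus>\<^bsub>group_algebra R G\<^esub> y = (\<lambda>s\<in>carrier G. x s \<oplus>\<^bsub>R\<^esub> y s)"
  "a \<odot>\<^bsub>group_algebra R G\<^esub> x = (\<lambda>s\<in>carrier G. a \<otimes>\<^bsub>R\<^esub> x s)"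
  "x \<otimes>\<^bsub>group_algebra R G\<^esub> y =
     (\<lambda>g\<in>carrier G. \<Oplus>\<^bsub>R\<^esub>h\<in>carrier G. x h \<otimes>\<^bsub>R\<^esub> y (inv\<^bsub>G\<^esub> h \<otimes>\<^bsub>G\<^esub> g))"
  "\<one>\<^bsub>group_algebra R G\<^esub> = free_basis R (carrier G) \<one>\<^bsub>G\<^esub>"
  by (simp_all add: group_algebra_def)

lemma associative_algebra_group_algebra:
  assumes "cring R" "group G" "finite (carrier G)"
  shows "associative_algebra R (group_algebra R G)"
proof -
  interpret R: cring R by fact
  interpret G: group G by fact
  let ?A = "group_algebra R G" and ?C = "carrier G"
  have mem: "x g \<in> carrier R" if "x \<in> carrier ?A" "g \<in> ?C" for x g
    using that by (auto simp: PiE_mem)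
  have closed: "inv\<^bsub>G\<^esub> h \<otimes>\<^bsub>G\<^esub> g \<in> ?C" if "h \<in> ?C" "g \<in> ?C" for h g
    using that by simp
  have mult: "(x \<otimes>\<^bsub>?A\<^esub> y) g = (\<Oplus>\<^bsub>R\<^esub>h\<in>?C. x h \<otimes>\<^bsub>R\<^esub> y (inv\<^bsub>G\<^esub> h \<otimes>\<^bsub>G\<^esub> g))" if "g \<in> ?C" for x y g
    using that by simp
  have sum_closed: "(\<Oplus>\<^bsub>R\<^esub>h\<in>?C. x h \<otimes>\<^bsub>R\<^esub> y (inv\<^bsub>G\<^esub> h \<otimes>\<^bsub>G\<^esub> g)) \<in> carrier R"
    if "x \<in> carrier ?A" "y \<in> carrier ?A" "g \<in> ?C" for x y g
    by (rule R.finsum_closed) (auto intro!: R.m_closed mem[OF that(1)] mem[OF that(2)] simp: that(3))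
  have mult_closed: "x \<otimes>\<^bsub>?A\<^esub> y \<in> carrier ?A" if "x \<in> carrier ?A" "y \<in> carrier ?A" for x y
    using sum_closed[OF that] by auto
  have one_closed: "\<one>\<^bsub>?A\<^esub> \<in> carrier ?A"
    by (auto simp: free_basis_def)
  have mod: "module R ?A"
    using module_free_module[OF assms(1), of ?C] by (rule module_cong) (auto intro!: ext)
  note add_closed = abelian_monoid.a_closed[OF module_directD(3)[OF mod]]
    and smult_closed = module.smult_closed[OF mod]
  show ?thesis
  proof (rule associative_algebraI[OF mod])
    show "monoid ?A"
    proof (rule monoidI)
      fix x y z assume xyz: "x \<in> carrier ?A" "y \<in> carrier ?A" "z \<in> carrier ?A"
      note mems = mem[OF xyz(1)] mem[OF xyz(2)] mem[OF xyz(3)]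
      show "x \<otimes>\<^bsub>?A\<^esub> y \<otimes>\<^bsub>?A\<^esub> z = x \<otimes>\<^bsub>?A\<^esub> (y \<otimes>\<^bsub>?A\<^esub> z)"
      proof (rule PiE_ext[of _ ?C "\<lambda>_. carrier R"])
        fix g assume g: "g \<in> ?C"
        have "(x \<otimes>\<^bsub>?A\<^esub> y \<otimes>\<^bsub>?A\<^esub> z) g =
            (\<Oplus>\<^bsub>R\<^esub>h\<in>?C. (\<Oplus>\<^bsub>R\<^esub>l\<in>?C. x l \<otimes>\<^bsub>R\<^esub> y (inv\<^bsub>G\<^esub> l \<otimes>\<^bsub>G\<^esub> h)) \<otimes>\<^bsub>R\<^esub> z (inv\<^bsub>G\<^esub> h \<otimes>\<^bsub>G\<^esub> g))"
          unfolding mult[OF g] by (intro R.finsum_cong') (auto simp: g intro!: R.m_closed R.finsum_closed mems)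
        also have "\<dots> = (\<Oplus>\<^bsub>R\<^esub>h\<in>?C. \<Oplus>\<^bsub>R\<^esub>l\<in>?C. x l \<otimes>\<^bsub>R\<^esub> y (inv\<^bsub>G\<^esub> l \<otimes>\<^bsub>G\<^esub> h) \<otimes>\<^bsub>R\<^esub> z (inv\<^bsub>G\<^esub> h \<otimes>\<^bsub>G\<^esub> g))"
          by (intro R.finsum_cong') (auto simp: g assms(3) intro!: R.finsum_ldistr R.m_closed R.finsum_closed mems)
        also have "\<dots> = (\<Oplus>\<^bsub>R\<^esub>l\<in>?C. \<Oplus>\<^bsub>R\<^esub>h\<in>?C. x l \<otimes>\<^bsub>R\<^esub> y (inv\<^bsub>G\<^esub> l \<otimes>\<^bsub>G\<^esub> h) \<otimes>\<^bsub>R\<^esub> z (inv\<^bsub>G\<^esub> h \<otimes>\<^bsub>G\<^esub> g))"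
          by (intro R.finsum_swap) (auto simp: g assms(3) intro!: R.m_closed mems)
        also have "\<dots> = (\<Oplus>\<^bsub>R\<^esub>l\<in>?C. x l \<otimes>\<^bsub>R\<^esub> (y \<otimes>\<^bsub>?A\<^esub> z) (inv\<^bsub>G\<^esub> l \<otimes>\<^bsub>G\<^esub> g))"
        proof (intro R.finsum_cong')
          fix l assume l: "l \<in> ?C"
          \<comment> \<open>The substitution of \<open>l\<close> times \<open>m\<close> for
            \<open>h\<close> turns the inner sum into the convolution of \<open>y\<close> and
            \<open>z\<close>, evaluated at \<open>inv l\<close> times \<open>g\<close>.\<close>
          have bij: "bij_betw (\<lambda>m. l \<otimes>\<^bsub>G\<^esub> m) ?C ?C"
            using l by (intro bij_betw_byWitness[of _ "\<lambda>m. inv\<^bsub>G\<^esub> l \<otimes>\<^bsub>G\<^esub> m"]) (auto simp: G.m_assoc[symmetric])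
          have "(\<Oplus>\<^bsub>R\<^esub>h\<in>?C. x l \<otimes>\<^bsub>R\<^esub> y (inv\<^bsub>G\<^esub> l \<otimes>\<^bsub>G\<^esub> h) \<otimes>\<^bsub>R\<^esub> z (inv\<^bsub>G\<^esub> h \<otimes>\<^bsub>G\<^esub> g)) =
              (\<Oplus>\<^bsub>R\<^esub>m\<in>?C. x l \<otimes>\<^bsub>R\<^esub> y (inv\<^bsub>G\<^esub> l \<otimes>\<^bsub>G\<^esub> (l \<otimes>\<^bsub>G\<^esub> m)) \<otimes>\<^bsub>R\<^esub> z (inv\<^bsub>G\<^esub> (l \<otimes>\<^bsub>G\<^esub> m) \<otimes>\<^bsub>G\<^esub> g))"
            by (rule R.finsum_reindex_bij[OF bij]) (auto simp: l g intro!: R.m_closed mems)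
          also have "\<dots> = (\<Oplus>\<^bsub>R\<^esub>m\<in>?C. x l \<otimes>\<^bsub>R\<^esub> (y m \<otimes>\<^bsub>R\<^esub> z (inv\<^bsub>G\<^esub> m \<otimes>\<^bsub>G\<^esub> (inv\<^bsub>G\<^esub> l \<otimes>\<^bsub>G\<^esub> g))))"
          proof (intro R.finsum_cong')
            fix m assume m: "m \<in> ?C"
            have "inv\<^bsub>G\<^esub> l \<otimes>\<^bsub>G\<^esub> (l \<otimes>\<^bsub>G\<^esub> m) = m"
              using l m by (simp add: G.m_assoc[symmetric])
            moreover have "inv\<^bsub>G\<^esub> (l \<otimes>\<^bsub>G\<^esub> m) \<otimes>\<^bsub>G\<^esub> g = inv\<^bsub>G\<^esub> m \<otimes>\<^bsub>G\<^esub> (inv\<^bsub>G\<^esub> l \<otimes>\<^bsub>G\<^esub> g)"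
              using l m g by (simp add: G.inv_mult_group G.m_assoc)
            ultimately show "x l \<otimes>\<^bsub>R\<^esub> y (inv\<^bsub>G\<^esub> l \<otimes>\<^bsub>G\<^esub> (l \<otimes>\<^bsub>G\<^esub> m)) \<otimes>\<^bsub>R\<^esub> z (inv\<^bsub>G\<^esub> (l \<otimes>\<^bsub>G\<^esub> m) \<otimes>\<^bsub>G\<^esub> g) =
                x l \<otimes>\<^bsub>R\<^esub> (y m \<otimes>\<^bsub>R\<^esub> z (inv\<^bsub>G\<^esub> m \<otimes>\<^bsub>G\<^esub> (inv\<^bsub>G\<^esub> l \<otimes>\<^bsub>G\<^esub> g)))"
              using l m g by (simp add: R.m_assoc mems)
          qed (auto simp: l g intro!: R.m_closed mems)
          also have "\<dots> = x l \<otimes>\<^bsub>R\<^esub> (\<Oplus>\<^bsub>R\<^esub>m\<in>?C. y m \<otimes>\<^bsub>R\<^esub> z (inv\<^bsub>G\<^esub> m \<otimes>\<^bsub>G\<^esub> (inv\<^bsub>G\<^esub> l \<otimes>\<^bsub>G\<^esub> g)))"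
            by (rule R.finsum_rdistr[symmetric]) (auto simp: l g assms(3) intro!: R.m_closed mems)
          finally show "(\<Oplus>\<^bsub>R\<^esub>h\<in>?C. x l \<otimes>\<^bsub>R\<^esub> y (inv\<^bsub>G\<^esub> l \<otimes>\<^bsub>G\<^esub> h) \<otimes>\<^bsub>R\<^esub> z (inv\<^bsub>G\<^esub> h \<otimes>\<^bsub>G\<^esub> g)) =
              x l \<otimes>\<^bsub>R\<^esub> (y \<otimes>\<^bsub>?A\<^esub> z) (inv\<^bsub>G\<^esub> l \<otimes>\<^bsub>G\<^esub> g)"
            unfolding mult[OF closed[OF l g]] .
        qed (use g mem[OF mult_closed[OF xyz(2,3)]] in \<open>auto intro!: R.m_closed mems simp del: group_algebra_sel\<close>)
        also have "\<dots> = (x \<otimes>\<^bsub>?A\<^esub> (y \<otimes>\<^bsub>?A\<^esub> z)) g"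
          by (rule mult[OF g, symmetric])
        finally show "(x \<otimes>\<^bsub>?A\<^esub> y \<otimes>\<^bsub>?A\<^esub> z) g = (x \<otimes>\<^bsub>?A\<^esub> (y \<otimes>\<^bsub>?A\<^esub> z)) g" .
      qed (use mult_closed xyz in \<open>simp_all only: group_algebra_sel(1)\<close>)
    next
      fix x assume x: "x \<in> carrier ?A"
      show "\<one>\<^bsub>?A\<^esub> \<otimes>\<^bsub>?A\<^esub> x = x"
      proof (rule PiE_ext[of _ ?C "\<lambda>_. carrier R"])
        fix g assume g: "g \<in> ?C"
        have "(\<Oplus>\<^bsub>R\<^esub>h\<in>?C. \<one>\<^bsub>?A\<^esub> h \<otimes>\<^bsub>R\<^esub> x (inv\<^bsub>G\<^esub> h \<otimes>\<^bsub>G\<^esub> g)) = \<one>\<^bsub>?A\<^esub> \<one>\<^bsub>G\<^esub> \<otimes>\<^bsub>R\<^esub> x (inv\<^bsub>G\<^esub> \<one>\<^bsub>G\<^esub> \<otimes>\<^bsub>G\<^esub> g)"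
          using g by (intro R.finsum_delta) (auto simp: free_basis_def assms(3) mem[OF x])
        then show "(\<one>\<^bsub>?A\<^esub> \<otimes>\<^bsub>?A\<^esub> x) g = x g"
          using g mem[OF x g] by (simp add: free_basis_def)
      qed (use mult_closed[OF one_closed x] x in \<open>simp_all only: group_algebra_sel(1)\<close>)
      show "x \<otimes>\<^bsub>?A\<^esub> \<one>\<^bsub>?A\<^esub> = x"
      proof (rule PiE_ext[of _ ?C "\<lambda>_. carrier R"])
        fix g assume g: "g \<in> ?C"
        have neq: "inv\<^bsub>G\<^esub> h \<otimes>\<^bsub>G\<^esub> g \<noteq> \<one>\<^bsub>G\<^esub>" if "h \<in> ?C" "h \<noteq> g" for h
          using that g by (metis G.inv_closed G.inv_equality G.inv_inv)
        have "(\<Oplus>\<^bsub>R\<^esub>h\<in>?C. x h \<otimes>\<^bsub>R\<^esub> \<one>\<^bsub>?A\<^esub> (inv\<^bsub>G\<^esub> h \<otimes>\<^bsub>G\<^esub> g)) = x g \<otimes>\<^bsub>R\<^esub> \<one>\<^bsub>?A\<^esub> (inv\<^bsub>G\<^esub> g \<otimes>\<^bsub>G\<^esub> g)"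
          using g neq by (intro R.finsum_delta) (auto simp: free_basis_def assms(3) mem[OF x])
        then show "(x \<otimes>\<^bsub>?A\<^esub> \<one>\<^bsub>?A\<^esub>) g = x g"
          using g mem[OF x g] by (simp add: free_basis_def)
      qed (use mult_closed[OF x one_closed] x in \<open>simp_all only: group_algebra_sel(1)\<close>)
    qed (rule mult_closed one_closed; assumption)+
  next
    fix x y z assume xyz: "x \<in> carrier ?A" "y \<in> carrier ?A" "z \<in> carrier ?A"
    note mems = mem[OF xyz(1)] mem[OF xyz(2)] mem[OF xyz(3)]
    show "(x \<oplus>\<^bsub>?A\<^esub> y) \<otimes>\<^bsub>?A\<^esub> z = x \<otimes>\<^bsub>?A\<^esub> z \<oplus>\<^bsub>?A\<^esub> y \<otimes>\<^bsub>?A\<^esub> z"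
    proof (rule PiE_ext[of _ ?C "\<lambda>_. carrier R"])
      fix g assume g: "g \<in> ?C"
      have "((x \<oplus>\<^bsub>?A\<^esub> y) \<otimes>\<^bsub>?A\<^esub> z) g =
         (\<Oplus>\<^bsub>R\<^esub>h\<in>?C. x h \<otimes>\<^bsub>R\<^esub> z (inv\<^bsub>G\<^esub> h \<otimes>\<^bsub>G\<^esub> g) \<oplus>\<^bsub>R\<^esub> y h \<otimes>\<^bsub>R\<^esub> z (inv\<^bsub>G\<^esub> h \<otimes>\<^bsub>G\<^esub> g))"
        unfolding mult[OF g] by (intro R.finsum_cong') (auto simp: g R.l_distr mems)
      also have "\<dots> = (\<Oplus>\<^bsub>R\<^esub>h\<in>?C. x h \<otimes>\<^bsub>R\<^esub> z (inv\<^bsub>G\<^esub> h \<otimes>\<^bsub>G\<^esub> g)) \<oplus>\<^bsub>R\<^esub> (\<Oplus>\<^bsub>R\<^esub>h\<in>?C. y h \<otimes>\<^bsub>R\<^esub> z (inv\<^bsub>G\<^esub> h \<otimes>\<^bsub>G\<^esub> g))"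
        by (intro R.finsum_addf) (auto simp: g intro!: R.m_closed mems)
      finally show "((x \<oplus>\<^bsub>?A\<^esub> y) \<otimes>\<^bsub>?A\<^esub> z) g = (x \<otimes>\<^bsub>?A\<^esub> z \<oplus>\<^bsub>?A\<^esub> y \<otimes>\<^bsub>?A\<^esub> z) g"
        using g by simp
    qed (unfold group_algebra_sel(1)[symmetric], (intro mult_closed add_closed xyz)+)
    show "z \<otimes>\<^bsub>?A\<^esub> (x \<oplus>\<^bsub>?A\<^esub> y) = z \<otimes>\<^bsub>?A\<^esub> x \<oplus>\<^bsub>?A\<^esub> z \<otimes>\<^bsub>?A\<^esub> y"
    proof (rule PiE_ext[of _ ?C "\<lambda>_. carrier R"])
      fix g assume g: "g \<in> ?C"
      have "(z \<otimes>\<^bsub>?A\<^esub> (x \<oplus>\<^bsub>?A\<^esub> y)) g =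
         (\<Oplus>\<^bsub>R\<^esub>h\<in>?C. z h \<otimes>\<^bsub>R\<^esub> x (inv\<^bsub>G\<^esub> h \<otimes>\<^bsub>G\<^esub> g) \<oplus>\<^bsub>R\<^esub> z h \<otimes>\<^bsub>R\<^esub> y (inv\<^bsub>G\<^esub> h \<otimes>\<^bsub>G\<^esub> g))"
        unfolding mult[OF g] by (intro R.finsum_cong') (auto simp: g R.r_distr mems)
      also have "\<dots> = (\<Oplus>\<^bsub>R\<^esub>h\<in>?C. z h \<otimes>\<^bsub>R\<^esub> x (inv\<^bsub>G\<^esub> h \<otimes>\<^bsub>G\<^esub> g)) \<oplus>\<^bsub>R\<^esub> (\<Oplus>\<^bsub>R\<^esub>h\<in>?C. z h \<otimes>\<^bsub>R\<^esub> y (inv\<^bsub>G\<^esub> h \<otimes>\<^bsub>G\<^esub> g))"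
        by (intro R.finsum_addf) (auto simp: g intro!: R.m_closed mems)
      finally show "(z \<otimes>\<^bsub>?A\<^esub> (x \<oplus>\<^bsub>?A\<^esub> y)) g = (z \<otimes>\<^bsub>?A\<^esub> x \<oplus>\<^bsub>?A\<^esub> z \<otimes>\<^bsub>?A\<^esub> y) g"
        using g by simp
    qed (unfold group_algebra_sel(1)[symmetric], (intro mult_closed add_closed xyz)+)
  next
    fix a x y assume a: "a \<in> carrier R" and xy: "x \<in> carrier ?A" "y \<in> carrier ?A"
    note mems = mem[OF xy(1)] mem[OF xy(2)]
    show "(a \<odot>\<^bsub>?A\<^esub> x) \<otimes>\<^bsub>?A\<^esub> y = a \<odot>\<^bsub>?A\<^esub> (x \<otimes>\<^bsub>?A\<^esub> y)"
    proof (rule PiE_ext[of _ ?C "\<lambda>_. carrier R"])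
      fix g assume g: "g \<in> ?C"
      have "((a \<odot>\<^bsub>?A\<^esub> x) \<otimes>\<^bsub>?A\<^esub> y) g = (\<Oplus>\<^bsub>R\<^esub>h\<in>?C. a \<otimes>\<^bsub>R\<^esub> (x h \<otimes>\<^bsub>R\<^esub> y (inv\<^bsub>G\<^esub> h \<otimes>\<^bsub>G\<^esub> g)))"
        unfolding mult[OF g] by (intro R.finsum_cong') (auto simp: g a R.m_assoc mems)
      also have "\<dots> = a \<otimes>\<^bsub>R\<^esub> (\<Oplus>\<^bsub>R\<^esub>h\<in>?C. x h \<otimes>\<^bsub>R\<^esub> y (inv\<^bsub>G\<^esub> h \<otimes>\<^bsub>G\<^esub> g))"
        by (rule R.finsum_rdistr[symmetric]) (auto simp: g a assms(3) intro!: R.m_closed mems)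
      finally show "((a \<odot>\<^bsub>?A\<^esub> x) \<otimes>\<^bsub>?A\<^esub> y) g = (a \<odot>\<^bsub>?A\<^esub> (x \<otimes>\<^bsub>?A\<^esub> y)) g"
        using g by simp
    qed (unfold group_algebra_sel(1)[symmetric], (intro mult_closed smult_closed xy a)+)
    show "x \<otimes>\<^bsub>?A\<^esub> (a \<odot>\<^bsub>?A\<^esub> y) = a \<odot>\<^bsub>?A\<^esub> (x \<otimes>\<^bsub>?A\<^esub> y)"
    proof (rule PiE_ext[of _ ?C "\<lambda>_. carrier R"])
      fix g assume g: "g \<in> ?C"
      have "(x \<otimes>\<^bsub>?A\<^esub> (a \<odot>\<^bsub>?A\<^esub> y)) g = (\<Oplus>\<^bsub>R\<^esub>h\<in>?C. a \<otimes>\<^bsub>R\<^esub> (x h \<otimes>\<^bsub>R\<^esub> y (inv\<^bsub>G\<^esub> h \<otimes>\<^bsub>G\<^esub> g)))"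
        unfolding mult[OF g] by (intro R.finsum_cong') (auto simp: g a R.m_lcomm mems)
      also have "\<dots> = a \<otimes>\<^bsub>R\<^esub> (\<Oplus>\<^bsub>R\<^esub>h\<in>?C. x h \<otimes>\<^bsub>R\<^esub> y (inv\<^bsub>G\<^esub> h \<otimes>\<^bsub>G\<^esub> g))"
        by (rule R.finsum_rdistr[symmetric]) (auto simp: g a assms(3) intro!: R.m_closed mems)
      finally show "(x \<otimes>\<^bsub>?A\<^esub> (a \<odot>\<^bsub>?A\<^esub> y)) g = (a \<odot>\<^bsub>?A\<^esub> (x \<otimes>\<^bsub>?A\<^esub> y)) g"
        using g by simp
    qed (unfold group_algebra_sel(1)[symmetric], (intro mult_closed smult_closed xy a)+)
  qed
qed


text \<open>Associativity, unit laws and distributivity in \<open>A\<close> are pulled back from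
  \<open>B\<close> along the injective map. For the matrix Brauer category this replaces a direct
  verification of the axioms for a multiplication defined by factorising diagrams.\<close>

lemma algebra_iso_transport:
  assumes A: "module R A" and B: "associative_algebra R B" and bij: "bij_betw \<phi> (carrier A) (carrier B)"
    and add: "\<And>x y. x \<in> carrier A \<Longrightarrow> y \<in> carrier A \<Longrightarrow> \<phi> (x \<oplus>\<^bsub>A\<^esub> y) = \<phi> x \<oplus>\<^bsub>B\<^esub> \<phi> y"
    and smult: "\<And>a x. a \<in> carrier R \<Longrightarrow> x \<in> carrier A \<Longrightarrow> \<phi> (a \<odot>\<^bsub>A\<^esub> x) = a \<odot>\<^bsub>B\<^esub> \<phi> x"
    and closed: "\<And>x y. x \<in> carrier A \<Longrightarrow> y \<in> carrier A \<Longrightarrow> x \<otimes>\<^bsub>A\<^esub> y \<in> carrier A" "\<one>\<^bsub>A\<^esub> \<in> carrier A"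
    and mult: "\<And>x y. x \<in> carrier A \<Longrightarrow> y \<in> carrier A \<Longrightarrow> \<phi> (x \<otimes>\<^bsub>A\<^esub> y) = \<phi> x \<otimes>\<^bsub>B\<^esub> \<phi> y"
    and one: "\<phi> \<one>\<^bsub>A\<^esub> = \<one>\<^bsub>B\<^esub>"
  shows "algebra_iso R A B \<phi>"
proof -
  interpret A: module R A by (rule A)
  interpret B: associative_algebra R B by (rule B)
  have img: "\<phi> x \<in> carrier B" if "x \<in> carrier A" for x
    using bij that by (auto simp: bij_betw_def)
  have inj: "x = y" if "\<phi> x = \<phi> y" "x \<in> carrier A" "y \<in> carrier A" for x y
    using bij that by (auto simp: bij_betw_def dest: inj_onD)
  note hom = add smult mult one and mem = closed img A.M.a_closed A.smult_closed
  have "associative_algebra R A"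
  proof (rule associative_algebraI[OF A])
    show "monoid A"
      by (rule monoidI; (rule inj)?) (simp_all add: hom mem B.m_assoc)
  qed (rule inj; simp add: hom mem B.l_distr B.r_distr B.smult_mult_left B.smult_mult_right)+
  moreover have "module_iso R A B \<phi>"
    unfolding module_iso_def using A B.module_axioms bij add smult by blast
  ultimately show ?thesis
    unfolding algebra_iso_def using B mult one by blast
qed

section \<open>Pointwise sums, ranks and counting\<close>

lemma finsum_pointwise:
  assumes "abelian_monoid M" "abelian_monoid R" "carrier M = S \<rightarrow>\<^sub>E carrier R"
    and "\<zero>\<^bsub>M\<^esub> = (\<lambda>s\<in>S. \<zero>\<^bsub>R\<^esub>)" "\<And>x y. x \<oplus>\<^bsub>M\<^esub> y = (\<lambda>s\<in>S. x s \<oplus>\<^bsub>R\<^esub> y s)"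
    and "\<And>l. l \<in> L \<Longrightarrow> F l \<in> carrier M" "s \<in> S"
  shows "(\<Oplus>\<^bsub>M\<^esub>l\<in>L. F l) s = (\<Oplus>\<^bsub>R\<^esub>l\<in>L. F l s)"
proof -
  interpret M: abelian_monoid M by fact
  interpret R: abelian_monoid R by fact
  have mem: "x s \<in> carrier R" if "x \<in> carrier M" for x
    using that assms(3,7) by auto
  show ?thesis
    using assms(6)
  \<comment> \<open>Over an infinite index set both sums have the default value zero.\<close>
  proof (induction L rule: infinite_finite_induct)
    case (insert l L)
    then show ?case
      using assms(5,7) mem by (simp add: M.finsum_insert R.finsum_insert Pi_def)
  qed (use assms(4,7) in simp_all)
qed

lemma finsum_free_module:
  assumes "cring R" "\<And>l. l \<in> L \<Longrightarrow> F l \<in> S \<rightarrow>\<^sub>E carrier R" "s \<in> S"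
  shows "(\<Oplus>\<^bsub>free_module R S\<^esub>l\<in>L. F l) s = (\<Oplus>\<^bsub>R\<^esub>l\<in>L. F l s)"
  using module_directD(3)[OF module_free_module[OF assms(1)]] assms
  by (intro finsum_pointwise) (auto simp: cring_def ring_def abelian_group_def)

lemma finsum_group_algebra:
  assumes "cring R" "group G" "finite (carrier G)"
    and "\<And>l. l \<in> L \<Longrightarrow> F l \<in> carrier G \<rightarrow>\<^sub>E carrier R" "g \<in> carrier G"
  shows "(\<Oplus>\<^bsub>group_algebra R G\<^esub>l\<in>L. F l) g = (\<Oplus>\<^bsub>R\<^esub>l\<in>L. F l g)"
  using module_directD(3)[OF associative_algebraD(1)[OF associative_algebra_group_algebra[OF assms(1-3)]]] assms
  by (intro finsum_pointwise) (auto simp: cring_def ring_def abelian_group_def)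

lemma free_of_rank_card:
  assumes "cring R" "finite S"
  shows "free_of_rank R (free_module R S) (card S)"
proof -
  obtain h where h: "bij_betw h {..<card S} S"
    using ex_bij_betw_nat_finite[OF assms(2)] by (auto simp: lessThan_atLeast0)
  define g where "g = inv_into {..<card S} h"
  have g: "g s < card S" "h (g s) = s" if "s \<in> S" for s
    using bij_betw_apply[OF bij_betw_inv_into[OF h] that] bij_betw_inv_into_right[OF h that] by (simp_all add: g_def)
  have h': "h i \<in> S" "g (h i) = i" if "i < card S" for i
    using bij_betw_apply[OF h, of i] bij_betw_inv_into_left[OF h, of i] that by (simp_all add: g_def)
  let ?\<phi> = "\<lambda>x. \<lambda>i\<in>{..<card S}. x (h i)"
  have "bij_betw ?\<phi> (S \<rightarrow>\<^sub>E carrier R) ({..<card S} \<rightarrow>\<^sub>E carrier R)"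
  proof (rule bij_betw_byWitness[of _ "\<lambda>y. \<lambda>s\<in>S. y (g s)"])
    show "\<forall>x\<in>S \<rightarrow>\<^sub>E carrier R. (\<lambda>s\<in>S. ?\<phi> x (g s)) = x"
    proof
      fix x assume "x \<in> S \<rightarrow>\<^sub>E carrier R"
      then show "(\<lambda>s\<in>S. ?\<phi> x (g s)) = x"
        using g by (intro PiE_ext[of _ S "\<lambda>_. carrier R" x]) auto
    qed
    show "\<forall>y\<in>{..<card S} \<rightarrow>\<^sub>E carrier R. ?\<phi> (\<lambda>s\<in>S. y (g s)) = y"
    proof
      fix y assume "y \<in> {..<card S} \<rightarrow>\<^sub>E carrier R"
      then show "?\<phi> (\<lambda>s\<in>S. y (g s)) = y"
        using h' by (intro PiE_ext[of _ "{..<card S}" "\<lambda>_. carrier R" y]) auto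
    qed
  qed (rule image_subsetI, use g h' in \<open>simp add: restrict_PiE_iff PiE_iff\<close>)+
  then have "module_iso R (free_module R S) (free_module R {..<card S}) ?\<phi>"
    using module_free_module[OF assms(1), of S] module_free_module[OF assms(1), of "{..<card S}"] h'
    by (auto simp: module_iso_def intro!: restrict_ext)
  then show ?thesis
    unfolding free_of_rank_def by blast
qed

lemma finite_sym_group: "finite (carrier (sym_group r))"
  by (simp add: sym_group_def finite_permutations)

lemma card_sym_group: "card (carrier (sym_group r)) = fact r"
  by (simp add: sym_group_def card_permutations)

lemma mono_count_fact: "mono_count p r * fact r = card (brauer_up r p)"
  using bij_betw_same_card[OF up_perm_bij[of r p]]
  by (simp add: card_cartesian_product card_sym_group mono_count_def)


section \<open>The canonical isomorphism\<close>

locale enumerated_diagrams =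
  fixes k :: "('k, 'm) ring_scheme" and e :: "nat \<Rightarrow> nat \<Rightarrow> diagram \<Rightarrow> nat"
  assumes k: "cring k" and e: "enumeration e"
begin

sublocale K: cring k by (rule k)

abbreviation sym_algebra :: "nat \<Rightarrow> ('k, (nat \<Rightarrow> nat) \<Rightarrow> 'k) module" where
  "sym_algebra r \<equiv> group_algebra k (sym_group r)"

section \<open>Diagrams in matrix coordinates\<close>

definition row :: "nat \<Rightarrow> nat \<Rightarrow> nat \<Rightarrow> diagram" where
  "row q r i = inv_into (brauer_up_mono r q) (e q r) i"

lemma e_bij: "bij_betw (e q r) (brauer_up_mono r q) {..<mono_count q r}"
  using e by (simp add: enumeration_def)

lemma row_bij: "bij_betw (row q r) {..<mono_count q r} (brauer_up_mono r q)"
  unfolding row_def using bij_betw_inv_into[OF e_bij] .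

lemma row_in: "i < mono_count q r \<Longrightarrow> row q r i \<in> brauer_up_mono r q"
  using row_bij by (auto simp: bij_betw_def)

lemma e_row: "i < mono_count q r \<Longrightarrow> e q r (row q r i) = i"
  unfolding row_def using bij_betw_inv_into_right[OF e_bij] by simp

lemma row_e: "a \<in> brauer_up_mono r q \<Longrightarrow> row q r (e q r a) = a"
  unfolding row_def using bij_betw_inv_into_left[OF e_bij] by simp

lemma e_less: "a \<in> brauer_up_mono r q \<Longrightarrow> e q r a < mono_count q r"
  using e_bij by (auto simp: bij_betw_def)

lemma row_eq_iff: "i < mono_count q r \<Longrightarrow> j < mono_count q r \<Longrightarrow> row q r i = row q r j \<longleftrightarrow> i = j"
  by (metis e_row)

definition basis_diagram :: "nat \<Rightarrow> nat \<Rightarrow> nat \<Rightarrow> nat \<Rightarrow> (nat \<Rightarrow> nat) \<Rightarrow> nat \<Rightarrow> diagram" where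
  "basis_diagram p q r i \<sigma> j = strand_diagram r (row q r i) \<sigma> (row p r j)"

definition coords :: "nat \<Rightarrow> nat \<Rightarrow> diagram \<Rightarrow> nat \<times> nat \<times> (nat \<Rightarrow> nat) \<times> nat" where
  "coords p q f = (THE (r, i, \<sigma>, j). i < mono_count q r \<and> \<sigma> \<in> carrier (sym_group r) \<and> j < mono_count p r \<and>
     f = basis_diagram p q r i \<sigma> j)"

lemma basis_diagram_in:
  "i < mono_count q r \<Longrightarrow> \<sigma> \<in> carrier (sym_group r) \<Longrightarrow> j < mono_count p r \<Longrightarrow> basis_diagram p q r i \<sigma> j \<in> brauer p q"
  unfolding basis_diagram_def by (intro strand_diagram_in row_in)

lemma basis_diagram_eq_iff:
  assumes "i < mono_count q r" "\<sigma> \<in> carrier (sym_group r)" "j < mono_count p r"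
    and "i' < mono_count q r'" "\<sigma>' \<in> carrier (sym_group r')" "j' < mono_count p r'"
  shows "basis_diagram p q r i \<sigma> j = basis_diagram p q r' i' \<sigma>' j' \<longleftrightarrow> r = r' \<and> i = i' \<and> \<sigma> = \<sigma>' \<and> j = j'"
proof
  assume "basis_diagram p q r i \<sigma> j = basis_diagram p q r' i' \<sigma>' j'"
  then have "r = r' \<and> row q r i = row q r' i' \<and> \<sigma> = \<sigma>' \<and> row p r j = row p r' j'"
    unfolding basis_diagram_def using assms by (intro strand_diagram_unique[of _ r q _ _ p _ r']) (auto intro: row_in)
  then show "r = r' \<and> i = i' \<and> \<sigma> = \<sigma>' \<and> j = j'"
    using assms row_eq_iff by blast
qed simp

lemma coords_basis_diagram:
  assumes "i < mono_count q r" "\<sigma> \<in> carrier (sym_group r)" "j < mono_count p r"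
  shows "coords p q (basis_diagram p q r i \<sigma> j) = (r, i, \<sigma>, j)"
  unfolding coords_def using assms basis_diagram_eq_iff[OF assms]
  by (intro the_equality) auto

lemma basis_diagram_exists:
  assumes "f \<in> brauer p q"
  obtains r i \<sigma> j where "i < mono_count q r" "\<sigma> \<in> carrier (sym_group r)" "j < mono_count p r"
    "f = basis_diagram p q r i \<sigma> j" "r \<preceq> p" "r \<preceq> q"
proof -
  obtain r a \<sigma> b where *: "a \<in> brauer_up_mono r q" "\<sigma> \<in> carrier (sym_group r)" "b \<in> brauer_up_mono r p"
    "f = strand_diagram r a \<sigma> b"
    using assms by (rule strand_diagram_exists)
  then show ?thesis
    using that[of "e q r a" r \<sigma> "e p r b"]
    by (simp add: basis_diagram_def e_less row_e up_mono_parity)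
qed

text \<open>Elements of the free module are coefficient functions, so the map is given on
  coefficients: an entry looks up the coefficient of the diagram with these coordinates. The values
  on basis diagrams, by which the isomorphism is prescribed, are recovered afterwards.\<close>

definition canonical :: "nat \<Rightarrow> nat \<Rightarrow> (diagram \<Rightarrow> 'k) \<Rightarrow> nat \<Rightarrow> nat \<times> nat \<Rightarrow> (nat \<Rightarrow> nat) \<Rightarrow> 'k" where
  "canonical p q x = (\<lambda>r\<in>{r. r \<preceq> p \<and> r \<preceq> q}. \<lambda>(i, j)\<in>{..<mono_count q r} \<times> {..<mono_count p r}.
     \<lambda>\<sigma>\<in>carrier (sym_group r). x (basis_diagram p q r i \<sigma> j))"

lemma canonical_apply:
  "r \<preceq> p \<Longrightarrow> r \<preceq> q \<Longrightarrow> i < mono_count q r \<Longrightarrow> j < mono_count p r \<Longrightarrow> \<sigma> \<in> carrier (sym_group r) \<Longrightarrow>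
    canonical p q x r (i, j) \<sigma> = x (basis_diagram p q r i \<sigma> j)"
  by (simp add: canonical_def)

abbreviation matrix_sum :: "nat \<Rightarrow> nat \<Rightarrow> ('k, nat \<Rightarrow> nat \<times> nat \<Rightarrow> (nat \<Rightarrow> nat) \<Rightarrow> 'k) module" where
  "matrix_sum p q \<equiv> direct_sum {r. r \<preceq> p \<and> r \<preceq> q}
     (\<lambda>r. matrix_module (sym_algebra r) (mono_count q r) (mono_count p r))"

lemma matrix_sum_ext:
  assumes "x \<in> carrier (matrix_sum p q)" "y \<in> carrier (matrix_sum p q)"
    and "\<And>r i j \<sigma>. r \<preceq> p \<Longrightarrow> r \<preceq> q \<Longrightarrow> i < mono_count q r \<Longrightarrow> j < mono_count p r \<Longrightarrow> \<sigma> \<in> carrier (sym_group r) \<Longrightarrow>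
      x r (i, j) \<sigma> = y r (i, j) \<sigma>"
  shows "x = y"
proof (rule PiE_ext)
  show x: "x \<in> (\<Pi>\<^sub>E r\<in>{r. r \<preceq> p \<and> r \<preceq> q}. carrier (matrix_module (sym_algebra r) (mono_count q r) (mono_count p r)))"
    and y: "y \<in> (\<Pi>\<^sub>E r\<in>{r. r \<preceq> p \<and> r \<preceq> q}. carrier (matrix_module (sym_algebra r) (mono_count q r) (mono_count p r)))"
    using assms by simp_all
  fix r assume r: "r \<in> {r. r \<preceq> p \<and> r \<preceq> q}"
  have xr: "x r \<in> {..<mono_count q r} \<times> {..<mono_count p r} \<rightarrow>\<^sub>E carrier (sym_algebra r)"
    and yr: "y r \<in> {..<mono_count q r} \<times> {..<mono_count p r} \<rightarrow>\<^sub>E carrier (sym_algebra r)"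
    using PiE_mem[OF x r] PiE_mem[OF y r] by simp_all
  show "x r = y r"
  proof (rule matrix_ext[OF xr yr])
    fix i j assume ij: "i \<in> {..<mono_count q r}" "j \<in> {..<mono_count p r}"
    then have "(i, j) \<in> {..<mono_count q r} \<times> {..<mono_count p r}" by simp
    from PiE_mem[OF xr this] PiE_mem[OF yr this]
    show "x r (i, j) = y r (i, j)"
      using assms(3) r ij by (intro PiE_ext[of _ "carrier (sym_group r)" "\<lambda>_. carrier k"]) auto
  qed
qed

lemma canonical_in: "x \<in> carrier (mB_hom k p q) \<Longrightarrow> canonical p q x \<in> carrier (matrix_sum p q)"
  unfolding canonical_def mB_hom_def by (auto intro!: basis_diagram_in PiE_mem[of x "brauer p q" "\<lambda>_. carrier k"])

lemma canonical_bij: "bij_betw (canonical p q) (carrier (mB_hom k p q)) (carrier (matrix_sum p q))"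
proof (rule bij_betw_byWitness)
  let ?\<psi> = "\<lambda>y. \<lambda>f\<in>brauer p q. case coords p q f of (r, i, \<sigma>, j) \<Rightarrow> y r (i, j) \<sigma>"
  have \<psi>_in: "?\<psi> y \<in> carrier (mB_hom k p q)" if y: "y \<in> carrier (matrix_sum p q)" for y
    unfolding mB_hom_def free_module_sel
  proof (rule restrict_PiE_iff[THEN iffD2], rule ballI)
    fix f assume "f \<in> brauer p q"
    then obtain r i \<sigma> j where f: "i < mono_count q r" "\<sigma> \<in> carrier (sym_group r)" "j < mono_count p r"
      "f = basis_diagram p q r i \<sigma> j" "r \<preceq> p" "r \<preceq> q"
      by (rule basis_diagram_exists)
    have "y r \<in> {..<mono_count q r} \<times> {..<mono_count p r} \<rightarrow>\<^sub>E (carrier (sym_group r) \<rightarrow>\<^sub>E carrier k)"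
      using y f(5,6) by (auto simp: PiE_def Pi_def)
    then have "y r (i, j) \<in> carrier (sym_group r) \<rightarrow>\<^sub>E carrier k"
      by (rule PiE_mem) (use f in simp)
    then show "(case coords p q f of (r, i, \<sigma>, j) \<Rightarrow> y r (i, j) \<sigma>) \<in> carrier k"
      using f(1-4) by (auto simp: coords_basis_diagram)
  qed
  show "\<forall>x\<in>carrier (mB_hom k p q). ?\<psi> (canonical p q x) = x"
  proof
    fix x assume x: "x \<in> carrier (mB_hom k p q)"
    show "?\<psi> (canonical p q x) = x"
    proof (rule PiE_ext)
      show "?\<psi> (canonical p q x) \<in> brauer p q \<rightarrow>\<^sub>E carrier k"
        using \<psi>_in[OF canonical_in[OF x]] by (simp only: mB_hom_def free_module_sel)
      show "x \<in> brauer p q \<rightarrow>\<^sub>E carrier k" using x by (simp add: mB_hom_def)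
      fix f assume f: "f \<in> brauer p q"
      then obtain r i \<sigma> j where "i < mono_count q r" "\<sigma> \<in> carrier (sym_group r)" "j < mono_count p r"
        "f = basis_diagram p q r i \<sigma> j" "r \<preceq> p" "r \<preceq> q"
        by (rule basis_diagram_exists)
      then show "?\<psi> (canonical p q x) f = x f"
        using f by (simp add: coords_basis_diagram canonical_apply)
    qed
  qed
  show "\<forall>y\<in>carrier (matrix_sum p q). canonical p q (?\<psi> y) = y"
  proof
    fix y assume y: "y \<in> carrier (matrix_sum p q)"
    show "canonical p q (?\<psi> y) = y"
      using canonical_in[OF \<psi>_in[OF y]] y
      by (rule matrix_sum_ext) (simp add: canonical_apply coords_basis_diagram basis_diagram_in)
  qed
  show "canonical p q ` carrier (mB_hom k p q) \<subseteq> carrier (matrix_sum p q)"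
    by (rule image_subsetI) (rule canonical_in)
  show "?\<psi> ` carrier (matrix_sum p q) \<subseteq> carrier (mB_hom k p q)"
    by (rule image_subsetI) (rule \<psi>_in)
qed

lemma group_algebra_sym: "associative_algebra k (sym_algebra r)"
  by (rule associative_algebra_group_algebra[OF k sym_group_is_group finite_sym_group])

lemma module_matrix_sum: "module k (matrix_sum p q)"
  by (rule module_direct_sum[OF k module_matrix_module[OF associative_algebraD(1)[OF group_algebra_sym]]])

lemma module_mB_hom: "module k (mB_hom k p q)"
  unfolding mB_hom_def by (rule module_free_module[OF k])

lemma canonical_add:
  assumes "x \<in> carrier (mB_hom k p q)" "y \<in> carrier (mB_hom k p q)"
  shows "canonical p q (x \<oplus>\<^bsub>mB_hom k p q\<^esub> y) = canonical p q x \<oplus>\<^bsub>matrix_sum p q\<^esub> canonical p q y"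
proof (rule matrix_sum_ext)
  show "canonical p q (x \<oplus>\<^bsub>mB_hom k p q\<^esub> y) \<in> carrier (matrix_sum p q)"
    using assms abelian_monoid.a_closed[OF module_directD(3)[OF module_mB_hom]] by (intro canonical_in)
  show "canonical p q x \<oplus>\<^bsub>matrix_sum p q\<^esub> canonical p q y \<in> carrier (matrix_sum p q)"
    using assms by (intro abelian_monoid.a_closed[OF module_directD(3)[OF module_matrix_sum]] canonical_in)
qed (simp add: canonical_apply mB_hom_def basis_diagram_in)

lemma canonical_smult:
  assumes "a \<in> carrier k" "x \<in> carrier (mB_hom k p q)"
  shows "canonical p q (a \<odot>\<^bsub>mB_hom k p q\<^esub> x) = a \<odot>\<^bsub>matrix_sum p q\<^esub> canonical p q x"
proof (rule matrix_sum_ext)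
  show "canonical p q (a \<odot>\<^bsub>mB_hom k p q\<^esub> x) \<in> carrier (matrix_sum p q)"
    using assms module.smult_closed[OF module_mB_hom] by (intro canonical_in)
  show "a \<odot>\<^bsub>matrix_sum p q\<^esub> canonical p q x \<in> carrier (matrix_sum p q)"
    using assms by (intro module.smult_closed[OF module_matrix_sum] canonical_in)
qed (simp add: canonical_apply mB_hom_def basis_diagram_in)

lemma canonical_module_iso: "module_iso k (mB_hom k p q) (matrix_sum p q) (canonical p q)"
  unfolding module_iso_def
  using module_mB_hom module_matrix_sum canonical_bij canonical_add canonical_smult by blast

lemma free_basis_in: "free_basis k S s \<in> S \<rightarrow>\<^sub>E carrier k"
  by (auto simp: free_basis_def)

text \<open>Both sides are delta functions. By uniqueness of the factorisation, the basis vector of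
  a diagram is supported at the one coordinate tuple of this diagram.\<close>

lemma canonical_canonical_on_basis: "canonical_on_basis k e p q (canonical p q)"
  unfolding canonical_on_basis_def
proof (intro allI impI, elim conjE)
  fix r fp \<sigma> fm
  assume r: "r \<preceq> p" "r \<preceq> q" and fp: "fp \<in> brauer_up_mono r q" and \<sigma>: "\<sigma> \<in> carrier (sym_group r)"
    and fm: "fm \<in> brauer_down_mono p r"
  define b where "b = flip fm"
  have b: "b \<in> brauer_up_mono r p" "fm = flip b"
    using fm flip_up_mono[of b p r] by (simp_all add: b_def)
  let ?f = "basis_diagram p q r (e q r fp) \<sigma> (e p r b)"
  have f: "fp \<bullet> perm_diagram r \<sigma> \<bullet> fm = ?f"
    using fp b by (simp add: basis_diagram_def strand_diagram_def row_e)
  let ?I = "{r. r \<preceq> p \<and> r \<preceq> q}"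
  let ?M = "\<lambda>r. matrix_module (sym_algebra r) (mono_count q r) (mono_count p r)"
  have "canonical p q (free_basis k (brauer p q) ?f) =
    summand_embed ?I ?M r (matrix_single (sym_algebra r) (mono_count q r) (mono_count p r)
      (e q r fp) (e p r b) (free_basis k (carrier (sym_group r)) \<sigma>))" (is "_ = ?R")
  proof (rule matrix_sum_ext)
    show "canonical p q (free_basis k (brauer p q) ?f) \<in> carrier (matrix_sum p q)"
      by (rule canonical_in) (simp add: mB_hom_def free_basis_in)
    show "?R \<in> carrier (matrix_sum p q)"
      using free_basis_in[of "carrier (sym_group r)" \<sigma>] K.zero_closed
      by (auto simp: summand_embed_def matrix_single_def)
    fix s i j \<tau> assume s: "s \<preceq> p" "s \<preceq> q" "i < mono_count q s" "j < mono_count p s" "\<tau> \<in> carrier (sym_group s)"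
    have "basis_diagram p q s i \<tau> j = ?f \<longleftrightarrow> s = r \<and> i = e q r fp \<and> \<tau> = \<sigma> \<and> j = e p r b"
      using s fp b \<sigma> by (intro basis_diagram_eq_iff) (auto intro: e_less)
    then show "canonical p q (free_basis k (brauer p q) ?f) s (i, j) \<tau> = ?R s (i, j) \<tau>"
      using s by (auto simp: canonical_apply free_basis_def basis_diagram_in summand_embed_def matrix_single_def)
  qed
  then show "canonical p q (free_basis k (brauer p q) (fp \<bullet> perm_diagram r \<sigma> \<bullet> fm)) =
    summand_embed ?I ?M r (matrix_single (sym_algebra r) (mono_count q r) (mono_count p r)
      (e q r fp) (e p r (flip fm)) (free_basis k (carrier (sym_group r)) \<sigma>))"
    by (simp only: f b_def)
qed

section \<open>Composition and identity in matrix coordinates\<close>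

lemma mB_basis_comp_basis_diagram:
  assumes "i < mono_count p r" "\<sigma> \<in> carrier (sym_group r)" "l < mono_count p r"
    and "l' < mono_count p s" "\<tau> \<in> carrier (sym_group s)" "j < mono_count p s"
  shows "mB_basis_comp p p p (basis_diagram p p r i \<sigma> l) (basis_diagram p p s l' \<tau> j) =
     (if r = s \<and> l = l' then Some (basis_diagram p p r i (\<sigma> \<circ> \<tau>) j) else None)"
proof -
  have "mB_basis_comp p p p (basis_diagram p p r i \<sigma> l) (basis_diagram p p s l' \<tau> j) =
     (if r = s \<and> row p r l = row p s l' then Some (strand_diagram r (row p r i) (\<sigma> \<circ> \<tau>) (row p s j)) else None)"
    unfolding basis_diagram_def using assms by (intro mB_basis_comp_strand_diagram) (auto intro: row_in)
  then show ?thesis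
    using assms row_eq_iff by (auto simp: basis_diagram_def)
qed

lemma sym_mult_closed: "\<sigma> \<in> carrier (sym_group r) \<Longrightarrow> \<tau> \<in> carrier (sym_group r) \<Longrightarrow> \<sigma> \<circ> \<tau> \<in> carrier (sym_group r)"
  by (simp add: sym_group_carrier permutes_compose)

text \<open>A pair of diagrams with the given composite is determined by the inner index
  \<open>l\<close> and the permutation \<alpha> of the left factor; the permutation of the right
  factor must then be the inverse of \<alpha> times \<sigma>. The resulting double sum is an entry
  of a matrix product over the group algebra, written out by coefficients.\<close>

lemma mB_comp_basis_diagram:
  assumes x: "x \<in> carrier (mB_hom k p p)" and y: "y \<in> carrier (mB_hom k p p)"
    and i: "i < mono_count p r" and \<sigma>: "\<sigma> \<in> carrier (sym_group r)" and j: "j < mono_count p r"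
  shows "mB_comp k p p p x y (basis_diagram p p r i \<sigma> j) =
    (\<Oplus>\<^bsub>k\<^esub>l\<in>{..<mono_count p r}. \<Oplus>\<^bsub>k\<^esub>\<alpha>\<in>carrier (sym_group r).
       x (basis_diagram p p r i \<alpha> l) \<otimes>\<^bsub>k\<^esub> y (basis_diagram p p r l (inv\<^bsub>sym_group r\<^esub> \<alpha> \<otimes>\<^bsub>sym_group r\<^esub> \<sigma>) j))"
proof -
  interpret G: group "sym_group r" by (rule sym_group_is_group)
  let ?S = "carrier (sym_group r)" and ?h = "basis_diagram p p r i \<sigma> j"
  let ?\<beta> = "\<lambda>\<alpha>. inv\<^bsub>sym_group r\<^esub> \<alpha> \<otimes>\<^bsub>sym_group r\<^esub> \<sigma>"
  let ?T = "{fg \<in> brauer p p \<times> brauer p p. mB_basis_comp p p p (fst fg) (snd fg) = Some ?h}"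
  define g where "g = (\<lambda>(l, \<alpha>). (basis_diagram p p r i \<alpha> l, basis_diagram p p r l (?\<beta> \<alpha>) j))"
  have \<beta>: "?\<beta> \<alpha> \<in> ?S" "\<alpha> \<circ> ?\<beta> \<alpha> = \<sigma>" if "\<alpha> \<in> ?S" for \<alpha>
  proof -
    show "?\<beta> \<alpha> \<in> ?S" by (intro G.m_closed G.inv_closed that \<sigma>)
    have "\<alpha> \<otimes>\<^bsub>sym_group r\<^esub> ?\<beta> \<alpha> = \<sigma>" using that \<sigma> G.inv_closed[OF that] by (metis G.m_assoc G.r_inv G.l_one)
    then show "\<alpha> \<circ> ?\<beta> \<alpha> = \<sigma>" by (simp add: sym_group_mult)
  qed
  have "bij_betw g ({..<mono_count p r} \<times> ?S) ?T"
  proof (rule bij_betw_imageI)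
    show "inj_on g ({..<mono_count p r} \<times> ?S)"
    proof (rule inj_onI, clarify)
      fix l \<alpha> l' \<alpha>' assume *: "l < mono_count p r" "l' < mono_count p r" "\<alpha> \<in> ?S" "\<alpha>' \<in> ?S" "g (l, \<alpha>) = g (l', \<alpha>')"
      then have "basis_diagram p p r i \<alpha> l = basis_diagram p p r i \<alpha>' l'" by (simp add: g_def)
      then show "l = l' \<and> \<alpha> = \<alpha>'"
        using * i by (simp add: basis_diagram_eq_iff)
    qed
    show "g ` ({..<mono_count p r} \<times> ?S) = ?T"
    proof (intro equalityI subsetI)
      fix fg assume "fg \<in> g ` ({..<mono_count p r} \<times> ?S)"
      then obtain l \<alpha> where "l < mono_count p r" "\<alpha> \<in> ?S" "fg = g (l, \<alpha>)" by auto
      then show "fg \<in> ?T"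
        using i j \<beta> by (simp add: g_def basis_diagram_in mB_basis_comp_basis_diagram)
    next
      fix fg assume fg: "fg \<in> ?T"
      then obtain f g' where fg': "fg = (f, g')" "f \<in> brauer p p" "g' \<in> brauer p p"
        "mB_basis_comp p p p f g' = Some ?h" by auto
      obtain s i' \<alpha> l where f: "i' < mono_count p s" "\<alpha> \<in> carrier (sym_group s)" "l < mono_count p s"
        "f = basis_diagram p p s i' \<alpha> l"
        using fg'(2) by (rule basis_diagram_exists)
      obtain t l' \<tau> j' where g': "l' < mono_count p t" "\<tau> \<in> carrier (sym_group t)" "j' < mono_count p t"
        "g' = basis_diagram p p t l' \<tau> j'"
        using fg'(3) by (rule basis_diagram_exists)
      have st: "s = t" "l = l'" and eq: "basis_diagram p p s i' (\<alpha> \<circ> \<tau>) j' = ?h"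
        using fg'(4) unfolding f(4) g'(4) mB_basis_comp_basis_diagram[OF f(1-3) g'(1-3)]
        by (auto split: if_splits)
      have "\<alpha> \<circ> \<tau> \<in> carrier (sym_group s)" using f(2) g'(2) st by (simp add: sym_mult_closed)
      then have "s = r \<and> i' = i \<and> \<alpha> \<circ> \<tau> = \<sigma> \<and> j' = j"
        using eq basis_diagram_eq_iff[of i' p s "\<alpha> \<circ> \<tau>" j' p i r \<sigma> j] f g' st i j \<sigma> by simp
      moreover from this have "\<tau> = ?\<beta> \<alpha>"
        using f(2) g'(2) st G.inv_solve_left[of \<tau> \<alpha> \<sigma>] \<sigma> by (simp add: sym_group_mult)
      ultimately have "fg = g (l, \<alpha>)" "l < mono_count p r" "\<alpha> \<in> ?S"
        using fg' f g' st by (auto simp: g_def)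
      then show "fg \<in> g ` ({..<mono_count p r} \<times> ?S)" by auto
    qed
  qed
  note reindex = K.finsum_reindex_bij[OF this]
  have mem: "x f \<in> carrier k" "y f \<in> carrier k" if "f \<in> brauer p p" for f
    using that x y by (auto simp: mB_hom_def)
  have "mB_comp k p p p x y ?h = (\<Oplus>\<^bsub>k\<^esub>fg\<in>?T. x (fst fg) \<otimes>\<^bsub>k\<^esub> y (snd fg))"
    using basis_diagram_in[OF i \<sigma> j] by (simp add: mB_comp_def)
  also have "\<dots> = (\<Oplus>\<^bsub>k\<^esub>z\<in>{..<mono_count p r} \<times> ?S. x (fst (g z)) \<otimes>\<^bsub>k\<^esub> y (snd (g z)))"
    by (rule reindex) (auto simp: mem)
  also have "\<dots> = (\<Oplus>\<^bsub>k\<^esub>l\<in>{..<mono_count p r}. \<Oplus>\<^bsub>k\<^esub>\<alpha>\<in>?S. x (fst (g (l, \<alpha>))) \<otimes>\<^bsub>k\<^esub> y (snd (g (l, \<alpha>))))"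
    using \<beta> i j by (intro K.finsum_product) (auto simp: finite_sym_group g_def intro!: mem basis_diagram_in K.m_closed)
  finally show ?thesis by (simp add: g_def)
qed

lemma mB_comp_in:
  assumes "x \<in> carrier (mB_hom k p p)" "y \<in> carrier (mB_hom k p p)"
  shows "mB_comp k p p p x y \<in> carrier (mB_hom k p p)"
  using assms unfolding mB_comp_def mB_hom_def by (auto intro!: K.finsum_closed K.m_closed)

lemma finite_parity: "finite {r. r \<preceq> p}"
  by (rule finite_subset[of _ "{..p}"]) (auto simp: parity_le_def)

lemma mB_id_in: "mB_id k p \<in> carrier (mB_hom k p p)"
proof -
  interpret M: module k "mB_hom k p p" by (rule module_mB_hom)
  show ?thesis
    unfolding mB_id_def by (intro M.M.finsum_closed funcsetI) (simp_all add: mB_hom_def free_basis_in)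
qed

text \<open>\<open>f \<bullet> flip f\<close> is the basis diagram with row and column
  \<open>f\<close> and trivial permutation. Hence at a given diagram at most one term of the double
  sum in \<open>mB_id\<close> can be nonzero.\<close>

lemma mB_id_basis_diagram:
  assumes "i < mono_count p r" "\<sigma> \<in> carrier (sym_group r)" "j < mono_count p r" "r \<preceq> p"
  shows "mB_id k p (basis_diagram p p r i \<sigma> j) = (if \<sigma> = id \<and> i = j then \<one>\<^bsub>k\<^esub> else \<zero>\<^bsub>k\<^esub>)"
proof -
  let ?h = "basis_diagram p p r i \<sigma> j"
  interpret M: module k "mB_hom k p p" by (rule module_mB_hom)
  have h: "?h \<in> brauer p p" using assms by (intro basis_diagram_in)
  let ?F = "\<lambda>f. free_basis k (brauer p p) (f \<bullet> flip f)"
  have F_in: "?F f \<in> brauer p p \<rightarrow>\<^sub>E carrier k" for f by (rule free_basis_in)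
  have sum_in: "(\<Oplus>\<^bsub>mB_hom k p p\<^esub>f\<in>brauer_up_mono s p. ?F f) \<in> brauer p p \<rightarrow>\<^sub>E carrier k" for s
  proof -
    have "(\<Oplus>\<^bsub>mB_hom k p p\<^esub>f\<in>brauer_up_mono s p. ?F f) \<in> carrier (mB_hom k p p)"
      by (intro M.M.finsum_closed funcsetI) (simp add: mB_hom_def F_in)
    then show ?thesis by (simp add: mB_hom_def)
  qed
  have F: "?F f ?h = (if s = r \<and> f = row p r i \<and> \<sigma> = id \<and> i = j then \<one>\<^bsub>k\<^esub> else \<zero>\<^bsub>k\<^esub>)"
    if f: "f \<in> brauer_up_mono s p" for s f
  proof -
    have id: "id \<in> carrier (sym_group s)" by (simp add: sym_group_carrier permutes_id)
    have "f \<bullet> flip f = basis_diagram p p s (e p s f) id (e p s f)"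
      using f by (simp add: basis_diagram_def strand_diagram_def row_e up_concat_id)
    moreover have "?h = basis_diagram p p s (e p s f) id (e p s f) \<longleftrightarrow>
        r = s \<and> i = e p s f \<and> \<sigma> = id \<and> j = e p s f"
      using assms f id by (intro basis_diagram_eq_iff) (auto intro: e_less)
    moreover have "r = s \<and> i = e p s f \<and> \<sigma> = id \<and> j = e p s f \<longleftrightarrow> s = r \<and> f = row p r i \<and> \<sigma> = id \<and> i = j"
      using assms f by (auto simp: e_row row_e)
    ultimately show ?thesis using h by (simp add: free_basis_def)
  qed
  have "mB_id k p ?h = (\<Oplus>\<^bsub>k\<^esub>s\<in>{r. r \<preceq> p}. (\<Oplus>\<^bsub>mB_hom k p p\<^esub>f\<in>brauer_up_mono s p. ?F f) ?h)"
    unfolding mB_id_def using sum_in h unfolding mB_hom_def by (intro finsum_free_module[OF k]) auto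
  also have "\<dots> = (\<Oplus>\<^bsub>k\<^esub>s\<in>{r. r \<preceq> p}. \<Oplus>\<^bsub>k\<^esub>f\<in>brauer_up_mono s p. ?F f ?h)"
    unfolding mB_hom_def using F_in h
    by (intro K.finsum_cong' refl finsum_free_module[OF k]) (auto intro!: K.finsum_closed)
  also have "\<dots> = (\<Oplus>\<^bsub>k\<^esub>f\<in>brauer_up_mono r p. ?F f ?h)"
  proof (rule K.finsum_delta)
    show "r \<in> {r. r \<preceq> p}" using assms by simp
    fix s assume "s \<in> {r. r \<preceq> p}" "s \<noteq> r"
    then have "(\<Oplus>\<^bsub>k\<^esub>f\<in>brauer_up_mono s p. ?F f ?h) = (\<Oplus>\<^bsub>k\<^esub>f\<in>brauer_up_mono s p. \<zero>\<^bsub>k\<^esub>)"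
      using F by (intro K.finsum_cong') auto
    then show "(\<Oplus>\<^bsub>k\<^esub>f\<in>brauer_up_mono s p. ?F f ?h) = \<zero>\<^bsub>k\<^esub>"
      by (simp add: K.finsum_zero)
  qed (use F_in h finite_parity in \<open>auto intro!: K.finsum_closed\<close>)
  also have "\<dots> = ?F (row p r i) ?h"
    using F[of _ r] row_in[OF assms(1)] finite_brauer F_in h
    by (intro K.finsum_delta) (auto simp: brauer_up_mono_def)
  also have "\<dots> = (if \<sigma> = id \<and> i = j then \<one>\<^bsub>k\<^esub> else \<zero>\<^bsub>k\<^esub>)"
    using F[OF row_in[OF assms(1)]] by simp
  finally show ?thesis .
qed

abbreviation matrix_algebra_sum :: "nat \<Rightarrow> ('k, nat \<Rightarrow> nat \<times> nat \<Rightarrow> (nat \<Rightarrow> nat) \<Rightarrow> 'k) module" where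
  "matrix_algebra_sum p \<equiv> direct_sum {r. r \<preceq> p} (\<lambda>r. matrix_algebra (sym_algebra r) (mono_count p r))"

lemma matrix_algebra_sum_algebra: "associative_algebra k (matrix_algebra_sum p)"
  by (intro associative_algebra_direct_sum k associative_algebra_matrix group_algebra_sym)

lemma matrix_algebra_sum_module:
  "carrier (matrix_algebra_sum p) = carrier (matrix_sum p p)"
  "x \<oplus>\<^bsub>matrix_algebra_sum p\<^esub> y = x \<oplus>\<^bsub>matrix_sum p p\<^esub> y"
  "a \<odot>\<^bsub>matrix_algebra_sum p\<^esub> x = a \<odot>\<^bsub>matrix_sum p p\<^esub> x"
  by simp_all

lemma matrix_algebra_sum_mult:
  assumes "x \<in> carrier (matrix_algebra_sum p)" "y \<in> carrier (matrix_algebra_sum p)"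
    and "r \<preceq> p" "i < mono_count p r" "j < mono_count p r" "\<sigma> \<in> carrier (sym_group r)"
  shows "(x \<otimes>\<^bsub>matrix_algebra_sum p\<^esub> y) r (i, j) \<sigma> =
    (\<Oplus>\<^bsub>k\<^esub>l\<in>{..<mono_count p r}. \<Oplus>\<^bsub>k\<^esub>\<alpha>\<in>carrier (sym_group r).
       x r (i, l) \<alpha> \<otimes>\<^bsub>k\<^esub> y r (l, j) (inv\<^bsub>sym_group r\<^esub> \<alpha> \<otimes>\<^bsub>sym_group r\<^esub> \<sigma>))"
proof -
  interpret A: associative_algebra k "sym_algebra r" by (rule group_algebra_sym)
  have mem: "x r (i, j) \<in> carrier (sym_algebra r)" "y r (i, j) \<in> carrier (sym_algebra r)"
    if "i < mono_count p r" "j < mono_count p r" for i j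
    using assms(1-3) that by (auto simp: PiE_def Pi_def)
  have "(x \<otimes>\<^bsub>matrix_algebra_sum p\<^esub> y) r (i, j) \<sigma> =
    (\<Oplus>\<^bsub>sym_algebra r\<^esub>l\<in>{..<mono_count p r}. x r (i, l) \<otimes>\<^bsub>sym_algebra r\<^esub> y r (l, j)) \<sigma>"
    using assms(3-5) by simp
  also have "\<dots> = (\<Oplus>\<^bsub>k\<^esub>l\<in>{..<mono_count p r}. (x r (i, l) \<otimes>\<^bsub>sym_algebra r\<^esub> y r (l, j)) \<sigma>)"
  proof (rule finsum_group_algebra[OF k sym_group_is_group finite_sym_group])
    fix l assume "l \<in> {..<mono_count p r}"
    then have "x r (i, l) \<otimes>\<^bsub>sym_algebra r\<^esub> y r (l, j) \<in> carrier (sym_algebra r)"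
      using assms(4,5) by (intro A.m_closed mem) auto
    then show "x r (i, l) \<otimes>\<^bsub>sym_algebra r\<^esub> y r (l, j) \<in> carrier (sym_group r) \<rightarrow>\<^sub>E carrier k"
      by (simp only: group_algebra_sel)
  qed (rule assms)
  finally show ?thesis using assms(6) by simp
qed

lemma module_mB_algebra: "module k (mB_algebra k p)"
  unfolding mB_algebra_def by (rule module_cong[OF module_mB_hom[of p p]]) simp_all

lemma mB_algebra_sel:
  "carrier (mB_algebra k p) = carrier (mB_hom k p p)"
  "x \<oplus>\<^bsub>mB_algebra k p\<^esub> y = x \<oplus>\<^bsub>mB_hom k p p\<^esub> y"
  "a \<odot>\<^bsub>mB_algebra k p\<^esub> x = a \<odot>\<^bsub>mB_hom k p p\<^esub> x"
  "x \<otimes>\<^bsub>mB_algebra k p\<^esub> y = mB_comp k p p p x y"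
  "\<one>\<^bsub>mB_algebra k p\<^esub> = mB_id k p"
  by (simp_all add: mB_algebra_def)

text \<open>In coordinates the composition of diagrams and the product in the direct sum of matrix
  algebras are the same double sum, and the identities agree. That the source is an algebra at all
  follows by transport.\<close>

lemma canonical_algebra_iso: "algebra_iso k (mB_algebra k p) (matrix_algebra_sum p) (canonical p p)"
proof (rule algebra_iso_transport[OF module_mB_algebra matrix_algebra_sum_algebra])
  show "bij_betw (canonical p p) (carrier (mB_algebra k p)) (carrier (matrix_algebra_sum p))"
    unfolding mB_algebra_sel matrix_algebra_sum_module by (rule canonical_bij)
  interpret B: associative_algebra k "matrix_algebra_sum p" by (rule matrix_algebra_sum_algebra)
  fix x y assume "x \<in> carrier (mB_algebra k p)" "y \<in> carrier (mB_algebra k p)"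
  then have xy: "x \<in> carrier (mB_hom k p p)" "y \<in> carrier (mB_hom k p p)"
    by (simp_all only: mB_algebra_sel)
  show "canonical p p (x \<oplus>\<^bsub>mB_algebra k p\<^esub> y) = canonical p p x \<oplus>\<^bsub>matrix_algebra_sum p\<^esub> canonical p p y"
    unfolding mB_algebra_sel matrix_algebra_sum_module using xy by (rule canonical_add)
  show "x \<otimes>\<^bsub>mB_algebra k p\<^esub> y \<in> carrier (mB_algebra k p)"
    unfolding mB_algebra_sel using xy by (rule mB_comp_in)
  have c: "canonical p p x \<in> carrier (matrix_algebra_sum p)" "canonical p p y \<in> carrier (matrix_algebra_sum p)"
    unfolding matrix_algebra_sum_module by (rule canonical_in, rule xy)+
  show "canonical p p (x \<otimes>\<^bsub>mB_algebra k p\<^esub> y) = canonical p p x \<otimes>\<^bsub>matrix_algebra_sum p\<^esub> canonical p p y"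
    unfolding mB_algebra_sel
  proof (rule matrix_sum_ext)
    show "canonical p p (mB_comp k p p p x y) \<in> carrier (matrix_sum p p)"
      using xy by (intro canonical_in mB_comp_in)
    show "canonical p p x \<otimes>\<^bsub>matrix_algebra_sum p\<^esub> canonical p p y \<in> carrier (matrix_sum p p)"
      using B.m_closed[OF c] by (simp only: matrix_algebra_sum_module)
    fix r i j \<sigma>
    assume r: "r \<preceq> p" "r \<preceq> p" and ij: "i < mono_count p r" "j < mono_count p r" and \<sigma>: "\<sigma> \<in> carrier (sym_group r)"
    interpret G: group "sym_group r" by (rule sym_group_is_group)
    have mem: "x f \<in> carrier k" "y f \<in> carrier k" if "f \<in> brauer p p" for f
      using that xy by (auto simp: mB_hom_def)
    show "canonical p p (mB_comp k p p p x y) r (i, j) \<sigma> =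
        (canonical p p x \<otimes>\<^bsub>matrix_algebra_sum p\<^esub> canonical p p y) r (i, j) \<sigma>"
      unfolding canonical_apply[OF r ij \<sigma>] mB_comp_basis_diagram[OF xy ij(1) \<sigma> ij(2)]
        matrix_algebra_sum_mult[OF c r(1) ij \<sigma>]
    proof (intro K.finsum_cong' refl)
      fix l \<alpha> assume l: "l \<in> {..<mono_count p r}" and \<alpha>: "\<alpha> \<in> carrier (sym_group r)"
      then show "x (basis_diagram p p r i \<alpha> l) \<otimes>\<^bsub>k\<^esub>
            y (basis_diagram p p r l (inv\<^bsub>sym_group r\<^esub> \<alpha> \<otimes>\<^bsub>sym_group r\<^esub> \<sigma>) j) =
          canonical p p x r (i, l) \<alpha> \<otimes>\<^bsub>k\<^esub> canonical p p y r (l, j) (inv\<^bsub>sym_group r\<^esub> \<alpha> \<otimes>\<^bsub>sym_group r\<^esub> \<sigma>)"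
        using r ij \<sigma> G.m_closed[OF G.inv_closed[OF \<alpha>] \<sigma>]
        by (simp add: canonical_apply del: sym_group_inv_equality)
    qed (use r ij \<sigma> G.m_closed[OF G.inv_closed \<sigma>] in
        \<open>auto simp: canonical_apply simp del: sym_group_inv_equality intro!: K.finsum_closed K.m_closed mem basis_diagram_in\<close>)
  qed
next
  fix a x assume "a \<in> carrier k" "x \<in> carrier (mB_algebra k p)"
  then show "canonical p p (a \<odot>\<^bsub>mB_algebra k p\<^esub> x) = a \<odot>\<^bsub>matrix_algebra_sum p\<^esub> canonical p p x"
    unfolding mB_algebra_sel matrix_algebra_sum_module by (rule canonical_smult)
next
  show "\<one>\<^bsub>mB_algebra k p\<^esub> \<in> carrier (mB_algebra k p)"
    unfolding mB_algebra_sel by (rule mB_id_in)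
  interpret B: associative_algebra k "matrix_algebra_sum p" by (rule matrix_algebra_sum_algebra)
  show "canonical p p \<one>\<^bsub>mB_algebra k p\<^esub> = \<one>\<^bsub>matrix_algebra_sum p\<^esub>"
    unfolding mB_algebra_sel
  proof (rule matrix_sum_ext)
    show "canonical p p (mB_id k p) \<in> carrier (matrix_sum p p)"
      by (intro canonical_in mB_id_in)
    show "\<one>\<^bsub>matrix_algebra_sum p\<^esub> \<in> carrier (matrix_sum p p)"
      using B.one_closed by (simp only: matrix_algebra_sum_module)
    fix r i j \<sigma>
    assume "r \<preceq> p" "r \<preceq> p" "i < mono_count p r" "j < mono_count p r" "\<sigma> \<in> carrier (sym_group r)"
    then show "canonical p p (mB_id k p) r (i, j) \<sigma> = \<one>\<^bsub>matrix_algebra_sum p\<^esub> r (i, j) \<sigma>"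
      by (simp add: canonical_apply mB_id_basis_diagram free_basis_def sym_group_one)
  qed
qed

end


section \<open>Rational numbers in a field of characteristic zero\<close>

text \<open>The homomorphism from the prime field, evaluated at the reduced fraction. The expression
  is total; in a field of characteristic zero the denominators become units and it is a ring
  homomorphism.\<close>

definition rat_embed :: "('k, 'm) ring_scheme \<Rightarrow> rat \<Rightarrow> 'k" where
  "rat_embed R q = (case quotient_of q of (a, b) \<Rightarrow> ([a] \<cdot>\<^bsub>R\<^esub> \<one>\<^bsub>R\<^esub>) \<otimes>\<^bsub>R\<^esub> inv\<^bsub>R\<^esub> ([b] \<cdot>\<^bsub>R\<^esub> \<one>\<^bsub>R\<^esub>))"

locale char_zero_field = field +
  assumes char_zero: "char_zero R"
begin

abbreviation int_embed :: "int \<Rightarrow> 'a" where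
  "int_embed a \<equiv> [a] \<cdot> \<one>"

lemma int_embed_add: "int_embed (a + b) = int_embed a \<oplus> int_embed b"
  by (rule add.int_pow_mult) simp

lemma int_embed_mult: "int_embed (a * b) = int_embed a \<otimes> int_embed b"
proof -
  have "int_embed a \<otimes> int_embed b = [a] \<cdot> (\<one> \<otimes> int_embed b)"
    by (rule add_pow_ldistr_int) simp_all
  also have "\<dots> = [a] \<cdot> ([b] \<cdot> \<one>)" by simp
  also have "\<dots> = int_embed (b * a)"
    by (rule add.int_pow_pow) simp
  finally show ?thesis by (simp add: mult.commute)
qed

lemma int_embed_nonzero:
  assumes "b > 0"
  shows "int_embed b \<noteq> \<zero>"
proof -
  have "int_embed b = [nat b] \<cdot> \<one>"
    using assms by (simp add: add_pow_int_ge)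
  then show ?thesis
    using char_zero assms by (simp add: char_zero_def)
qed

lemma rat_embed_closed [simp]: "rat_embed R q \<in> carrier R"
proof -
  obtain a b where q: "quotient_of q = (a, b)" by (cases "quotient_of q")
  then have "int_embed b \<in> Units R"
    using quotient_of_denom_pos[OF q] int_embed_nonzero[of b] by (simp add: field_Units)
  then show ?thesis by (simp add: rat_embed_def q)
qed

text \<open>Frees the computations from the reduced fraction chosen by \<open>quotient_of\<close>.
  Together with \<open>rat_embed_unique\<close>, sums and products are then treated by clearing
  denominators.\<close>

lemma rat_embed_mult_denom:
  assumes "q = of_int a / of_int b" "b > 0"
  shows "rat_embed R q \<otimes> int_embed b = int_embed a"
proof -
  obtain c d where q: "quotient_of q = (c, d)" by (cases "quotient_of q")
  then have d: "d > 0" "q = of_int c / of_int d"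
    using quotient_of_denom_pos quotient_of_div by blast+
  have "of_int c / of_int d = (of_int a / of_int b :: rat)"
    by (rule trans[OF d(2)[symmetric] assms(1)])
  then have "(of_int (c * b) :: rat) = of_int (a * d)"
    using assms(2) d(1) by (simp add: frac_eq_eq)
  then have cb: "c * b = a * d" by (simp only: of_int_eq_iff)
  have u: "int_embed d \<in> Units R"
    using d int_embed_nonzero[of d] by (simp add: field_Units)
  have "rat_embed R q \<otimes> int_embed b = inv (int_embed d) \<otimes> (int_embed c \<otimes> int_embed b)"
    using u by (simp add: rat_embed_def q m_ac)
  also have "\<dots> = inv (int_embed d) \<otimes> (int_embed a \<otimes> int_embed d)"
    by (simp only: int_embed_mult[symmetric] cb)
  also have "\<dots> = int_embed a"
    using u by (simp add: m_comm[of "int_embed a"] m_assoc[symmetric])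
  finally show ?thesis .
qed

lemma rat_embed_unique:
  assumes "z \<in> carrier R" "z \<otimes> int_embed b = int_embed a" "b > 0" "q = of_int a / of_int b"
  shows "z = rat_embed R q"
  using m_rcancel[OF int_embed_nonzero[OF assms(3)] _ assms(1) rat_embed_closed[of q]]
    assms rat_embed_mult_denom[OF assms(4,3)] by simp

lemma rat_fraction: obtains a b where "(q :: rat) = of_int a / of_int b" "b > 0"
proof -
  obtain a b where "quotient_of q = (a, b)" by (cases "quotient_of q")
  then show ?thesis using that[of a b] quotient_of_div[of q a b] quotient_of_denom_pos[of q a b] by blast
qed

lemma rat_embed_add: "rat_embed R (p + q) = rat_embed R p \<oplus> rat_embed R q"
proof -
  obtain a b where p: "p = of_int a / of_int b" "b > 0" by (rule rat_fraction)
  obtain c d where q: "q = of_int c / of_int d" "d > 0" by (rule rat_fraction)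
  note P = rat_embed_mult_denom[OF p] and Q = rat_embed_mult_denom[OF q]
  have "(rat_embed R p \<oplus> rat_embed R q) \<otimes> int_embed (b * d) =
      (rat_embed R p \<otimes> int_embed b) \<otimes> int_embed d \<oplus> (rat_embed R q \<otimes> int_embed d) \<otimes> int_embed b"
    by (simp add: int_embed_mult l_distr m_assoc m_comm[of "int_embed b" "int_embed d"])
  also have "\<dots> = int_embed (a * d + c * b)"
    by (simp only: P Q int_embed_mult int_embed_add)
  finally show ?thesis
    by (rule rat_embed_unique[symmetric, rotated]) (use p q in \<open>simp_all add: field_simps\<close>)
qed

lemma rat_embed_mult: "rat_embed R (p * q) = rat_embed R p \<otimes> rat_embed R q"
proof -
  obtain a b where p: "p = of_int a / of_int b" "b > 0" by (rule rat_fraction)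
  obtain c d where q: "q = of_int c / of_int d" "d > 0" by (rule rat_fraction)
  note P = rat_embed_mult_denom[OF p] and Q = rat_embed_mult_denom[OF q]
  have "(rat_embed R p \<otimes> rat_embed R q) \<otimes> int_embed (b * d) =
      (rat_embed R p \<otimes> int_embed b) \<otimes> (rat_embed R q \<otimes> int_embed d)"
    by (simp add: int_embed_mult m_ac)
  also have "\<dots> = int_embed (a * c)"
    by (simp only: P Q int_embed_mult)
  finally show ?thesis
    by (rule rat_embed_unique[symmetric, rotated]) (use p q in \<open>simp_all add: field_simps\<close>)
qed

lemma rat_embed_zero [simp]: "rat_embed R 0 = \<zero>"
proof -
  have "int_embed 0 = \<zero>" by (simp add: add_pow_def)
  then show ?thesis by (intro rat_embed_unique[symmetric, of _ 1 0]) simp_all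
qed

lemma rat_embed_one [simp]: "rat_embed R 1 = \<one>"
  by (rule rat_embed_unique[symmetric, of _ 1 1]) simp_all

lemma rat_embed_sum: "rat_embed R (\<Sum>i\<in>I. f i) = (\<Oplus>i\<in>I. rat_embed R (f i))"
proof (induction I rule: infinite_finite_induct)
  case (insert i I)
  then show ?case by (simp add: rat_embed_add finsum_insert Pi_def)
qed simp_all

end


section \<open>Block coordinates\<close>

lemma finsum_ground_algebra:
  assumes "cring R" "\<And>l. l \<in> L \<Longrightarrow> f l \<in> carrier R"
  shows "(\<Oplus>\<^bsub>ground_algebra R\<^esub>l\<in>L. f l) = (\<Oplus>\<^bsub>R\<^esub>l\<in>L. f l)"
proof -
  interpret R: cring R by fact
  interpret G: associative_algebra R "ground_algebra R" by (rule associative_algebra_ground[OF assms(1)])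
  show ?thesis
    using assms(2)
  proof (induction L rule: infinite_finite_induct)
    case (insert l L)
    then show ?case by (simp add: G.M.finsum_insert R.finsum_insert Pi_def)
  qed simp_all
qed

definition block_pairs :: "'i set \<Rightarrow> ('i \<Rightarrow> 'j) \<Rightarrow> ('i \<times> 'i) set" where
  "block_pairs K b = {(u, v). u \<in> K \<and> v \<in> K \<and> b u = b v}"

lemma block_pairs_iff [simp]: "(u, v) \<in> block_pairs K b \<longleftrightarrow> u \<in> K \<and> v \<in> K \<and> b u = b v"
  by (simp add: block_pairs_def)

lemma block_pairs_ext:
  assumes "f \<in> block_pairs K b \<rightarrow>\<^sub>E C" "g \<in> block_pairs K b \<rightarrow>\<^sub>E C"
    and "\<And>u v. u \<in> K \<Longrightarrow> v \<in> K \<Longrightarrow> b u = b v \<Longrightarrow> f (u, v) = g (u, v)"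
  shows "f = g"
  using assms by (intro PiE_ext[of f "block_pairs K b" "\<lambda>_. C" g]) auto

text \<open>\<open>\<phi>\<close> identifies the algebra with the block diagonal matrices whose rows and columns are indexed
  by \<open>K\<close>, the blocks being the fibres of \<open>b\<close>.\<close>

locale block_coordinates = associative_algebra R M for R and M (structure) +
  fixes K :: "'i set" and b :: "'i \<Rightarrow> 'j" and \<phi> :: "'b \<Rightarrow> 'i \<times> 'i \<Rightarrow> 'a"
  assumes finite_index: "finite K"
    and coord_bij: "bij_betw \<phi> (carrier M) (block_pairs K b \<rightarrow>\<^sub>E carrier R)"
    and coord_add: "\<lbrakk>x \<in> carrier M; y \<in> carrier M; u \<in> K; v \<in> K; b u = b v\<rbrakk> \<Longrightarrow>
      \<phi> (x \<oplus>\<^bsub>M\<^esub> y) (u, v) = \<phi> x (u, v) \<oplus>\<^bsub>R\<^esub> \<phi> y (u, v)"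
    and coord_smult: "\<lbrakk>a \<in> carrier R; x \<in> carrier M; u \<in> K; v \<in> K; b u = b v\<rbrakk> \<Longrightarrow>
      \<phi> (a \<odot>\<^bsub>M\<^esub> x) (u, v) = a \<otimes>\<^bsub>R\<^esub> \<phi> x (u, v)"
    and coord_mult: "\<lbrakk>x \<in> carrier M; y \<in> carrier M; u \<in> K; v \<in> K; b u = b v\<rbrakk> \<Longrightarrow>
      \<phi> (x \<otimes>\<^bsub>M\<^esub> y) (u, v) = (\<Oplus>\<^bsub>R\<^esub>w\<in>{w \<in> K. b w = b u}. \<phi> x (u, w) \<otimes>\<^bsub>R\<^esub> \<phi> y (w, v))"
    and coord_one: "\<lbrakk>u \<in> K; v \<in> K; b u = b v\<rbrakk> \<Longrightarrow>
      \<phi> \<one>\<^bsub>M\<^esub> (u, v) = (if u = v then \<one>\<^bsub>R\<^esub> else \<zero>\<^bsub>R\<^esub>)"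
begin

lemma coord_closed: "x \<in> carrier M \<Longrightarrow> \<phi> x \<in> block_pairs K b \<rightarrow>\<^sub>E carrier R"
  using coord_bij by (auto simp: bij_betw_def)

lemma coord_mem: "x \<in> carrier M \<Longrightarrow> u \<in> K \<Longrightarrow> v \<in> K \<Longrightarrow> b u = b v \<Longrightarrow> \<phi> x (u, v) \<in> carrier R"
  using coord_closed[of x] by (auto simp: PiE_iff)

lemma coord_zero:
  assumes "u \<in> K" "v \<in> K" "b u = b v"
  shows "\<phi> \<zero>\<^bsub>M\<^esub> (u, v) = \<zero>\<^bsub>R\<^esub>"
  using coord_smult[of "\<zero>\<^bsub>R\<^esub>" "\<zero>\<^bsub>M\<^esub>" u v] coord_mem[of "\<zero>\<^bsub>M\<^esub>" u v] assms by simp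

lemma coord_finsum:
  assumes "u \<in> K" "v \<in> K" "b u = b v" "\<And>l. l \<in> L \<Longrightarrow> F l \<in> carrier M"
  shows "\<phi> (\<Oplus>\<^bsub>M\<^esub>l\<in>L. F l) (u, v) = (\<Oplus>\<^bsub>R\<^esub>l\<in>L. \<phi> (F l) (u, v))"
  using assms(4)
proof (induction L rule: infinite_finite_induct)
  case (insert l L)
  then show ?case
    using assms(1-3) by (simp add: M.finsum_insert R.finsum_insert Pi_def coord_add coord_mem)
qed (use assms(1-3) coord_zero in simp_all)

text \<open>Only labels change: the blocks are numbered by \<open>{..<N}\<close> and the indices
  inside block \<open>l\<close> by \<open>{..<n l}\<close>. A function on pairs from equal blocks is
  then a tuple of square matrices, and the sum over a block in \<open>coord_mult\<close> is the sum
  in the matrix product.\<close>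

lemma coord_split_semisimple: "split_semisimple R M"
proof -
  \<comment> \<open>Counting only the values that \<open>b\<close> takes on \<open>K\<close> leaves
    no empty block, so all matrix sizes are positive.\<close>
  define N where "N = card (b ` K)"
  obtain \<beta> where \<beta>: "bij_betw \<beta> {..<N} (b ` K)"
    unfolding N_def using ex_bij_betw_nat_finite[of "b ` K"] finite_index by (auto simp: lessThan_atLeast0)
  define F where "F l = {u \<in> K. b u = \<beta> l}" for l
  define n where "n l = card (F l)" for l
  have finF: "finite (F l)" for l using finite_index by (simp add: F_def)
  then have "\<forall>l. \<exists>h. bij_betw h {..<n l} (F l)"
    unfolding n_def by (metis ex_bij_betw_nat_finite lessThan_atLeast0)
  then obtain c where c: "\<And>l. bij_betw (c l) {..<n l} (F l)" by metis
  have c_in: "c l i \<in> K" "b (c l i) = \<beta> l" if "i < n l" for l i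
    using bij_betw_apply[OF c, of i l] that by (simp_all add: F_def)
  have n_pos: "n l > 0" if "l < N" for l
  proof -
    have "\<beta> l \<in> b ` K" using \<beta> that by (auto simp: bij_betw_def)
    then have "F l \<noteq> {}" by (auto simp: F_def)
    then show ?thesis using finF by (simp add: n_def card_gt_0_iff)
  qed
  define blk where "blk u = inv_into {..<N} \<beta> (b u)" for u
  define pos where "pos u = inv_into {..<n (blk u)} (c (blk u)) u" for u
  have blk: "blk u < N" "\<beta> (blk u) = b u" if "u \<in> K" for u
    using that bij_betw_inv_into_right[OF \<beta>, of "b u"] bij_betw_apply[OF bij_betw_inv_into[OF \<beta>], of "b u"]
    by (simp_all add: blk_def)
  have pos: "pos u < n (blk u)" "c (blk u) (pos u) = u" if "u \<in> K" for u
    using that blk bij_betw_inv_into_right[OF c, of u "blk u"]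
      bij_betw_apply[OF bij_betw_inv_into[OF c], of u "blk u"]
    by (simp_all add: pos_def F_def)
  have blk_c: "blk (c l i) = l" if "l < N" "i < n l" for l i
    using that c_in[of i l] bij_betw_inv_into_left[OF \<beta>, of l] by (simp add: blk_def)
  have pos_c: "pos (c l i) = i" if "l < N" "i < n l" for l i
    using that bij_betw_inv_into_left[OF c, of i l] by (simp add: pos_def blk_c)
  let ?T = "direct_sum {..<N} (\<lambda>l. matrix_algebra (ground_algebra R) (n l))"
  define \<Psi> where "\<Psi> z = (\<lambda>l\<in>{..<N}. \<lambda>(i, j)\<in>{..<n l} \<times> {..<n l}. z (c l i, c l j))" for z :: "'i \<times> 'i \<Rightarrow> 'a"
  have T: "associative_algebra R ?T"
    by (intro associative_algebra_direct_sum associative_algebra_matrix associative_algebra_ground R.is_cring)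
  have T_ext: "x = y" if "x \<in> carrier ?T" "y \<in> carrier ?T"
    "\<And>l i j. l < N \<Longrightarrow> i < n l \<Longrightarrow> j < n l \<Longrightarrow> x l (i, j) = y l (i, j)" for x y
  proof (rule PiE_ext)
    show "x \<in> (\<Pi>\<^sub>E l\<in>{..<N}. {..<n l} \<times> {..<n l} \<rightarrow>\<^sub>E carrier R)"
      and "y \<in> (\<Pi>\<^sub>E l\<in>{..<N}. {..<n l} \<times> {..<n l} \<rightarrow>\<^sub>E carrier R)"
      using that(1,2) by simp_all
    then show "x l = y l" if "l \<in> {..<N}" for l
      using that \<open>\<And>l i j. l < N \<Longrightarrow> i < n l \<Longrightarrow> j < n l \<Longrightarrow> x l (i, j) = y l (i, j)\<close>
      by (intro matrix_ext[of "x l" "{..<n l}" "{..<n l}" "carrier R" "y l"]) (auto simp: PiE_iff)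
  qed
  have \<Psi>_in: "\<Psi> z \<in> carrier ?T" if "z \<in> block_pairs K b \<rightarrow>\<^sub>E carrier R" for z
    using that c_in by (auto simp: \<Psi>_def PiE_iff)
  have \<Psi>_bij: "bij_betw \<Psi> (block_pairs K b \<rightarrow>\<^sub>E carrier R) (carrier ?T)"
  proof (rule bij_betw_byWitness)
    let ?\<Theta> = "\<lambda>y. \<lambda>(u, v)\<in>block_pairs K b. y (blk u) (pos u, pos v)"
    have same: "blk u = blk v" if "b u = b v" for u v using that by (simp add: blk_def)
    have \<Theta>_in: "?\<Theta> y \<in> block_pairs K b \<rightarrow>\<^sub>E carrier R" if "y \<in> carrier ?T" for y
    proof -
      have "y (blk u) (pos u, pos v) \<in> carrier R" if "u \<in> K" "v \<in> K" "b u = b v" for u v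
        using \<open>y \<in> carrier ?T\<close> blk[OF that(1)] pos[OF that(1)] pos[OF that(2)] same[OF that(3)]
        by (simp add: PiE_iff)
      then show ?thesis by auto
    qed
    show "\<forall>z\<in>block_pairs K b \<rightarrow>\<^sub>E carrier R. ?\<Theta> (\<Psi> z) = z"
    proof
      fix z assume z: "z \<in> block_pairs K b \<rightarrow>\<^sub>E carrier R"
      show "?\<Theta> (\<Psi> z) = z"
      proof (rule block_pairs_ext[OF \<Theta>_in[OF \<Psi>_in[OF z]] z])
        fix u v assume uv: "u \<in> K" "v \<in> K" "b u = b v"
        then show "?\<Theta> (\<Psi> z) (u, v) = z (u, v)"
          using blk[of u] pos[of u] pos[of v] same[OF uv(3)] by (simp add: \<Psi>_def)
      qed
    qed
    show "\<forall>y\<in>carrier ?T. \<Psi> (?\<Theta> y) = y"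
    proof
      fix y assume y: "y \<in> carrier ?T"
      show "\<Psi> (?\<Theta> y) = y"
        by (rule T_ext[OF \<Psi>_in[OF \<Theta>_in[OF y]] y]) (simp add: \<Psi>_def c_in blk_c pos_c)
    qed
    show "\<Psi> ` (block_pairs K b \<rightarrow>\<^sub>E carrier R) \<subseteq> carrier ?T"
      by (rule image_subsetI) (rule \<Psi>_in)
    show "?\<Theta> ` carrier ?T \<subseteq> block_pairs K b \<rightarrow>\<^sub>E carrier R"
      by (rule image_subsetI) (rule \<Theta>_in)
  qed
  have \<Psi>_apply: "\<Psi> z l (i, j) = z (c l i, c l j)" if "l < N" "i < n l" "j < n l" for z l i j
    using that by (simp add: \<Psi>_def)
  have TI: "\<Psi> (\<phi> x) \<in> carrier ?T" if "x \<in> carrier M" for x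
    by (rule \<Psi>_in[OF coord_closed[OF that]])
  interpret T: associative_algebra R ?T by (rule T)
  have "algebra_iso R M ?T (\<Psi> \<circ> \<phi>)"
  proof (rule algebra_iso_transport[OF module_axioms T bij_betw_trans[OF coord_bij \<Psi>_bij]])
    fix x y assume xy: "x \<in> carrier M" "y \<in> carrier M"
    show "(\<Psi> \<circ> \<phi>) (x \<oplus>\<^bsub>M\<^esub> y) = (\<Psi> \<circ> \<phi>) x \<oplus>\<^bsub>?T\<^esub> (\<Psi> \<circ> \<phi>) y"
      unfolding comp_apply
      by (rule T_ext[OF TI T.M.a_closed[OF TI[OF xy(1)] TI[OF xy(2)]]]) (use xy in \<open>simp_all add: \<Psi>_apply coord_add c_in\<close>)
    show "(\<Psi> \<circ> \<phi>) (x \<otimes>\<^bsub>M\<^esub> y) = (\<Psi> \<circ> \<phi>) x \<otimes>\<^bsub>?T\<^esub> (\<Psi> \<circ> \<phi>) y"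
      unfolding comp_apply
    proof (rule T_ext[OF TI T.m_closed[OF TI[OF xy(1)] TI[OF xy(2)]]])
      fix l i j assume l: "l < N" "i < n l" "j < n l"
      have F_eq: "{w \<in> K. b w = b (c l i)} = F l"
        using l c_in by (auto simp: F_def)
      have "\<Psi> (\<phi> (x \<otimes>\<^bsub>M\<^esub> y)) l (i, j) = (\<Oplus>\<^bsub>R\<^esub>w\<in>F l. \<phi> x (c l i, w) \<otimes>\<^bsub>R\<^esub> \<phi> y (w, c l j))"
        using l xy by (simp add: \<Psi>_apply coord_mult c_in F_eq[symmetric])
      also have "\<dots> = (\<Oplus>\<^bsub>R\<^esub>m\<in>{..<n l}. \<phi> x (c l i, c l m) \<otimes>\<^bsub>R\<^esub> \<phi> y (c l m, c l j))"
        using l xy c_in by (intro R.finsum_reindex_bij[OF c]) (auto simp: F_def intro!: R.m_closed coord_mem)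
      also have "\<dots> = (\<Oplus>\<^bsub>ground_algebra R\<^esub>m\<in>{..<n l}. \<phi> x (c l i, c l m) \<otimes>\<^bsub>R\<^esub> \<phi> y (c l m, c l j))"
        using l xy c_in by (intro finsum_ground_algebra[symmetric] R.is_cring) (auto intro!: R.m_closed coord_mem)
      also have "\<dots> = (\<Psi> (\<phi> x) \<otimes>\<^bsub>?T\<^esub> \<Psi> (\<phi> y)) l (i, j)"
      proof -
        interpret Gr: associative_algebra R "ground_algebra R"
          by (rule associative_algebra_ground[OF R.is_cring])
        show ?thesis
          using l xy c_in by (simp, intro Gr.M.finsum_cong') (auto simp: \<Psi>_apply intro!: R.m_closed coord_mem)
      qed
      finally show "\<Psi> (\<phi> (x \<otimes>\<^bsub>M\<^esub> y)) l (i, j) = (\<Psi> (\<phi> x) \<otimes>\<^bsub>?T\<^esub> \<Psi> (\<phi> y)) l (i, j)" .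
    qed (use xy in simp)
  next
    fix a x assume ax: "a \<in> carrier R" "x \<in> carrier M"
    show "(\<Psi> \<circ> \<phi>) (a \<odot>\<^bsub>M\<^esub> x) = a \<odot>\<^bsub>?T\<^esub> (\<Psi> \<circ> \<phi>) x"
      unfolding comp_apply
      by (rule T_ext[OF TI T.smult_closed[OF ax(1) TI[OF ax(2)]]]) (use ax in \<open>simp_all add: \<Psi>_apply coord_smult c_in\<close>)
  next
    show "(\<Psi> \<circ> \<phi>) \<one>\<^bsub>M\<^esub> = \<one>\<^bsub>?T\<^esub>"
      unfolding comp_apply
    proof (rule T_ext[OF TI T.one_closed])
      fix l i j assume l: "l < N" "i < n l" "j < n l"
      have "c l i = c l j \<longleftrightarrow> i = j" using l pos_c by metis
      then show "\<Psi> (\<phi> \<one>\<^bsub>M\<^esub>) l (i, j) = \<one>\<^bsub>?T\<^esub> l (i, j)"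
        using l c_in by (simp add: \<Psi>_apply coord_one)
    qed simp
  qed simp_all
  then show ?thesis
    unfolding split_semisimple_def using n_pos by blast
qed

end

lemma algebra_iso_trans:
  assumes "algebra_iso R A B \<phi>" "algebra_iso R B C \<psi>"
  shows "algebra_iso R A C (\<psi> \<circ> \<phi>)"
proof -
  have "\<phi> x \<in> carrier B" if "x \<in> carrier A" for x
    using assms(1) that by (auto simp: algebra_iso_def module_iso_def bij_betw_def)
  moreover have "bij_betw (\<psi> \<circ> \<phi>) (carrier A) (carrier C)"
    using assms by (auto simp: algebra_iso_def module_iso_def intro: bij_betw_trans)
  ultimately show ?thesis
    using assms by (simp add: algebra_iso_def module_iso_def)
qed

text \<open>Matrices whose entries are block diagonal matrices are again block diagonal, with pairs
  as indices. The outer index is dropped from the block label, since it ranges freely within each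
  block; a block of size \<open>d\<close> becomes one of size \<open>n\<close> times
  \<open>d\<close>.\<close>

lemma block_coordinates_matrix:
  assumes "block_coordinates R A K b \<phi>"
  shows "block_coordinates R (matrix_algebra A n) ({..<n} \<times> K) (b \<circ> snd)
    (\<lambda>x. \<lambda>(u, v)\<in>block_pairs ({..<n} \<times> K) (b \<circ> snd). \<phi> (x (fst u, fst v)) (snd u, snd v))"
proof -
  interpret A: block_coordinates R A K b \<phi> by fact
  let ?M = "matrix_algebra A n" and ?P = "block_pairs ({..<n} \<times> K) (b \<circ> snd)"
  let ?\<Phi> = "\<lambda>x. \<lambda>(u, v)\<in>?P. \<phi> (x (fst u, fst v)) (snd u, snd v)"
  have alg: "associative_algebra R ?M"
    by (rule associative_algebra_matrix[OF A.associative_algebra_axioms])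
  interpret M: associative_algebra R ?M by (rule alg)
  have mem: "x (i, j) \<in> carrier A" if "x \<in> carrier ?M" "i < n" "j < n" for x i j
    using that by (simp add: PiE_iff)
  have \<Phi>_in: "?\<Phi> x \<in> ?P \<rightarrow>\<^sub>E carrier R" if "x \<in> carrier ?M" for x
    by (auto intro!: A.coord_mem mem[OF that])
  define \<psi> where "\<psi> = inv_into (carrier A) \<phi>"
  have \<psi>: "\<psi> z \<in> carrier A" "\<phi> (\<psi> z) = z" if "z \<in> block_pairs K b \<rightarrow>\<^sub>E carrier R" for z
    using bij_betw_apply[OF bij_betw_inv_into[OF A.coord_bij] that] bij_betw_inv_into_right[OF A.coord_bij that]
    by (simp_all add: \<psi>_def)
  have \<psi>': "\<psi> (\<phi> x) = x" if "x \<in> carrier A" for x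
    using bij_betw_inv_into_left[OF A.coord_bij that] by (simp add: \<psi>_def)
  \<comment> \<open>The coordinates of the entry \<open>(i, j)\<close>, cut out of the coordinates
    of the whole matrix.\<close>
  let ?slice = "\<lambda>z i j. \<lambda>(u, v)\<in>block_pairs K b. z ((i, u), (j, v))"
  let ?\<Psi> = "\<lambda>z. \<lambda>(i, j)\<in>{..<n} \<times> {..<n}. \<psi> (?slice z i j)"
  have slice: "?slice z i j \<in> block_pairs K b \<rightarrow>\<^sub>E carrier R" if "z \<in> ?P \<rightarrow>\<^sub>E carrier R" "i < n" "j < n" for z i j
    using that by (auto simp: PiE_iff)
  have \<Psi>_in: "?\<Psi> z \<in> carrier ?M" if "z \<in> ?P \<rightarrow>\<^sub>E carrier R" for z
    using \<psi>(1)[OF slice[OF that]] by auto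
  have bij: "bij_betw ?\<Phi> (carrier ?M) (?P \<rightarrow>\<^sub>E carrier R)"
  proof (rule bij_betw_byWitness[of _ ?\<Psi>])
    show "\<forall>x\<in>carrier ?M. ?\<Psi> (?\<Phi> x) = x"
    proof
      fix x assume x: "x \<in> carrier ?M"
      show "?\<Psi> (?\<Phi> x) = x"
      proof (rule matrix_ext[of _ "{..<n}" "{..<n}" "carrier A"])
        fix i j assume ij: "i \<in> {..<n}" "j \<in> {..<n}"
        have "?slice (?\<Phi> x) i j = \<phi> (x (i, j))"
        proof (rule block_pairs_ext)
          show "?slice (?\<Phi> x) i j \<in> block_pairs K b \<rightarrow>\<^sub>E carrier R"
            using ij by (intro slice \<Phi>_in x) auto
          show "\<phi> (x (i, j)) \<in> block_pairs K b \<rightarrow>\<^sub>E carrier R"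
            using ij by (intro A.coord_closed mem[OF x]) auto
        qed (use ij in simp)
        then show "?\<Psi> (?\<Phi> x) (i, j) = x (i, j)"
          using ij \<psi>'[OF mem[OF x, of i j]] by simp
      qed (use \<Psi>_in[OF \<Phi>_in[OF x]] x in \<open>simp_all only: matrix_algebra_sel(1)\<close>)
    qed
    show "\<forall>z\<in>?P \<rightarrow>\<^sub>E carrier R. ?\<Phi> (?\<Psi> z) = z"
    proof
      fix z assume z: "z \<in> ?P \<rightarrow>\<^sub>E carrier R"
      show "?\<Phi> (?\<Psi> z) = z"
      proof (rule block_pairs_ext[OF \<Phi>_in[OF \<Psi>_in[OF z]] z])
        fix u v assume "u \<in> {..<n} \<times> K" "v \<in> {..<n} \<times> K" "(b \<circ> snd) u = (b \<circ> snd) v"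
        then show "?\<Phi> (?\<Psi> z) (u, v) = z (u, v)"
          using \<psi>(2)[OF slice[OF z, of "fst u" "fst v"]] by auto
      qed
    qed
    show "?\<Phi> ` carrier ?M \<subseteq> ?P \<rightarrow>\<^sub>E carrier R"
      by (rule image_subsetI) (rule \<Phi>_in)
    show "?\<Psi> ` (?P \<rightarrow>\<^sub>E carrier R) \<subseteq> carrier ?M"
      by (rule image_subsetI) (rule \<Psi>_in)
  qed
  have mult: "?\<Phi> (x \<otimes>\<^bsub>?M\<^esub> y) (u, v) =
      (\<Oplus>\<^bsub>R\<^esub>w\<in>{w \<in> {..<n} \<times> K. (b \<circ> snd) w = (b \<circ> snd) u}. ?\<Phi> x (u, w) \<otimes>\<^bsub>R\<^esub> ?\<Phi> y (w, v))"
    if xy: "x \<in> carrier ?M" "y \<in> carrier ?M" and uv: "u \<in> {..<n} \<times> K" "v \<in> {..<n} \<times> K" "(b \<circ> snd) u = (b \<circ> snd) v"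
    for x y u v
  proof -
    obtain i s j t where u: "u = (i, s)" "i < n" "s \<in> K" and v: "v = (j, t)" "j < n" "t \<in> K" and st: "b s = b t"
      using uv by auto
    let ?L = "{w \<in> K. b w = b s}"
    note mems = mem[OF xy(1)] mem[OF xy(2)]
    have "?\<Phi> (x \<otimes>\<^bsub>?M\<^esub> y) (u, v) = \<phi> (\<Oplus>\<^bsub>A\<^esub>l\<in>{..<n}. x (i, l) \<otimes>\<^bsub>A\<^esub> y (l, j)) (s, t)"
      using u v st by simp
    also have "\<dots> = (\<Oplus>\<^bsub>R\<^esub>l\<in>{..<n}. \<phi> (x (i, l) \<otimes>\<^bsub>A\<^esub> y (l, j)) (s, t))"
      using u v st by (intro A.coord_finsum) (auto intro!: A.m_closed mems)
    also have "\<dots> = (\<Oplus>\<^bsub>R\<^esub>l\<in>{..<n}. \<Oplus>\<^bsub>R\<^esub>w\<in>?L. \<phi> (x (i, l)) (s, w) \<otimes>\<^bsub>R\<^esub> \<phi> (y (l, j)) (w, t))"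
    proof (intro A.R.finsum_cong' refl)
      fix l assume "l \<in> {..<n}"
      then show "\<phi> (x (i, l) \<otimes>\<^bsub>A\<^esub> y (l, j)) (s, t) =
          (\<Oplus>\<^bsub>R\<^esub>w\<in>?L. \<phi> (x (i, l)) (s, w) \<otimes>\<^bsub>R\<^esub> \<phi> (y (l, j)) (w, t))"
        using u v st by (intro A.coord_mult mems) simp_all
    qed (use u v st in \<open>auto intro!: A.R.finsum_closed A.R.m_closed A.coord_mem mems\<close>)
    also have "\<dots> = (\<Oplus>\<^bsub>R\<^esub>z\<in>{..<n} \<times> ?L. \<phi> (x (i, fst z)) (s, snd z) \<otimes>\<^bsub>R\<^esub> \<phi> (y (fst z, j)) (snd z, t))"
      using u v st A.finite_index
      by (subst A.R.finsum_product) (auto intro!: A.R.m_closed A.coord_mem mems)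
    also have "{..<n} \<times> ?L = {w \<in> {..<n} \<times> K. (b \<circ> snd) w = (b \<circ> snd) u}"
      using u by auto
    also have "(\<Oplus>\<^bsub>R\<^esub>z\<in>\<dots>. \<phi> (x (i, fst z)) (s, snd z) \<otimes>\<^bsub>R\<^esub> \<phi> (y (fst z, j)) (snd z, t)) =
        (\<Oplus>\<^bsub>R\<^esub>w\<in>{w \<in> {..<n} \<times> K. (b \<circ> snd) w = (b \<circ> snd) u}. ?\<Phi> x (u, w) \<otimes>\<^bsub>R\<^esub> ?\<Phi> y (w, v))"
      using u v st by (intro A.R.finsum_cong') (auto intro!: A.R.m_closed A.coord_mem mems)
    finally show ?thesis .
  qed
  show ?thesis
  proof (intro block_coordinates.intro alg block_coordinates_axioms.intro bij mult; assumption?)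
    show "finite ({..<n} \<times> K)" using A.finite_index by simp
    fix u v assume uv: "u \<in> {..<n} \<times> K" "v \<in> {..<n} \<times> K" "(b \<circ> snd) u = (b \<circ> snd) v"
    then obtain i s j t where u: "u = (i, s)" "i < n" "s \<in> K" and v: "v = (j, t)" "j < n" "t \<in> K" and st: "b s = b t"
      by auto
    show "?\<Phi> (x \<oplus>\<^bsub>?M\<^esub> y) (u, v) = ?\<Phi> x (u, v) \<oplus>\<^bsub>R\<^esub> ?\<Phi> y (u, v)"
      if "x \<in> carrier ?M" "y \<in> carrier ?M" for x y
      using u v st A.coord_add[OF mem[OF that(1)] mem[OF that(2)]] by simp
    show "?\<Phi> (a \<odot>\<^bsub>?M\<^esub> x) (u, v) = a \<otimes>\<^bsub>R\<^esub> ?\<Phi> x (u, v)" if "a \<in> carrier R" "x \<in> carrier ?M" for a x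
      using u v st A.coord_smult[OF that(1) mem[OF that(2)]] by simp
    show "?\<Phi> \<one>\<^bsub>?M\<^esub> (u, v) = (if u = v then \<one>\<^bsub>R\<^esub> else \<zero>\<^bsub>R\<^esub>)"
      using u v st by (simp add: A.coord_one A.coord_zero)
  qed
qed

text \<open>In contrast to matrices, the summand index becomes part of the block label, because
  elements of different summands multiply to zero.\<close>

lemma block_coordinates_direct_sum:
  assumes "cring R" "finite J" "\<And>r. r \<in> J \<Longrightarrow> block_coordinates R (A r) (K r) (b r) (\<phi> r)"
  shows "block_coordinates R (direct_sum J A) (Sigma J K) (\<lambda>(r, u). (r, b r u))
    (\<lambda>x. \<lambda>(u, v)\<in>block_pairs (Sigma J K) (\<lambda>(r, u). (r, b r u)). \<phi> (fst u) (x (fst u)) (snd u, snd v))"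
proof -
  interpret R: cring R by fact
  let ?b = "\<lambda>(r, u). (r, b r u)"
  let ?M = "direct_sum J A" and ?P = "block_pairs (Sigma J K) ?b"
  let ?\<Phi> = "\<lambda>x. \<lambda>(u, v)\<in>?P. \<phi> (fst u) (x (fst u)) (snd u, snd v)"
  note bc = assms(3)
  have alg: "associative_algebra R ?M"
    using bc by (intro associative_algebra_direct_sum assms(1)) (simp add: block_coordinates_def)
  have mem: "x r \<in> carrier (A r)" if "x \<in> carrier ?M" "r \<in> J" for x r
    using that by (simp add: PiE_iff)
  note cmem = block_coordinates.coord_mem[OF bc]
  have \<Phi>_in: "?\<Phi> x \<in> ?P \<rightarrow>\<^sub>E carrier R" if "x \<in> carrier ?M" for x
    by (auto intro!: cmem mem[OF that])
  define \<psi> where "\<psi> r = inv_into (carrier (A r)) (\<phi> r)" for r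
  have \<psi>: "\<psi> r z \<in> carrier (A r)" "\<phi> r (\<psi> r z) = z"
    if "r \<in> J" "z \<in> block_pairs (K r) (b r) \<rightarrow>\<^sub>E carrier R" for r z
    using bij_betw_apply[OF bij_betw_inv_into[OF block_coordinates.coord_bij[OF bc[OF that(1)]]] that(2)]
      bij_betw_inv_into_right[OF block_coordinates.coord_bij[OF bc[OF that(1)]] that(2)]
    by (simp_all add: \<psi>_def)
  have \<psi>': "\<psi> r (\<phi> r x) = x" if "r \<in> J" "x \<in> carrier (A r)" for r x
    using bij_betw_inv_into_left[OF block_coordinates.coord_bij[OF bc[OF that(1)]] that(2)] by (simp add: \<psi>_def)
  let ?slice = "\<lambda>z r. \<lambda>(u, v)\<in>block_pairs (K r) (b r). z ((r, u), (r, v))"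
  let ?\<Psi> = "\<lambda>z. \<lambda>r\<in>J. \<psi> r (?slice z r)"
  have slice: "?slice z r \<in> block_pairs (K r) (b r) \<rightarrow>\<^sub>E carrier R" if "z \<in> ?P \<rightarrow>\<^sub>E carrier R" "r \<in> J" for z r
    using that by (auto simp: PiE_iff)
  have \<Psi>_in: "?\<Psi> z \<in> carrier ?M" if "z \<in> ?P \<rightarrow>\<^sub>E carrier R" for z
    using \<psi>(1)[OF _ slice[OF that]] by auto
  have bij: "bij_betw ?\<Phi> (carrier ?M) (?P \<rightarrow>\<^sub>E carrier R)"
  proof (rule bij_betw_byWitness[of _ ?\<Psi>])
    show "\<forall>x\<in>carrier ?M. ?\<Psi> (?\<Phi> x) = x"
    proof
      fix x assume x: "x \<in> carrier ?M"
      show "?\<Psi> (?\<Phi> x) = x"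
      proof (rule PiE_ext[of _ J "\<lambda>r. carrier (A r)"])
        fix r assume r: "r \<in> J"
        have "?slice (?\<Phi> x) r = \<phi> r (x r)"
        proof (rule block_pairs_ext)
          show "?slice (?\<Phi> x) r \<in> block_pairs (K r) (b r) \<rightarrow>\<^sub>E carrier R"
            using r by (intro slice \<Phi>_in x) auto
          show "\<phi> r (x r) \<in> block_pairs (K r) (b r) \<rightarrow>\<^sub>E carrier R"
            by (rule block_coordinates.coord_closed[OF bc[OF r] mem[OF x r]])
        qed (use r in simp)
        then show "?\<Psi> (?\<Phi> x) r = x r"
          using r \<psi>'[OF r mem[OF x r]] by simp
      qed (use \<Psi>_in[OF \<Phi>_in[OF x]] x in \<open>simp_all only: direct_sum_sel(1)\<close>)
    qed
    show "\<forall>z\<in>?P \<rightarrow>\<^sub>E carrier R. ?\<Phi> (?\<Psi> z) = z"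
    proof
      fix z assume z: "z \<in> ?P \<rightarrow>\<^sub>E carrier R"
      show "?\<Phi> (?\<Psi> z) = z"
      proof (rule block_pairs_ext[OF \<Phi>_in[OF \<Psi>_in[OF z]] z])
        fix u v assume "u \<in> Sigma J K" "v \<in> Sigma J K" "?b u = ?b v"
        then show "?\<Phi> (?\<Psi> z) (u, v) = z (u, v)"
          using \<psi>(2)[OF _ slice[OF z, of "fst u"]] by auto
      qed
    qed
    show "?\<Phi> ` carrier ?M \<subseteq> ?P \<rightarrow>\<^sub>E carrier R"
      by (rule image_subsetI) (rule \<Phi>_in)
    show "?\<Psi> ` (?P \<rightarrow>\<^sub>E carrier R) \<subseteq> carrier ?M"
      by (rule image_subsetI) (rule \<Psi>_in)
  qed
  have mult: "?\<Phi> (x \<otimes>\<^bsub>?M\<^esub> y) (u, v) =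
      (\<Oplus>\<^bsub>R\<^esub>w\<in>{w \<in> Sigma J K. ?b w = ?b u}. ?\<Phi> x (u, w) \<otimes>\<^bsub>R\<^esub> ?\<Phi> y (w, v))"
    if xy: "x \<in> carrier ?M" "y \<in> carrier ?M" and uv: "u \<in> Sigma J K" "v \<in> Sigma J K" "?b u = ?b v"
    for x y u v
  proof -
    obtain r s t where u: "u = (r, s)" "r \<in> J" "s \<in> K r" and v: "v = (r, t)" "t \<in> K r" and st: "b r s = b r t"
      using uv by auto
    let ?L = "{w \<in> K r. b r w = b r s}"
    note mems = mem[OF xy(1) u(2)] mem[OF xy(2) u(2)]
    have img: "bij_betw (Pair r) ?L {w \<in> Sigma J K. ?b w = ?b u}"
      using u by (intro bij_betw_imageI) (auto simp: inj_on_def)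
    have "?\<Phi> (x \<otimes>\<^bsub>?M\<^esub> y) (u, v) = (\<Oplus>\<^bsub>R\<^esub>w\<in>?L. \<phi> r (x r) (s, w) \<otimes>\<^bsub>R\<^esub> \<phi> r (y r) (w, t))"
      using u v st block_coordinates.coord_mult[OF bc[OF u(2)] mems, of s t] by simp
    also have "\<dots> = (\<Oplus>\<^bsub>R\<^esub>w\<in>?L. ?\<Phi> x (u, (r, w)) \<otimes>\<^bsub>R\<^esub> ?\<Phi> y ((r, w), v))"
      using u v st by (intro R.finsum_cong') (auto intro!: R.m_closed cmem mems)
    also have "\<dots> = (\<Oplus>\<^bsub>R\<^esub>w\<in>{w \<in> Sigma J K. ?b w = ?b u}. ?\<Phi> x (u, w) \<otimes>\<^bsub>R\<^esub> ?\<Phi> y (w, v))"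
      using u v st by (intro R.finsum_reindex_bij[OF img, symmetric]) (auto intro!: R.m_closed cmem mems)
    finally show ?thesis .
  qed
  show ?thesis
  proof (intro block_coordinates.intro alg block_coordinates_axioms.intro bij mult; assumption?)
    show "finite (Sigma J K)" using assms(2) block_coordinates.finite_index[OF bc] by simp
    fix u v assume uv: "u \<in> Sigma J K" "v \<in> Sigma J K" "?b u = ?b v"
    then obtain r s t where u: "u = (r, s)" "r \<in> J" "s \<in> K r" and v: "v = (r, t)" "t \<in> K r" and st: "b r s = b r t"
      by auto
    show "?\<Phi> (x \<oplus>\<^bsub>?M\<^esub> y) (u, v) = ?\<Phi> x (u, v) \<oplus>\<^bsub>R\<^esub> ?\<Phi> y (u, v)"
      if "x \<in> carrier ?M" "y \<in> carrier ?M" for x y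
      using u v st block_coordinates.coord_add[OF bc[OF u(2)] mem[OF that(1) u(2)] mem[OF that(2) u(2)]] by simp
    show "?\<Phi> (a \<odot>\<^bsub>?M\<^esub> x) (u, v) = a \<otimes>\<^bsub>R\<^esub> ?\<Phi> x (u, v)" if "a \<in> carrier R" "x \<in> carrier ?M" for a x
      using u v st block_coordinates.coord_smult[OF bc[OF u(2)] that(1) mem[OF that(2) u(2)]] by simp
    show "?\<Phi> \<one>\<^bsub>?M\<^esub> (u, v) = (if u = v then \<one>\<^bsub>R\<^esub> else \<zero>\<^bsub>R\<^esub>)"
      using u v st block_coordinates.coord_one[OF bc[OF u(2)], of s t] by simp
  qed
qed

text \<open>The Fourier transform of the group: \<phi> sums \<open>x\<close> against the matrix
  coefficients \<open>D\<close>, and \<psi> inverts it with the help of \<open>U\<close>. The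
  relations \<open>UD\<close> and \<open>DU\<close> make both composites the identity, and
  \<open>D_mult\<close> turns convolution into matrix multiplication. All of these are rational
  identities, carried into \<open>R\<close> by \<open>rat_embed\<close>.\<close>

lemma (in char_zero_field) block_coordinates_sym_group:
  "\<exists>(I :: fperm galg set) (b :: fperm galg \<Rightarrow> fperm galg) \<phi>. block_coordinates R (group_algebra R (sym_group n)) I b \<phi>"
proof -
  let ?G = "sym_group n"
  let ?S = "carrier ?G" and ?A = "group_algebra R (sym_group n)"
  interpret G: group ?G by (rule sym_group_is_group)
  obtain I b D U where "finite (I :: fperm galg set) \<and>
     (\<forall>e\<in>I. \<forall>f\<in>I. b e = (b f :: fperm galg) \<longrightarrow> (\<forall>\<sigma>\<in>?S. \<forall>\<tau>\<in>?S.
         D e f (\<sigma> \<circ> \<tau>) = (\<Sum>g\<in>{g \<in> I. b g = b e}. D e g \<sigma> * D g f \<tau>))) \<and>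
     (\<forall>e\<in>I. \<forall>f\<in>I. b e = b f \<longrightarrow> D e f id = (if e = f then 1 else 0)) \<and>
     (\<forall>e\<in>I. \<forall>f\<in>I. \<forall>e'\<in>I. \<forall>f'\<in>I. b e = b f \<longrightarrow> b e' = b f' \<longrightarrow>
         (\<Sum>\<sigma>\<in>?S. U e f \<sigma> * D e' f' \<sigma>) = (if e = e' \<and> f = f' then 1 else 0 :: rat)) \<and>
     (\<forall>\<sigma>\<in>?S. \<forall>\<tau>\<in>?S. (\<Sum>(e, f)\<in>{(e, f) \<in> I \<times> I. b e = b f}. D e f \<sigma> * U e f \<tau>) = (if \<sigma> = \<tau> then 1 else 0))"
    using sym_group_matrix_coefficients[of n] by (elim exE)
  then have I: "finite I"
    and D_mult: "\<And>e f \<sigma> \<tau>. e \<in> I \<Longrightarrow> f \<in> I \<Longrightarrow> b e = b f \<Longrightarrow> \<sigma> \<in> ?S \<Longrightarrow> \<tau> \<in> ?S \<Longrightarrow>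
      D e f (\<sigma> \<circ> \<tau>) = (\<Sum>g\<in>{g \<in> I. b g = b e}. D e g \<sigma> * D g f \<tau>)"
    and D_one: "\<And>e f. e \<in> I \<Longrightarrow> f \<in> I \<Longrightarrow> b e = b f \<Longrightarrow> D e f id = (if e = f then 1 else 0)"
    and UD: "\<And>e f e' f'. e \<in> I \<Longrightarrow> f \<in> I \<Longrightarrow> e' \<in> I \<Longrightarrow> f' \<in> I \<Longrightarrow> b e = b f \<Longrightarrow> b e' = b f' \<Longrightarrow>
      (\<Sum>\<sigma>\<in>?S. U e f \<sigma> * D e' f' \<sigma>) = (if e = e' \<and> f = f' then 1 else 0)"
    and DU: "\<And>\<sigma> \<tau>. \<sigma> \<in> ?S \<Longrightarrow> \<tau> \<in> ?S \<Longrightarrow>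
      (\<Sum>(e, f)\<in>{(e, f) \<in> I \<times> I. b e = b f}. D e f \<sigma> * U e f \<tau>) = (if \<sigma> = \<tau> then 1 else 0)"
    by (simp_all only: simp_thms)
  let ?d = "\<lambda>e f \<sigma>. rat_embed R (D e f \<sigma>)" and ?u = "\<lambda>e f \<sigma>. rat_embed R (U e f \<sigma>)"
  let ?P = "block_pairs I b"
  have P_eq: "{(e, f) \<in> I \<times> I. b e = b f} = ?P" by (auto simp: block_pairs_def)
  have finP: "finite ?P" by (rule finite_subset[of _ "I \<times> I"]) (auto simp: block_pairs_def I)
  have finS: "finite ?S" by (rule finite_sym_group)
  have alg: "associative_algebra R ?A"
    by (rule associative_algebra_group_algebra[OF is_cring sym_group_is_group finS])
  define \<phi> where "\<phi> x = (\<lambda>(e, f)\<in>?P. \<Oplus>\<sigma>\<in>?S. x \<sigma> \<otimes> ?d e f \<sigma>)" for x :: "(nat \<Rightarrow> nat) \<Rightarrow> 'a"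
  define \<psi> where "\<psi> z = (\<lambda>\<sigma>\<in>?S. \<Oplus>ef\<in>?P. z ef \<otimes> ?u (fst ef) (snd ef) \<sigma>)" for z :: "fperm galg \<times> fperm galg \<Rightarrow> 'a"
  have mem: "x \<sigma> \<in> carrier R" if "x \<in> carrier ?A" "\<sigma> \<in> ?S" for x \<sigma>
    using that by (simp add: PiE_iff)
  have \<phi>_apply: "\<phi> x (e, f) = (\<Oplus>\<sigma>\<in>?S. x \<sigma> \<otimes> ?d e f \<sigma>)" if "e \<in> I" "f \<in> I" "b e = b f" for x e f
    using that by (simp add: \<phi>_def)
  have \<phi>_in: "\<phi> x \<in> ?P \<rightarrow>\<^sub>E carrier R" if "x \<in> carrier ?A" for x
    unfolding \<phi>_def by (auto intro!: finsum_closed mem[OF that])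
  have \<psi>_in: "\<psi> z \<in> carrier ?A" if "z \<in> ?P \<rightarrow>\<^sub>E carrier R" for z
    using that unfolding \<psi>_def by (auto intro!: finsum_closed simp: PiE_iff)
  have bij: "bij_betw \<phi> (carrier ?A) (?P \<rightarrow>\<^sub>E carrier R)"
  proof (rule bij_betw_byWitness[of _ \<psi>])
    show "\<forall>x\<in>carrier ?A. \<psi> (\<phi> x) = x"
    proof
      fix x assume x: "x \<in> carrier ?A"
      show "\<psi> (\<phi> x) = x"
      proof (rule PiE_ext[of _ ?S "\<lambda>_. carrier R"])
        fix \<tau> assume \<tau>: "\<tau> \<in> ?S"
        have "\<psi> (\<phi> x) \<tau> = (\<Oplus>ef\<in>?P. (\<Oplus>\<sigma>\<in>?S. x \<sigma> \<otimes> ?d (fst ef) (snd ef) \<sigma>) \<otimes> ?u (fst ef) (snd ef) \<tau>)"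
          using \<tau> unfolding \<psi>_def \<phi>_def
          by (simp, intro finsum_cong') (auto intro!: finsum_closed m_closed mem[OF x])
        also have "\<dots> = (\<Oplus>ef\<in>?P. \<Oplus>\<sigma>\<in>?S. x \<sigma> \<otimes> (?d (fst ef) (snd ef) \<sigma> \<otimes> ?u (fst ef) (snd ef) \<tau>))"
        proof (intro finsum_cong' refl)
          fix ef assume "ef \<in> ?P"
          show "(\<Oplus>\<sigma>\<in>?S. x \<sigma> \<otimes> ?d (fst ef) (snd ef) \<sigma>) \<otimes> ?u (fst ef) (snd ef) \<tau> =
              (\<Oplus>\<sigma>\<in>?S. x \<sigma> \<otimes> (?d (fst ef) (snd ef) \<sigma> \<otimes> ?u (fst ef) (snd ef) \<tau>))"
            by (subst finsum_ldistr[OF finS]) (auto intro!: finsum_cong' simp: mem[OF x] m_assoc)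
        qed (auto intro!: finsum_closed m_closed mem[OF x])
        also have "\<dots> = (\<Oplus>\<sigma>\<in>?S. \<Oplus>ef\<in>?P. x \<sigma> \<otimes> (?d (fst ef) (snd ef) \<sigma> \<otimes> ?u (fst ef) (snd ef) \<tau>))"
          by (intro finsum_swap finS finP) (auto intro!: m_closed mem[OF x])
        also have "\<dots> = (\<Oplus>\<sigma>\<in>?S. if \<sigma> = \<tau> then x \<tau> else \<zero>)"
        proof (intro finsum_cong' refl)
          fix \<sigma> assume \<sigma>: "\<sigma> \<in> ?S"
          have "(\<Oplus>ef\<in>?P. x \<sigma> \<otimes> (?d (fst ef) (snd ef) \<sigma> \<otimes> ?u (fst ef) (snd ef) \<tau>)) =
              x \<sigma> \<otimes> (\<Oplus>ef\<in>?P. ?d (fst ef) (snd ef) \<sigma> \<otimes> ?u (fst ef) (snd ef) \<tau>)"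
            by (rule finsum_rdistr[symmetric, OF finP mem[OF x \<sigma>]]) auto
          also have "(\<Oplus>ef\<in>?P. ?d (fst ef) (snd ef) \<sigma> \<otimes> ?u (fst ef) (snd ef) \<tau>) =
              rat_embed R (\<Sum>(e, f)\<in>?P. D e f \<sigma> * U e f \<tau>)"
            by (simp add: rat_embed_sum rat_embed_mult case_prod_unfold)
          also have "x \<sigma> \<otimes> \<dots> = (if \<sigma> = \<tau> then x \<tau> else \<zero>)"
            unfolding DU[OF \<sigma> \<tau>, unfolded P_eq] using mem[OF x \<sigma>] mem[OF x \<tau>] by simp
          finally show "(\<Oplus>ef\<in>?P. x \<sigma> \<otimes> (?d (fst ef) (snd ef) \<sigma> \<otimes> ?u (fst ef) (snd ef) \<tau>)) =
              (if \<sigma> = \<tau> then x \<tau> else \<zero>)" .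
        qed (use mem[OF x \<tau>] in auto)
        also have "\<dots> = x \<tau>"
          using finsum_delta[OF finS \<tau>, of "\<lambda>\<sigma>. if \<sigma> = \<tau> then x \<tau> else \<zero>"] mem[OF x \<tau>] by simp
        finally show "\<psi> (\<phi> x) \<tau> = x \<tau>" .
      qed (use \<psi>_in[OF \<phi>_in[OF x]] x in \<open>simp_all only: group_algebra_sel(1)\<close>)
    qed
    show "\<forall>z\<in>?P \<rightarrow>\<^sub>E carrier R. \<phi> (\<psi> z) = z"
    proof
      fix z assume z: "z \<in> ?P \<rightarrow>\<^sub>E carrier R"
      have zmem: "z ef \<in> carrier R" if "ef \<in> ?P" for ef using z that by (simp add: PiE_iff)
      show "\<phi> (\<psi> z) = z"
      proof (rule block_pairs_ext[OF \<phi>_in[OF \<psi>_in[OF z]] z])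
        fix e f assume ef: "e \<in> I" "f \<in> I" "b e = b f"
        then have efP: "(e, f) \<in> ?P" by simp
        have "\<phi> (\<psi> z) (e, f) = (\<Oplus>\<sigma>\<in>?S. (\<Oplus>gh\<in>?P. z gh \<otimes> ?u (fst gh) (snd gh) \<sigma>) \<otimes> ?d e f \<sigma>)"
          using ef unfolding \<phi>_apply[OF ef] \<psi>_def
          by (intro finsum_cong') (auto intro!: finsum_closed m_closed zmem)
        also have "\<dots> = (\<Oplus>\<sigma>\<in>?S. \<Oplus>gh\<in>?P. z gh \<otimes> (?u (fst gh) (snd gh) \<sigma> \<otimes> ?d e f \<sigma>))"
        proof (intro finsum_cong' refl)
          fix \<sigma> assume "\<sigma> \<in> ?S"
          show "(\<Oplus>gh\<in>?P. z gh \<otimes> ?u (fst gh) (snd gh) \<sigma>) \<otimes> ?d e f \<sigma> =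
              (\<Oplus>gh\<in>?P. z gh \<otimes> (?u (fst gh) (snd gh) \<sigma> \<otimes> ?d e f \<sigma>))"
            by (subst finsum_ldistr[OF finP]) (auto intro!: finsum_cong' simp: zmem m_assoc)
        qed (auto intro!: finsum_closed m_closed zmem)
        also have "\<dots> = (\<Oplus>gh\<in>?P. \<Oplus>\<sigma>\<in>?S. z gh \<otimes> (?u (fst gh) (snd gh) \<sigma> \<otimes> ?d e f \<sigma>))"
          by (intro finsum_swap finS finP) (auto intro!: m_closed zmem)
        also have "\<dots> = (\<Oplus>gh\<in>?P. if gh = (e, f) then z (e, f) else \<zero>)"
        proof (intro finsum_cong' refl)
          fix gh assume gh: "gh \<in> ?P"
          have "(\<Oplus>\<sigma>\<in>?S. z gh \<otimes> (?u (fst gh) (snd gh) \<sigma> \<otimes> ?d e f \<sigma>)) =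
              z gh \<otimes> (\<Oplus>\<sigma>\<in>?S. ?u (fst gh) (snd gh) \<sigma> \<otimes> ?d e f \<sigma>)"
            by (rule finsum_rdistr[symmetric, OF finS zmem[OF gh]]) auto
          also have "(\<Oplus>\<sigma>\<in>?S. ?u (fst gh) (snd gh) \<sigma> \<otimes> ?d e f \<sigma>) =
              rat_embed R (\<Sum>\<sigma>\<in>?S. U (fst gh) (snd gh) \<sigma> * D e f \<sigma>)"
            by (simp add: rat_embed_sum rat_embed_mult)
          also have "z gh \<otimes> \<dots> = (if gh = (e, f) then z (e, f) else \<zero>)"
            using gh ef UD[of "fst gh" "snd gh" e f] zmem[OF gh] by (cases gh) auto
          finally show "(\<Oplus>\<sigma>\<in>?S. z gh \<otimes> (?u (fst gh) (snd gh) \<sigma> \<otimes> ?d e f \<sigma>)) =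
              (if gh = (e, f) then z (e, f) else \<zero>)" .
        qed (use zmem[OF efP] in auto)
        also have "\<dots> = z (e, f)"
          using finsum_delta[OF finP efP, of "\<lambda>gh. if gh = (e, f) then z (e, f) else \<zero>"] zmem[OF efP] by simp
        finally show "\<phi> (\<psi> z) (e, f) = z (e, f)" .
      qed
    qed
    show "\<phi> ` carrier ?A \<subseteq> ?P \<rightarrow>\<^sub>E carrier R" by (rule image_subsetI) (rule \<phi>_in)
    show "\<psi> ` (?P \<rightarrow>\<^sub>E carrier R) \<subseteq> carrier ?A" by (rule image_subsetI) (rule \<psi>_in)
  qed
  have mult: "\<phi> (x \<otimes>\<^bsub>?A\<^esub> y) (e, f) = (\<Oplus>g\<in>{g \<in> I. b g = b e}. \<phi> x (e, g) \<otimes> \<phi> y (g, f))"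
    if xy: "x \<in> carrier ?A" "y \<in> carrier ?A" and ef: "e \<in> I" "f \<in> I" "b e = b f" for x y e f
  proof -
    let ?L = "{g \<in> I. b g = b e}"
    have finL: "finite ?L" using I by simp
    note mems = mem[OF xy(1)] mem[OF xy(2)]
    have cl: "inv\<^bsub>?G\<^esub> \<alpha> \<otimes>\<^bsub>?G\<^esub> \<sigma> \<in> ?S" if "\<alpha> \<in> ?S" "\<sigma> \<in> ?S" for \<alpha> \<sigma>
      by (intro G.m_closed G.inv_closed that)
    have "\<phi> (x \<otimes>\<^bsub>?A\<^esub> y) (e, f) =
        (\<Oplus>\<sigma>\<in>?S. (\<Oplus>\<alpha>\<in>?S. x \<alpha> \<otimes> y (inv\<^bsub>?G\<^esub> \<alpha> \<otimes>\<^bsub>?G\<^esub> \<sigma>)) \<otimes> ?d e f \<sigma>)"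
      unfolding \<phi>_apply[OF ef] by (intro finsum_cong') (auto intro!: finsum_closed m_closed mems cl simp del: sym_group_inv_equality)
    also have "\<dots> = (\<Oplus>\<sigma>\<in>?S. \<Oplus>\<alpha>\<in>?S. x \<alpha> \<otimes> y (inv\<^bsub>?G\<^esub> \<alpha> \<otimes>\<^bsub>?G\<^esub> \<sigma>) \<otimes> ?d e f \<sigma>)"
      by (intro finsum_cong') (auto intro!: finsum_ldistr finS finsum_closed m_closed mems cl simp del: sym_group_inv_equality)
    also have "\<dots> = (\<Oplus>\<alpha>\<in>?S. \<Oplus>\<sigma>\<in>?S. x \<alpha> \<otimes> y (inv\<^bsub>?G\<^esub> \<alpha> \<otimes>\<^bsub>?G\<^esub> \<sigma>) \<otimes> ?d e f \<sigma>)"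
      by (intro finsum_swap finS) (auto intro!: m_closed mems cl simp del: sym_group_inv_equality)
    also have "\<dots> = (\<Oplus>\<alpha>\<in>?S. \<Oplus>\<tau>\<in>?S. \<Oplus>g\<in>?L. (x \<alpha> \<otimes> ?d e g \<alpha>) \<otimes> (y \<tau> \<otimes> ?d g f \<tau>))"
    proof (rule finsum_cong'[OF refl])
      fix \<alpha> assume \<alpha>: "\<alpha> \<in> ?S"
      \<comment> \<open>Substituting \<alpha> times \<tau> for \<sigma> separates the two factors of
        the convolution, after which \<open>D_mult\<close> splits the matrix coefficient.\<close>
      have bij': "bij_betw (\<lambda>\<tau>. \<alpha> \<otimes>\<^bsub>?G\<^esub> \<tau>) ?S ?S"
      proof (rule bij_betw_byWitness[of _ "\<lambda>\<tau>. inv\<^bsub>?G\<^esub> \<alpha> \<otimes>\<^bsub>?G\<^esub> \<tau>"])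
        show "\<forall>\<tau>\<in>?S. inv\<^bsub>?G\<^esub> \<alpha> \<otimes>\<^bsub>?G\<^esub> (\<alpha> \<otimes>\<^bsub>?G\<^esub> \<tau>) = \<tau>" "\<forall>\<tau>\<in>?S. \<alpha> \<otimes>\<^bsub>?G\<^esub> (inv\<^bsub>?G\<^esub> \<alpha> \<otimes>\<^bsub>?G\<^esub> \<tau>) = \<tau>"
          using \<alpha> G.inv_closed[OF \<alpha>] G.l_inv[OF \<alpha>] G.r_inv[OF \<alpha>] by (metis G.m_assoc G.l_one)+
      qed (auto intro!: G.m_closed G.inv_closed \<alpha> simp del: sym_group_inv_equality)
      have "(\<Oplus>\<sigma>\<in>?S. x \<alpha> \<otimes> y (inv\<^bsub>?G\<^esub> \<alpha> \<otimes>\<^bsub>?G\<^esub> \<sigma>) \<otimes> ?d e f \<sigma>) =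
          (\<Oplus>\<tau>\<in>?S. x \<alpha> \<otimes> y (inv\<^bsub>?G\<^esub> \<alpha> \<otimes>\<^bsub>?G\<^esub> (\<alpha> \<otimes>\<^bsub>?G\<^esub> \<tau>)) \<otimes> ?d e f (\<alpha> \<otimes>\<^bsub>?G\<^esub> \<tau>))"
        by (rule finsum_reindex_bij[OF bij']) (auto intro!: m_closed mems cl \<alpha> simp del: sym_group_inv_equality)
      also have "\<dots> = (\<Oplus>\<tau>\<in>?S. \<Oplus>g\<in>?L. (x \<alpha> \<otimes> ?d e g \<alpha>) \<otimes> (y \<tau> \<otimes> ?d g f \<tau>))"
      proof (intro finsum_cong' refl)
        fix \<tau> assume \<tau>: "\<tau> \<in> ?S"
        have \<beta>: "inv\<^bsub>?G\<^esub> \<alpha> \<otimes>\<^bsub>?G\<^esub> (\<alpha> \<otimes>\<^bsub>?G\<^esub> \<tau>) = \<tau>"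
          using \<alpha> \<tau> G.inv_closed[OF \<alpha>] G.l_inv[OF \<alpha>] by (metis G.m_assoc G.l_one)
        have "?d e f (\<alpha> \<otimes>\<^bsub>?G\<^esub> \<tau>) = (\<Oplus>g\<in>?L. ?d e g \<alpha> \<otimes> ?d g f \<tau>)"
          using D_mult[OF ef \<alpha> \<tau>] by (simp add: sym_group_mult rat_embed_sum rat_embed_mult)
        then have "x \<alpha> \<otimes> y \<tau> \<otimes> ?d e f (\<alpha> \<otimes>\<^bsub>?G\<^esub> \<tau>) = (\<Oplus>g\<in>?L. (x \<alpha> \<otimes> y \<tau>) \<otimes> (?d e g \<alpha> \<otimes> ?d g f \<tau>))"
          using \<alpha> \<tau> by (simp only:) (rule finsum_rdistr[OF finL]; auto intro!: m_closed mems)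
        also have "\<dots> = (\<Oplus>g\<in>?L. (x \<alpha> \<otimes> ?d e g \<alpha>) \<otimes> (y \<tau> \<otimes> ?d g f \<tau>))"
          using \<alpha> \<tau> by (intro finsum_cong') (auto simp: mems m_ac)
        finally show "x \<alpha> \<otimes> y (inv\<^bsub>?G\<^esub> \<alpha> \<otimes>\<^bsub>?G\<^esub> (\<alpha> \<otimes>\<^bsub>?G\<^esub> \<tau>)) \<otimes> ?d e f (\<alpha> \<otimes>\<^bsub>?G\<^esub> \<tau>) =
            (\<Oplus>g\<in>?L. (x \<alpha> \<otimes> ?d e g \<alpha>) \<otimes> (y \<tau> \<otimes> ?d g f \<tau>))"
          unfolding \<beta> .
      qed (use \<alpha> in \<open>auto intro!: finsum_closed m_closed mems\<close>)
      finally show "(\<Oplus>\<sigma>\<in>?S. x \<alpha> \<otimes> y (inv\<^bsub>?G\<^esub> \<alpha> \<otimes>\<^bsub>?G\<^esub> \<sigma>) \<otimes> ?d e f \<sigma>) =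
          (\<Oplus>\<tau>\<in>?S. \<Oplus>g\<in>?L. (x \<alpha> \<otimes> ?d e g \<alpha>) \<otimes> (y \<tau> \<otimes> ?d g f \<tau>))" .
    qed (auto intro!: finsum_closed m_closed mems)
    also have "\<dots> = (\<Oplus>\<alpha>\<in>?S. \<Oplus>g\<in>?L. \<Oplus>\<tau>\<in>?S. (x \<alpha> \<otimes> ?d e g \<alpha>) \<otimes> (y \<tau> \<otimes> ?d g f \<tau>))"
      by (intro finsum_cong' refl finsum_swap finS finL) (auto intro!: finsum_closed m_closed mems)
    also have "\<dots> = (\<Oplus>g\<in>?L. \<Oplus>\<alpha>\<in>?S. \<Oplus>\<tau>\<in>?S. (x \<alpha> \<otimes> ?d e g \<alpha>) \<otimes> (y \<tau> \<otimes> ?d g f \<tau>))"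
      by (intro finsum_swap finS finL) (auto intro!: finsum_closed m_closed mems)
    also have "\<dots> = (\<Oplus>g\<in>?L. (\<Oplus>\<alpha>\<in>?S. x \<alpha> \<otimes> ?d e g \<alpha>) \<otimes> (\<Oplus>\<tau>\<in>?S. y \<tau> \<otimes> ?d g f \<tau>))"
    proof (intro finsum_cong' refl)
      fix g assume "g \<in> ?L"
      have "(\<Oplus>\<alpha>\<in>?S. x \<alpha> \<otimes> ?d e g \<alpha>) \<otimes> (\<Oplus>\<tau>\<in>?S. y \<tau> \<otimes> ?d g f \<tau>) =
          (\<Oplus>\<alpha>\<in>?S. (x \<alpha> \<otimes> ?d e g \<alpha>) \<otimes> (\<Oplus>\<tau>\<in>?S. y \<tau> \<otimes> ?d g f \<tau>))"
        by (rule finsum_ldistr[OF finS]) (auto intro!: finsum_closed m_closed mems)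
      also have "\<dots> = (\<Oplus>\<alpha>\<in>?S. \<Oplus>\<tau>\<in>?S. (x \<alpha> \<otimes> ?d e g \<alpha>) \<otimes> (y \<tau> \<otimes> ?d g f \<tau>))"
        by (intro finsum_cong' refl finsum_rdistr[OF finS]) (auto intro!: finsum_closed m_closed mems)
      finally show "(\<Oplus>\<alpha>\<in>?S. \<Oplus>\<tau>\<in>?S. (x \<alpha> \<otimes> ?d e g \<alpha>) \<otimes> (y \<tau> \<otimes> ?d g f \<tau>)) =
          (\<Oplus>\<alpha>\<in>?S. x \<alpha> \<otimes> ?d e g \<alpha>) \<otimes> (\<Oplus>\<tau>\<in>?S. y \<tau> \<otimes> ?d g f \<tau>)" ..
    qed (auto intro!: finsum_closed m_closed mems)
    also have "\<dots> = (\<Oplus>g\<in>?L. \<phi> x (e, g) \<otimes> \<phi> y (g, f))"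
      using ef by (intro finsum_cong') (auto simp: \<phi>_apply intro!: finsum_closed m_closed mems)
    finally show ?thesis .
  qed
  have "block_coordinates R ?A I b \<phi>"
  proof (intro block_coordinates.intro alg block_coordinates_axioms.intro bij mult I; assumption?)
    fix e f assume ef: "e \<in> I" "f \<in> I" "b e = b f"
    show "\<phi> (x \<oplus>\<^bsub>?A\<^esub> y) (e, f) = \<phi> x (e, f) \<oplus> \<phi> y (e, f)" if "x \<in> carrier ?A" "y \<in> carrier ?A" for x y
    proof -
      note mems = mem[OF that(1)] mem[OF that(2)]
      have "\<phi> (x \<oplus>\<^bsub>?A\<^esub> y) (e, f) = (\<Oplus>\<sigma>\<in>?S. x \<sigma> \<otimes> ?d e f \<sigma> \<oplus> y \<sigma> \<otimes> ?d e f \<sigma>)"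
        unfolding \<phi>_apply[OF ef] by (intro finsum_cong') (auto simp: mems l_distr)
      also have "\<dots> = \<phi> x (e, f) \<oplus> \<phi> y (e, f)"
        unfolding \<phi>_apply[OF ef] by (intro finsum_addf) (auto simp: mems)
      finally show ?thesis .
    qed
    show "\<phi> (a \<odot>\<^bsub>?A\<^esub> x) (e, f) = a \<otimes> \<phi> x (e, f)" if "a \<in> carrier R" "x \<in> carrier ?A" for a x
    proof -
      have "\<phi> (a \<odot>\<^bsub>?A\<^esub> x) (e, f) = (\<Oplus>\<sigma>\<in>?S. a \<otimes> (x \<sigma> \<otimes> ?d e f \<sigma>))"
        unfolding \<phi>_apply[OF ef] using that by (intro finsum_cong') (auto simp: mem[OF that(2)] m_assoc)
      also have "\<dots> = a \<otimes> \<phi> x (e, f)"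
        unfolding \<phi>_apply[OF ef] using that by (intro finsum_rdistr[symmetric] finS) (auto simp: mem[OF that(2)])
      finally show ?thesis .
    qed
    show "\<phi> \<one>\<^bsub>?A\<^esub> (e, f) = (if e = f then \<one> else \<zero>)"
    proof -
      have id: "id \<in> ?S" by (simp add: sym_group_carrier permutes_id)
      have "\<phi> \<one>\<^bsub>?A\<^esub> (e, f) = \<one>\<^bsub>?A\<^esub> id \<otimes> ?d e f id"
        unfolding \<phi>_apply[OF ef] using id
        by (intro finsum_delta finS) (auto simp: free_basis_def sym_group_one)
      then show ?thesis
        using id D_one[OF ef] by (simp add: free_basis_def sym_group_one)
    qed
  qed
  then show ?thesis by blast
qed

text \<open>Block coordinates pass from the group algebras to matrices over them and to the finite
  direct sum, and from there back along the canonical isomorphism. The index sets have the same type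
  for every \<open>r\<close>, so the coordinates can be chosen for all \<open>r\<close> at
  once.\<close>

lemma split_semisimple_mB_algebra:
  assumes "field k" "char_zero k"
  shows "split_semisimple k (mB_algebra k p)"
proof -
  \<comment> \<open>The conclusion mentions no numbering of diagrams, so an arbitrary one may be
    fixed.\<close>
  obtain e where e: "enumeration e" using enumeration_exists by blast
  interpret F: char_zero_field k using assms by (simp add: char_zero_field_def char_zero_field_axioms_def)
  interpret E: enumerated_diagrams k e using F.is_cring e by (simp add: enumerated_diagrams_def)
  have "\<exists>(K :: (nat \<times> fperm galg) set) (b :: _ \<Rightarrow> fperm galg) \<phi>.
      block_coordinates k (matrix_algebra (group_algebra k (sym_group r)) (mono_count p r)) K b \<phi>" for r
    using F.block_coordinates_sym_group[of r] block_coordinates_matrix by blast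
  then obtain K :: "nat \<Rightarrow> (nat \<times> fperm galg) set" and b :: "nat \<Rightarrow> _ \<Rightarrow> fperm galg" and \<phi>
    where bc: "\<And>r. block_coordinates k (matrix_algebra (group_algebra k (sym_group r)) (mono_count p r)) (K r) (b r) (\<phi> r)"
    by metis
  have "split_semisimple k (E.matrix_algebra_sum p)"
    by (rule block_coordinates.coord_split_semisimple[OF block_coordinates_direct_sum[OF F.is_cring E.finite_parity bc]])
  then obtain N n \<psi> where "\<forall>i<N::nat. n i > 0"
    "algebra_iso k (E.matrix_algebra_sum p) (direct_sum {..<N} (\<lambda>i. matrix_algebra (ground_algebra k) (n i))) \<psi>"
    unfolding split_semisimple_def by blast
  then show ?thesis
    unfolding split_semisimple_def using algebra_iso_trans[OF E.canonical_algebra_iso] by blast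
qed

theorem proposition6p10:
  fixes k :: "('k, 'm) ring_scheme" and p q :: nat
  assumes "cring k"
  shows
    "(\<forall>r. r \<preceq> p \<longrightarrow>
        (\<exists>n. free_of_rank k (up_module k r p) n \<and>
             of_nat (mono_count p r) = (of_nat n / fact r :: rat))) \<and>
     (\<forall>e. enumeration e \<longrightarrow>
        (\<exists>\<phi>. module_iso k (mB_hom k p q)
               (direct_sum {r. r \<preceq> p \<and> r \<preceq> q}
                  (\<lambda>r. matrix_module (group_algebra k (sym_group r)) (mono_count q r) (mono_count p r))) \<phi> \<and>
             canonical_on_basis k e p q \<phi>)) \<and>
     (\<forall>e. enumeration e \<longrightarrow>
        (\<exists>\<phi>. algebra_iso k (mB_algebra k p)
               (direct_sum {r. r \<preceq> p}
                  (\<lambda>r. matrix_algebra (group_algebra k (sym_group r)) (mono_count p r))) \<phi> \<and>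
             canonical_on_basis k e p p \<phi>)) \<and>
     (field k \<and> char_zero k \<longrightarrow> split_semisimple k (mB_algebra k p))"
proof (intro conjI allI impI)
  fix r
  have "of_nat (mono_count p r) = (of_nat (card (brauer_up r p)) / fact r :: rat)"
    by (simp add: mono_count_fact[symmetric])
  moreover have "free_of_rank k (up_module k r p) (card (brauer_up r p))"
    unfolding up_module_def
    by (rule free_of_rank_card[OF assms]) (simp add: brauer_up_def finite_brauer)
  ultimately show "\<exists>n. free_of_rank k (up_module k r p) n \<and> of_nat (mono_count p r) = (of_nat n / fact r :: rat)"
    by blast
next
  fix e assume "enumeration e"
  then interpret enumerated_diagrams k e using assms by (simp add: enumerated_diagrams_def)
  show "\<exists>\<phi>. module_iso k (mB_hom k p q) (matrix_sum p q) \<phi> \<and> canonical_on_basis k e p q \<phi>"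
    using canonical_module_iso canonical_canonical_on_basis by blast
  show "\<exists>\<phi>. algebra_iso k (mB_algebra k p) (matrix_algebra_sum p) \<phi> \<and> canonical_on_basis k e p p \<phi>"
    using canonical_algebra_iso canonical_canonical_on_basis by blast
next
  assume "field k \<and> char_zero k"
  then show "split_semisimple k (mB_algebra k p)"
    using split_semisimple_mB_algebra by blast
qed

end
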